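(* Let $f_i^\varepsilon$, $i=1,\dots,4$, be the Maxwellian-form solutions of the scaled kinetic system described in the context. Then, formally in the limit $\varepsilon\to0$, the number density of each constituent satisfies $$\frac{\partial n_i}{\partial t}+\nabla_{\boldsymbol x}\cdot(n_i\boldsymbol u_i)=-\lambda_iA,\qquad i=1,2,3,4,$$ where $n_i=\lim_{\varepsilon\to0}n_i^\varepsilon$, $\boldsymbol u_i=\lim_{\varepsilon\to0}\boldsymbol u_i^\varepsilon$, $\lambda_1=\lambda_2=1$, $\lambda_3=\lambda_4=-1$, and $A$ (the production term defining the chemical rate of the reactants of the backward reaction) is the formal limit for $\varepsilon\to0$ of $$ \begin{aligned} A^\varepsilon=&\left[\Big(\frac{m_3m_4}{m_1m_2}\Big)^{3/2}\frac{n_1^\varepsilon n_2^\varepsilon}{q_1(T)q_2(T)}\exp\Big(-\frac{E}{k_BT}\Big)-\frac{n_3^\varepsilon n_4^\varepsilon}{q_3(T)q_4(T)}\right]\frac{4}{\sqrt\pi\,(m_3m_4)^2}\Big(\frac{2k_BT}{\mu_{34}}\Big)^{(\gamma-1)/2}\Gamma\Big(\frac{\gamma+2}{2}\Big)\\ &\times\int_0^{+\infty}\!\!\int_0^{+\infty}\!\!\int_0^1\!\!\int_0^1\!\!\int_{\mathbb S^2}\exp\Big(-\frac{I+I_4}{k_BT}\Big)\Phi^{react}(I,I_4,R,r)\,b^{react}(\cos\theta)\cos\theta\,(1-R)\,d\sigma\,dr\,dR\,dI_4\,dI+O(\varepsilon). \end{aligned} $$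
   Context: **Mixture.** Four polyatomic species $A_1,\dots,A_4$ undergo the reversible reaction $A_1+A_2\rightleftharpoons A_3+A_4$. They have masses $m_i>0$ with $m_1+m_2=m_3+m_4=M$, binding energies $E_i$, reaction heat $E=E_3+E_4-E_1-E_2$, reduced masses $\mu_{ij}=m_im_j/(m_i+m_j)$, and nonnegative weights $\varphi_i(I)$ on $[0,\infty)$; $k_B$ is the Boltzmann constant and $q_i(T)=\int_0^{+\infty}\varphi_i(I)e^{-I/(k_BT)}dI$. The distribution functions $f_i(t,\boldsymbol x,\boldsymbol v,I)$ depend on $t>0$, $\boldsymbol x\in\Omega\subset\mathbb R^3$ (open bounded, regular boundary), $\boldsymbol v\in\mathbb R^3$, $I\ge0$. The primed quantities below are post-collisional. **Elastic operators.** For a pair $(\boldsymbol v,I)$ (species $i$) and $(\boldsymbol v_j,I_j)$ (species $j$), parameters $R,r\in[0,1]$, $\sigma\in\mathbb S^2$, let $\mathcal E=\frac12\mu_{ij}|\boldsymbol v-\boldsymbol v_j|^2+I+I_j$ and $$\boldsymbol v_i'=\tfrac{m_i\boldsymbol v+m_j\boldsymbol v_j}{m_i+m_j}+\tfrac{m_j}{m_i+m_j}\sqrt{\tfrac{2R\mathcal E}{\mu_{ij}}}\,\sigma,\quad \boldsymbol v_j'=\tfrac{m_i\boldsymbol v+m_j\boldsymbol v_j}{m_i+m_j}-\tfrac{m_i}{m_i+m_j}\sqrt{\tfrac{2R\mathcal E}{\mu_{ij}}}\,\sigma,\quad I_i'=r(1-R)\mathcal E,\quad I_j'=(1-r)(1-R)\mathcal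 E.$$ Then $$Q^e_{ij}(f_i,f_j)=\int_{\mathbb R^3}\!\int_0^\infty\!\!\int_0^1\!\!\int_0^1\!\!\int_{\mathbb S^2}[f_i(\boldsymbol v_i',I_i')f_j(\boldsymbol v_j',I_j')-f_i(\boldsymbol v,I)f_j(\boldsymbol v_j,I_j)]\,B_{ij}\,\frac{2\cos\theta\,(1-R)}{|\boldsymbol v-\boldsymbol v_j|\,\varphi_i(I)}\,d\sigma\,dr\,dR\,dI_j\,d\boldsymbol v_j,$$ and for $i=j$ the same formula is used with the second particle labelled $i_*$ (species $i$). Here $\sigma=\boldsymbol y-2(\omega\cdot\boldsymbol y)\omega$ with $\boldsymbol y=(\boldsymbol v-\boldsymbol v_j)/|\boldsymbol v-\boldsymbol v_j|$, $\omega\in\mathbb S^2$, and $\cos\theta=|\omega\cdot\boldsymbol y|$. **Reactive operators.** For $(i,j,k,l)\in\{(1,2,3,4),(2,1,4,3)\}$ (forward, put $s=-1$) or $\{(3,4,1,2),(4,3,2,1)\}$ (backward, put $s=+1$), let $\mathcal E^*=\frac12\mu_{ij}|\boldsymbol v-\boldsymbol v_j|^2+I+I_j+s\frac E2$, $$\boldsymbol v_k'=\tfrac{m_i\boldsymbol v+m_j\boldsymbol v_j}{M}+\tfrac{m_l}{M}\sqrt{\tfrac2{\mu_{kl}}}\big(R\mathcal E^*+s\tfrac E6\big)^{1/2}\sigma,\qquad \boldsymbol v_l'=\tfrac{m_i\boldsymbol v+m_j\boldsymbol v_j}{M}-\tfrac{m_k}{M}\sqrt{\tfrac2{\mu_{kl}}}\big(R\mathcal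 E^*+s\tfrac E6\big)^{1/2}\sigma,$$ $I_k'=r(1-R)\mathcal E^*+s\frac E6$, $I_l'=(1-r)(1-R)\mathcal E^*+s\frac E6$ (with $r$ and $1-r$ interchanged if $i\in\{2,4\}$). Then $$Q_i^{react}=\int_{\mathbb R^3}\!\int_0^\infty\!\!\int_0^1\!\!\int_0^1\!\!\int_{\mathbb S^2}\Big[\Big(\tfrac{m_im_j}{m_km_l}\Big)^3f_k(\boldsymbol v_k',I_k')f_l(\boldsymbol v_l',I_l')-f_i(\boldsymbol v,I)f_j(\boldsymbol v_j,I_j)\Big]H_iB^{react}\frac{2\cos\theta(1-R)}{(m_im_j)^2|\boldsymbol v-\boldsymbol v_j|\varphi_i(I)}\,d\sigma\,dr\,dR\,dI_j\,d\boldsymbol v_j,$$ where $H_3=H_4=1$, and for $i=1,2$, $H_i$ is the indicator function of the set where $I\ge\frac E6$, $I_j\ge\frac E6$, $R\mathcal E^*\ge\frac E6$, $\frac{\mu_{12}}2|\boldsymbol v-\boldsymbol v_j|^2\ge\frac E6$, $(1-R)r\mathcal E^*\ge\frac E6$, $(1-R)(1-r)\mathcal E^*\ge\frac E6$. **Kernels.** $B_{ij}=|\boldsymbol v-\boldsymbol v_j|^\gamma\Phi_{ij}(I,I_j,R,r)\,b_{ij}(\cos\theta)$ and $B^{react}=|\boldsymbol v-\boldsymbol v_j|^\gamma\Phi^{react}(I,I_j,R,r)\,b^{react}(\cos\theta)$ with $\gamma\ge1$. The kernels are assumed to have the reversibility symmetries of the model, so that the following known properties hold: $\int\!\!\int Q^e_{ij}\varphi_i\,dI\,d\boldsymbol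 v=0$ for all $i,j$; and $\int\!\!\int Q_1^{react}\varphi_1=\int\!\!\int Q_2^{react}\varphi_2=-\int\!\!\int Q_3^{react}\varphi_3=-\int\!\!\int Q_4^{react}\varphi_4$ (integrals in $dI\,d\boldsymbol v$ over $[0,\infty)\times\mathbb R^3$). **Scaled system and assumptions.** For $0<\varepsilon\ll1$, $$\varepsilon\,\partial_tf_i^\varepsilon+\boldsymbol v\cdot\nabla_{\boldsymbol x}f_i^\varepsilon=\frac1\varepsilon\sum_{j=1}^4Q^e_{ij}(f_i^\varepsilon,f_j^\varepsilon)+\varepsilon Q_i^{react},\qquad i=1,\dots,4,$$ where $Q_i^{react}$ is evaluated at $(f_1^\varepsilon,\dots,f_4^\varepsilon)$. It is assumed that for all $t\geq 0$ $$f_i^\varepsilon=\frac{n_i^\varepsilon}{q_i(T+\varepsilon T_i^\varepsilon)}\Big(\frac{m_i}{2\pi k_B(T+\varepsilon T_i^\varepsilon)}\Big)^{3/2}\exp\Big[-\frac{m_i|\boldsymbol v-\varepsilon\boldsymbol u_i^\varepsilon|^2+2I}{2k_B(T+\varepsilon T_i^\varepsilon)}\Big]$$ for some positive functions $n_i^\varepsilon,T_i^\varepsilon,T$ and $\mathbb R^3$-valued functions $\boldsymbol u_i^\varepsilon$ of $(t,\boldsymbol x)$ ($T$ independent of $\varepsilon$ and $i$), with $\boldsymbol u_i^\varepsilon=O(1)$, $T_i^\varepsilon=O(1)$ and $n_i^\varepsilon\to n_i$, $\boldsymbol u_i^\varepsilon\to\boldsymbol u_i$ as $\varepsilon\to0$.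 **"Formal".** All functions are taken smooth enough, all integrals convergent, Taylor expansions in $\varepsilon$ may be integrated term by term, and the limit $\varepsilon\to0$ may be exchanged with derivatives and integrals. *)

theory Defs
  imports "HOL-Analysis.Analysis" "HOL-Library.Landau_Symbols"
begin

type_synonym vec3 = "real^3"

definition half_line :: "real measure" where
  "half_line = restrict_space lborel {0..}"

definition unit_interval :: "real measure" where
  "unit_interval = restrict_space lborel {0..1}"

text \<open>The surface measure of the unit sphere of three-dimensional space, as a Borel measure
  concentrated on the sphere: the area of a piece of the sphere is three times the volume of the
  cone that it spans with the origin.\<close>

definition sphere_measure :: "vec3 measure" where
  "sphere_measure = scale_measure 3 (distr (restrict_space lborel (ball 0 1)) borel sgn)"

lemma emeasure_sphere_measure_UNIV: "emeasure sphere_measure UNIV = ennreal (4 * pi)"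
proof -
  have [measurable]: "(sgn :: vec3 \<Rightarrow> vec3) \<in> borel_measurable (restrict_space lborel (ball 0 1))"
  proof -
    have "(sgn :: vec3 \<Rightarrow> vec3) \<in> borel_measurable lborel"
      unfolding sgn_div_norm by measurable
    then show ?thesis
      by (rule measurable_restrict_space1)
  qed
  have "emeasure (distr (restrict_space lborel (ball (0::vec3) 1)) borel sgn) UNIV
      = emeasure lborel (ball (0::vec3) 1)"
    by (simp add: emeasure_distr emeasure_restrict_space space_restrict_space)
  also have "\<dots> = ennreal (4 / 3 * pi)"
    by (simp add: emeasure_ball unit_ball_vol_3)
  finally show ?thesis
    by (simp add: sphere_measure_def ennreal_mult[symmetric] flip: ennreal_numeral)
qed

text \<open>Integration variables: (velocity, internal energy), and
  (velocity and internal energy of the partner, R, r, sigma).\<close>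

definition state_measure :: "(vec3 \<times> real) measure" where
  "state_measure = lborel \<Otimes>\<^sub>M half_line"

definition collision_measure :: "(vec3 \<times> real \<times> real \<times> real \<times> vec3) measure" where
  "collision_measure =
     lborel \<Otimes>\<^sub>M half_line \<Otimes>\<^sub>M unit_interval \<Otimes>\<^sub>M unit_interval \<Otimes>\<^sub>M sphere_measure"

definition parameter_measure :: "(real \<times> real \<times> real \<times> real \<times> vec3) measure" where
  "parameter_measure =
     half_line \<Otimes>\<^sub>M half_line \<Otimes>\<^sub>M unit_interval \<Otimes>\<^sub>M unit_interval \<Otimes>\<^sub>M sphere_measure"

text \<open>The integration variable is \<open>\<sigma> = y - 2 (\<omega> \<bullet> y) \<omega>\<close>, so \<open>\<omega>\<close> is, up to sign, the
  direction of \<open>y - \<sigma>\<close>; the lemmas below show that \<open>cos \<theta> = |\<omega> \<bullet> y|\<close> is thereby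
  determined by \<open>y\<close> and \<open>\<sigma>\<close>.\<close>

definition cos_theta :: "vec3 \<Rightarrow> vec3 \<Rightarrow> real" where
  "cos_theta y \<sigma> = \<bar>sgn (y - \<sigma>) \<bullet> y\<bar>"

lemma cos_theta_reflection:
  assumes "norm \<omega> = 1" and "\<sigma> = y - (2 * (\<omega> \<bullet> y)) *\<^sub>R \<omega>"
  shows "cos_theta y \<sigma> = \<bar>\<omega> \<bullet> y\<bar>"
proof -
  have "sgn (y - \<sigma>) = sgn (2 * (\<omega> \<bullet> y)) *\<^sub>R \<omega>"
    using assms by (simp add: sgn_scaleR) (simp add: sgn_div_norm)
  then show ?thesis
    by (simp add: cos_theta_def abs_mult sgn_mult abs_sgn_eq)
qed

lemma reflection_exists:
  fixes y \<sigma> :: vec3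
  assumes "norm y = 1" and "norm \<sigma> = 1" and "y \<noteq> \<sigma>"
  shows "norm (sgn (y - \<sigma>)) = 1"
    and "\<sigma> = y - (2 * (sgn (y - \<sigma>) \<bullet> y)) *\<^sub>R sgn (y - \<sigma>)"
proof -
  show "norm (sgn (y - \<sigma>)) = 1"
    using assms by (simp add: norm_sgn)
  have 1: "y \<bullet> y = 1" "\<sigma> \<bullet> \<sigma> = 1"
    using assms by (simp_all add: dot_square_norm)
  have "(norm (y - \<sigma>))\<^sup>2 = 2 * ((y - \<sigma>) \<bullet> y)"
    using 1 by (simp add: power2_norm_eq_inner inner_diff inner_commute)
  then have "(2 * (sgn (y - \<sigma>) \<bullet> y)) *\<^sub>R sgn (y - \<sigma>) = y - \<sigma>"
    using assms by (auto simp: sgn_div_norm power2_eq_square divide_simps)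
  then show "\<sigma> = y - (2 * (sgn (y - \<sigma>) \<bullet> y)) *\<^sub>R sgn (y - \<sigma>)"
    by simp
qed

definition reduced_mass :: "(nat \<Rightarrow> real) \<Rightarrow> nat \<Rightarrow> nat \<Rightarrow> real" where
  "reduced_mass m i j = m i * m j / (m i + m j)"

definition mass_center :: "(nat \<Rightarrow> real) \<Rightarrow> nat \<Rightarrow> nat \<Rightarrow> vec3 \<Rightarrow> vec3 \<Rightarrow> vec3" where
  "mass_center m i j v w = (m i / (m i + m j)) *\<^sub>R v + (m j / (m i + m j)) *\<^sub>R w"

definition collision_energy ::
    "(nat \<Rightarrow> real) \<Rightarrow> nat \<Rightarrow> nat \<Rightarrow> vec3 \<Rightarrow> real \<Rightarrow> vec3 \<Rightarrow> real \<Rightarrow> real" where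
  "collision_energy m i j v I w J = reduced_mass m i j * (norm (v - w))\<^sup>2 / 2 + I + J"

definition kernel ::
    "real \<Rightarrow> (real \<Rightarrow> real \<Rightarrow> real \<Rightarrow> real \<Rightarrow> real) \<Rightarrow> (real \<Rightarrow> real)
     \<Rightarrow> vec3 \<Rightarrow> real \<Rightarrow> vec3 \<Rightarrow> real \<Rightarrow> real \<Rightarrow> real \<Rightarrow> vec3 \<Rightarrow> real" where
  "kernel \<gamma> \<Phi> b v I w J R r \<sigma> =
     norm (v - w) powr \<gamma> * \<Phi> I J R r * b (cos_theta (sgn (v - w)) \<sigma>)"

definition elastic_integrand ::
    "(nat \<Rightarrow> real) \<Rightarrow> (nat \<Rightarrow> real \<Rightarrow> real) \<Rightarrow> real
     \<Rightarrow> (nat \<Rightarrow> nat \<Rightarrow> real \<Rightarrow> real \<Rightarrow> real \<Rightarrow> real \<Rightarrow> real) \<Rightarrow> (nat \<Rightarrow> nat \<Rightarrow> real \<Rightarrow> real)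
     \<Rightarrow> nat \<Rightarrow> nat \<Rightarrow> (vec3 \<Rightarrow> real \<Rightarrow> real) \<Rightarrow> (vec3 \<Rightarrow> real \<Rightarrow> real)
     \<Rightarrow> vec3 \<Rightarrow> real \<Rightarrow> vec3 \<times> real \<times> real \<times> real \<times> vec3 \<Rightarrow> real" where
  "elastic_integrand m \<phi> \<gamma> \<Phi> b i j f g v I = (\<lambda>(w, J, R, r, \<sigma>).
     let \<mu> = reduced_mass m i j;
         G = mass_center m i j v w;
         \<E> = collision_energy m i j v I w J;
         v' = G + (m j / (m i + m j) * sqrt (2 * R * \<E> / \<mu>)) *\<^sub>R \<sigma>;
         w' = G - (m i / (m i + m j) * sqrt (2 * R * \<E> / \<mu>)) *\<^sub>R \<sigma>;
         I' = r * (1 - R) * \<E>;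
         J' = (1 - r) * (1 - R) * \<E>
     in (f v' I' * g w' J' - f v I * g w J)
        * kernel \<gamma> (\<Phi> i j) (b i j) v I w J R r \<sigma>
        * (2 * cos_theta (sgn (v - w)) \<sigma> * (1 - R) / (norm (v - w) * \<phi> i I)))"

definition Q_elastic ::
    "(nat \<Rightarrow> real) \<Rightarrow> (nat \<Rightarrow> real \<Rightarrow> real) \<Rightarrow> real
     \<Rightarrow> (nat \<Rightarrow> nat \<Rightarrow> real \<Rightarrow> real \<Rightarrow> real \<Rightarrow> real \<Rightarrow> real) \<Rightarrow> (nat \<Rightarrow> nat \<Rightarrow> real \<Rightarrow> real)
     \<Rightarrow> nat \<Rightarrow> nat \<Rightarrow> (vec3 \<Rightarrow> real \<Rightarrow> real) \<Rightarrow> (vec3 \<Rightarrow> real \<Rightarrow> real)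
     \<Rightarrow> vec3 \<Rightarrow> real \<Rightarrow> real" where
  "Q_elastic m \<phi> \<gamma> \<Phi> b i j f g v I =
     integral\<^sup>L collision_measure (elastic_integrand m \<phi> \<gamma> \<Phi> b i j f g v I)"

definition reaction_heat :: "(nat \<Rightarrow> real) \<Rightarrow> real" where
  "reaction_heat Eb = Eb 3 + Eb 4 - Eb 1 - Eb 2"

text \<open>The triple \<open>(j, k, l)\<close> belonging to species \<open>i\<close>: the other reactant and the two products.\<close>

definition reaction_partners :: "nat \<Rightarrow> nat \<times> nat \<times> nat" where
  "reaction_partners i =
     (if i = 1 then (2, 3, 4) else if i = 2 then (1, 4, 3)
      else if i = 3 then (4, 1, 2) else (3, 2, 1))"

definition reaction_sign :: "nat \<Rightarrow> real" where
  "reaction_sign i = (if i \<in> {1, 2} then -1 else 1)"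

definition threshold ::
    "(nat \<Rightarrow> real) \<Rightarrow> real \<Rightarrow> real \<Rightarrow> nat \<Rightarrow> vec3 \<Rightarrow> real \<Rightarrow> vec3 \<Rightarrow> real \<Rightarrow> real \<Rightarrow> real \<Rightarrow> real" where
  "threshold m E \<E> i v I w J R r =
     (if i \<in> {1, 2} then
        of_bool (I \<ge> E / 6 \<and> J \<ge> E / 6 \<and> R * \<E> \<ge> E / 6
          \<and> reduced_mass m 1 2 / 2 * (norm (v - w))\<^sup>2 \<ge> E / 6
          \<and> (1 - R) * r * \<E> \<ge> E / 6 \<and> (1 - R) * (1 - r) * \<E> \<ge> E / 6)
      else 1)"

definition react_integrand ::
    "(nat \<Rightarrow> real) \<Rightarrow> real \<Rightarrow> (nat \<Rightarrow> real \<Rightarrow> real) \<Rightarrow> real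
     \<Rightarrow> (real \<Rightarrow> real \<Rightarrow> real \<Rightarrow> real \<Rightarrow> real) \<Rightarrow> (real \<Rightarrow> real)
     \<Rightarrow> (nat \<Rightarrow> vec3 \<Rightarrow> real \<Rightarrow> real) \<Rightarrow> nat
     \<Rightarrow> vec3 \<Rightarrow> real \<Rightarrow> vec3 \<times> real \<times> real \<times> real \<times> vec3 \<Rightarrow> real" where
  "react_integrand m E \<phi> \<gamma> \<Phi> b f i v I = (\<lambda>(w, J, R, r, \<sigma>).
     let (j, k, l) = reaction_partners i;
         s = reaction_sign i;
         M = m 1 + m 2;
         \<mu> = reduced_mass m k l;
         G = mass_center m i j v w;
         \<E> = collision_energy m i j v I w J + s * E / 2;
         r' = (if i \<in> {2, 4} then 1 - r else r);
         vk = G + (m l / M * sqrt (2 / \<mu>) * sqrt (R * \<E> + s * E / 6)) *\<^sub>R \<sigma>;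
         vl = G - (m k / M * sqrt (2 / \<mu>) * sqrt (R * \<E> + s * E / 6)) *\<^sub>R \<sigma>;
         Ik = r' * (1 - R) * \<E> + s * E / 6;
         Il = (1 - r') * (1 - R) * \<E> + s * E / 6
     in ((m i * m j / (m k * m l)) ^ 3 * (f k vk Ik * f l vl Il) - f i v I * f j w J)
        * threshold m E \<E> i v I w J R r
        * kernel \<gamma> \<Phi> b v I w J R r \<sigma>
        * (2 * cos_theta (sgn (v - w)) \<sigma> * (1 - R)
           / ((m i * m j)\<^sup>2 * norm (v - w) * \<phi> i I)))"

definition Q_react ::
    "(nat \<Rightarrow> real) \<Rightarrow> real \<Rightarrow> (nat \<Rightarrow> real \<Rightarrow> real) \<Rightarrow> real
     \<Rightarrow> (real \<Rightarrow> real \<Rightarrow> real \<Rightarrow> real \<Rightarrow> real) \<Rightarrow> (real \<Rightarrow> real)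
     \<Rightarrow> (nat \<Rightarrow> vec3 \<Rightarrow> real \<Rightarrow> real) \<Rightarrow> nat \<Rightarrow> vec3 \<Rightarrow> real \<Rightarrow> real" where
  "Q_react m E \<phi> \<gamma> \<Phi> b f i v I =
     integral\<^sup>L collision_measure (react_integrand m E \<phi> \<gamma> \<Phi> b f i v I)"

definition moment :: "(real \<Rightarrow> real) \<Rightarrow> (vec3 \<Rightarrow> real \<Rightarrow> real) \<Rightarrow> real" where
  "moment \<phi> g = (\<integral>(v, I). g v I * \<phi> I \<partial>state_measure)"

definition moment_converges :: "(real \<Rightarrow> real) \<Rightarrow> (vec3 \<Rightarrow> real \<Rightarrow> real) \<Rightarrow> bool" where
  "moment_converges \<phi> g \<longleftrightarrow> integrable state_measure (\<lambda>(v, I). g v I * \<phi> I)"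

definition partition_fun :: "real \<Rightarrow> (real \<Rightarrow> real) \<Rightarrow> real \<Rightarrow> real" where
  "partition_fun kB \<phi> \<tau> = (\<integral>I. \<phi> I * exp (- I / (kB * \<tau>)) \<partial>half_line)"

text \<open>Arguments: Boltzmann constant, mass, weight, number density, temperature, mean velocity.\<close>

definition maxwellian ::
    "real \<Rightarrow> real \<Rightarrow> (real \<Rightarrow> real) \<Rightarrow> real \<Rightarrow> real \<Rightarrow> vec3 \<Rightarrow> vec3 \<Rightarrow> real \<Rightarrow> real" where
  "maxwellian kB m \<phi> n \<tau> u v I =
     n / partition_fun kB \<phi> \<tau> * (m / (2 * pi * kB * \<tau>)) powr (3 / 2)
     * exp (- (m * (norm (v - u))\<^sup>2 + 2 * I) / (2 * kB * \<tau>))"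

definition divergence :: "(vec3 \<Rightarrow> vec3) \<Rightarrow> vec3 \<Rightarrow> real" where
  "divergence F x = (\<Sum>a\<in>UNIV. frechet_derivative F (at x) (axis a 1) $ a)"

definition stoich :: "nat \<Rightarrow> real" where
  "stoich i = (if i \<in> {1, 2} then 1 else -1)"

text \<open>By rotation invariance the integral below does not depend on the unit vector \<open>y\<close> from which
  the angle \<open>\<theta>\<close> of \<open>\<sigma>\<close> is measured.\<close>

definition rate_integrand ::
    "real \<Rightarrow> (real \<Rightarrow> real \<Rightarrow> real \<Rightarrow> real \<Rightarrow> real) \<Rightarrow> (real \<Rightarrow> real) \<Rightarrow> vec3 \<Rightarrow> real
     \<Rightarrow> real \<times> real \<times> real \<times> real \<times> vec3 \<Rightarrow> real" where
  "rate_integrand kB \<Phi> b y \<tau> = (\<lambda>(I, J, R, r, \<sigma>).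
     exp (- (I + J) / (kB * \<tau>)) * \<Phi> I J R r * b (cos_theta y \<sigma>) * cos_theta y \<sigma> * (1 - R))"

definition leading_rate ::
    "real \<Rightarrow> (nat \<Rightarrow> real) \<Rightarrow> real \<Rightarrow> (nat \<Rightarrow> real \<Rightarrow> real) \<Rightarrow> real
     \<Rightarrow> (real \<Rightarrow> real \<Rightarrow> real \<Rightarrow> real \<Rightarrow> real) \<Rightarrow> (real \<Rightarrow> real) \<Rightarrow> vec3
     \<Rightarrow> real \<Rightarrow> (nat \<Rightarrow> real) \<Rightarrow> real" where
  "leading_rate kB m E \<phi> \<gamma> \<Phi> b y \<tau> n =
     (let q = (\<lambda>i. partition_fun kB (\<phi> i) \<tau>) in
       ((m 3 * m 4 / (m 1 * m 2)) powr (3 / 2) * (n 1 * n 2 / (q 1 * q 2)) * exp (- E / (kB * \<tau>))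
          - n 3 * n 4 / (q 3 * q 4))
       * (4 / (sqrt pi * (m 3 * m 4)\<^sup>2))
       * (2 * kB * \<tau> / reduced_mass m 3 4) powr ((\<gamma> - 1) / 2)
       * Gamma ((\<gamma> + 2) / 2)
       * integral\<^sup>L parameter_measure (rate_integrand kB \<Phi> b y \<tau>))"

end

theory Submission
  imports Defs
begin

text \<open>
  Integrating the kinetic equation against \<open>\<phi>\<^sub>i\<close> kills the elastic operators. For a Maxwellian with drift
  \<open>\<epsilon> u\<close> the moment of \<open>\<epsilon> \<partial>\<^sub>t f + v \<bullet> \<nabla>\<^sub>x f\<close> is \<open>\<epsilon> (\<partial>\<^sub>t n + \<nabla> \<bullet> (n u))\<close>: after centring at \<open>\<epsilon> u\<close>, the temperature
  gradient contributes only odd Gaussian moments and the derivative of a total mass, and the drift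
  gradient contributes its trace. Hence the reactive moments converge, and reversibility reduces the
  four species to the third one. The rate is obtained for the backward reaction of species 3, which has no
  threshold: replacing the Maxwellians by Maxwellians at rest at the common temperature \<open>T\<close> costs
  \<open>O(\<epsilon>)\<close> times the integrable weight \<open>exp (- H / (2 kB T))\<close>, \<open>H\<close> being the total energy, and at
  common temperature conservation of energy makes the bracket a constant multiple of
  a Gaussian in the velocities. The integral then factorizes into a Gamma integral over the relative velocity and an
  angular integral that is independent of the relative direction by rotation invariance.
\<close>

section \<open>Rotation invariance and radial integrals\<close>

text \<open>The temperature and the partition functions vary in time and space, so the transport
  moment needs the derivative of a partition function, and the rate needs a perturbation bound
  uniform over all velocities and internal energies. Drift and temperature change the exponent of a
  Maxwellian by at most a multiple of \<open>\<epsilon> * (1 + h)\<close>, where \<open>h\<close> is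
  the energy of one particle; the unbounded factor is paid for by half of the decay. What remains is
  a Boltzmann factor at temperature 2T, and the rate integral, assumed to converge at every
  temperature, makes it integrable against the kernel. In the constant of the rate,
  \<open>Gamma ((\<gamma> + 2) / 2)\<close> comes from the moment of order
  \<open>\<gamma> - 1\<close> of a Gaussian in three dimensions; the cube of the mass ratio drops to
  the power 3/2 because the Maxwellian normalizations bring the inverse ratio to the power 3/2. The
  limiting rate itself is read off the transport side of species 3, where convergence is assumed;
  the explicit formula enters through the comparison at positive epsilon.\<close>

lemma distr_lborel_orthogonal:
  fixes \<rho> :: "vec3 \<Rightarrow> vec3"
  assumes "orthogonal_transformation \<rho>"
  shows "distr lborel borel \<rho> = lborel"
proof (rule lborel_eqI[symmetric])
  have lin: "linear \<rho>" and bij: "bij \<rho>"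
    using assms by (auto simp: orthogonal_transformation_linear orthogonal_transformation_bij)
  have meas: "\<rho> \<in> borel_measurable borel"
    using lin by (intro borel_measurable_continuous_onI linear_continuous_on)
      (simp add: linear_conv_bounded_linear)
  have inv: "orthogonal_transformation (inv \<rho>)"
    using assms by (rule orthogonal_transformation_inv)
  \<comment> \<open>Boxes determine Lebesgue measure, and the preimage of a box is its image under
    the inverse map, which is again orthogonal.\<close>
  fix l u :: vec3
  assume lu: "\<And>b. b \<in> Basis \<Longrightarrow> l \<bullet> b \<le> u \<bullet> b"
  have vimage: "\<rho> -` box l u = inv \<rho> ` box l u"
    using bij by (simp add: bij_vimage_eq_inv_image)
  have "emeasure (distr lborel borel \<rho>) (box l u) = emeasure lborel (inv \<rho> ` box l u)"
    using meas by (simp add: emeasure_distr vimage)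
  also have "\<dots> = emeasure lebesgue (inv \<rho> ` box l u)"
    using measurable_sets[OF meas, of "box l u"] by (simp add: vimage)
  also have "\<dots> = ennreal (measure lebesgue (inv \<rho> ` box l u))"
    using measurable_orthogonal_image[OF inv, of "box l u"]
    by (simp add: emeasure_eq_measure2 fmeasurableD2)
  also have "\<dots> = ennreal (measure lebesgue (box l u))"
    by (subst measure_orthogonal_image[OF inv]) auto
  also have "\<dots> = ennreal (\<Prod>b\<in>Basis. (u - l) \<bullet> b)"
    using lu by (simp add: measure_lborel_box_eq)
  finally show "emeasure (distr lborel borel \<rho>) (box l u) = (\<Prod>b\<in>Basis. (u - l) \<bullet> b)" .
qed simp

lemma borel_measurable_orthogonal:
  fixes \<rho> :: "vec3 \<Rightarrow> vec3"
  assumes "orthogonal_transformation \<rho>"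
  shows "\<rho> \<in> borel_measurable borel"
  using assms
  by (intro borel_measurable_continuous_onI linear_continuous_on)
    (simp add: linear_conv_bounded_linear[symmetric] orthogonal_transformation_linear)

section \<open>Surface measure of the sphere and the scattering angle\<close>

lemma borel_measurable_sgn_vec3 [measurable]: "(sgn :: vec3 \<Rightarrow> vec3) \<in> borel_measurable borel"
  unfolding sgn_div_norm by measurable

lemma sets_sphere_measure [simp, measurable_cong]: "sets sphere_measure = sets borel"
  by (simp add: sphere_measure_def)

lemma space_sphere_measure [simp]: "space sphere_measure = UNIV"
  by (simp add: sets_eq_imp_space_eq[of sphere_measure borel])

lemma borel_measurable_sgn_ball [measurable]:
  "(sgn :: vec3 \<Rightarrow> vec3) \<in> borel_measurable (restrict_space lborel (ball 0 1))"
  by (rule measurable_restrict_space1) simp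

lemma emeasure_sphere_measure:
  assumes "S \<in> sets borel"
  shows "emeasure sphere_measure S = 3 * emeasure lborel (ball 0 1 \<inter> sgn -` S)"
proof -
  have "sgn -` S \<inter> ball 0 1 = ball 0 1 \<inter> (sgn -` S :: vec3 set)" by auto
  moreover have "(sgn -` S :: vec3 set) \<in> sets borel"
    using measurable_sets[OF borel_measurable_sgn_vec3 assms] by simp
  ultimately show ?thesis using assms
    by (simp add: sphere_measure_def emeasure_distr emeasure_restrict_space space_restrict_space)
qed

lemma finite_measure_sphere: "finite_measure sphere_measure"
  by (rule finite_measureI) (simp add: emeasure_sphere_measure_UNIV)

text \<open>The measure is defined on the whole space and has to be located on the sphere. The
  origin is the only point of the ball that \<open>sgn\<close> does not send to a unit vector, and a
  point has volume zero.\<close>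

lemma AE_sphere_measure_norm: "AE \<sigma> in sphere_measure. norm \<sigma> = 1"
proof (rule AE_I)
  show "{\<sigma> \<in> space sphere_measure. norm \<sigma> \<noteq> 1} \<subseteq> {\<sigma>. norm \<sigma> \<noteq> 1}" by auto
  show S: "{\<sigma>. norm \<sigma> \<noteq> 1} \<in> sets sphere_measure" by simp
  have "ball 0 1 \<inter> sgn -` {\<sigma>. norm \<sigma> \<noteq> 1} = {0 :: vec3}"
    by (auto simp: norm_sgn)
  with S show "emeasure sphere_measure {\<sigma>. norm \<sigma> \<noteq> 1} = 0"
    by (simp add: emeasure_sphere_measure)
qed

text \<open>\<open>sgn\<close> commutes with orthogonal maps and the unit ball is invariant, so the
  cone over a rotated set is the rotated cone, and the invariance of Lebesgue measure carries
  over.\<close>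

lemma distr_sphere_measure_orthogonal:
  assumes \<rho>: "orthogonal_transformation \<rho>"
  shows "distr sphere_measure sphere_measure \<rho> = sphere_measure"
proof (rule measure_eqI)
  fix S assume "S \<in> sets (distr sphere_measure sphere_measure \<rho>)"
  then have S: "S \<in> sets borel" by simp
  note [measurable] = borel_measurable_orthogonal[OF \<rho>]
  have sgn: "sgn (\<rho> v) = \<rho> (sgn v)" for v
    using \<rho> by (simp add: sgn_div_norm orthogonal_transformation_norm
        linear_scale orthogonal_transformation_linear)
  have eq: "ball 0 1 \<inter> sgn -` (\<rho> -` S) = \<rho> -` (ball 0 1 \<inter> sgn -` S)"
    using \<rho> by (auto simp: sgn orthogonal_transformation_norm)
  have pre: "\<rho> -` S \<in> sets borel"
    using measurable_sets[OF borel_measurable_orthogonal[OF \<rho>] S] by simp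
  have B: "ball 0 1 \<inter> sgn -` S \<in> sets (borel :: vec3 measure)"
    using measurable_sets[OF borel_measurable_sgn_vec3 S] by simp
  have "emeasure (distr sphere_measure sphere_measure \<rho>) S = emeasure sphere_measure (\<rho> -` S)"
    using S by (subst emeasure_distr) auto
  also have "\<dots> = 3 * emeasure (distr lborel borel \<rho>) (ball 0 1 \<inter> sgn -` S)"
    using B by (simp add: emeasure_sphere_measure[OF pre] eq emeasure_distr)
  also have "\<dots> = emeasure sphere_measure S"
    by (simp add: distr_lborel_orthogonal[OF \<rho>] emeasure_sphere_measure[OF S])
  finally show "emeasure (distr sphere_measure sphere_measure \<rho>) S = emeasure sphere_measure S" .
qed simp

lemma cos_theta_orthogonal:
  assumes "orthogonal_transformation \<rho>"
  shows "cos_theta (\<rho> y) (\<rho> \<sigma>) = cos_theta y \<sigma>"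
proof -
  have "sgn (\<rho> y - \<rho> \<sigma>) = \<rho> (sgn (y - \<sigma>))"
    using assms by (simp add: sgn_div_norm orthogonal_transformation_norm linear_diff[symmetric]
        linear_scale orthogonal_transformation_linear)
  then show ?thesis
    using assms by (simp add: cos_theta_def orthogonal_transformation_def)
qed

lemma cos_theta_le_norm: "cos_theta y \<sigma> \<le> norm y"
proof -
  have "\<bar>sgn (y - \<sigma>) \<bullet> y\<bar> \<le> norm (sgn (y - \<sigma>)) * norm y"
    by (rule Cauchy_Schwarz_ineq2)
  also have "\<dots> \<le> 1 * norm y"
    by (intro mult_right_mono) (auto simp: norm_sgn)
  finally show ?thesis by (simp add: cos_theta_def)
qed

lemma cos_theta_sgn_bounds: "0 \<le> cos_theta (sgn g) \<sigma>" "cos_theta (sgn g) \<sigma> \<le> 1"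
  using cos_theta_le_norm[of "sgn g" \<sigma>] by (auto simp: cos_theta_def norm_sgn split: if_splits)

section \<open>Measures of internal energies and collision parameters\<close>

lemma sigma_finite_half_line: "sigma_finite_measure half_line"
  unfolding half_line_def by (rule sigma_finite_measure_restrict_space) (auto intro: sigma_finite_lborel)

lemma finite_measure_unit_interval: "finite_measure unit_interval"
  unfolding unit_interval_def by (rule finite_measureI) (simp add: emeasure_restrict_space space_restrict_space)

lemma space_half_line [simp]: "space half_line = {0..}"
  by (simp add: half_line_def space_restrict_space)

lemma space_unit_interval [simp]: "space unit_interval = {0..1}"
  by (simp add: unit_interval_def space_restrict_space)

lemma borel_measurable_half_line_ident: "(\<lambda>x. x) \<in> borel_measurable half_line"
  unfolding half_line_def by (rule measurable_restrict_space1) simp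

lemma borel_measurable_unit_interval_ident: "(\<lambda>x. x) \<in> borel_measurable unit_interval"
  unfolding unit_interval_def by (rule measurable_restrict_space1) simp

section \<open>Gaussian integrals in polar coordinates\<close>

definition radial_density :: "real \<Rightarrow> real \<Rightarrow> real" where
  "radial_density a t = (if 0 \<le> t then 2 * pi * a powr (- 3 / 2) * sqrt t else 0)"

text \<open>Polar coordinates as an image measure. The set
  \<open>a * (norm g)\<^sup>2 \<le> s\<close> is a ball of radius \<open>sqrt (s / a)\<close>, and
  \<open>radial_density a\<close> is the derivative of its volume with respect to \<open>s\<close>.
  The two measures are compared on the half-lines \<open>{..s}\<close>, which generate the Borel
  sets.\<close>

lemma distr_lborel_norm_square:
  assumes a: "0 < a"
  shows "distr lborel borel (\<lambda>g :: vec3. a * (norm g)\<^sup>2) = density lborel (radial_density a)"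
    (is "?M = ?N")
proof -
  have [measurable]: "radial_density a \<in> borel_measurable borel"
    unfolding radial_density_def by measurable
  \<comment> \<open>The value is recorded together with the equality, because the uniqueness theorem
    also asks for finite measure on the exhausting half-lines.\<close>
  have emeas: "emeasure ?M {..s} = ennreal (if 0 \<le> s then 4 / 3 * pi * a powr (- 3 / 2) * s powr (3 / 2) else 0)
    \<and> emeasure ?N {..s} = emeasure ?M {..s}" for s
  proof (cases "0 \<le> s")
    case False
    then have *: "(\<lambda>g :: vec3. a * (norm g)\<^sup>2) -` {..s} = {}"
      using a by (auto simp: not_le) (meson less_le_trans mult_nonneg_nonneg not_less order_less_imp_le zero_le_power2)
    have "(\<integral>\<^sup>+ t. ennreal (radial_density a t) * indicator {..s} t \<partial>lborel) = (\<integral>\<^sup>+ (t :: real). 0 \<partial>lborel)"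
      using False by (intro nn_integral_cong) (auto simp: radial_density_def split: split_indicator)
    then have "emeasure ?N {..s} = 0"
      by (subst emeasure_density) auto
    with False show ?thesis by (simp add: emeasure_distr *)
  next
    case True
    have *: "(\<lambda>g :: vec3. a * (norm g)\<^sup>2) -` {..s} = cball 0 (sqrt (s / a))"
      using a True by (auto simp: real_le_rsqrt field_simps intro: real_sqrt_ge_zero)
        (metis mult.commute pos_le_divide_eq real_sqrt_le_iff real_sqrt_abs abs_norm_cancel real_sqrt_divide)+
    have c: "sqrt (s / a) ^ 3 = a powr (- 3 / 2) * s powr (3 / 2)"
    proof -
      have "sqrt (s / a) ^ 3 = ((s / a) powr (1 / 2)) ^ 3"
        using a True by (simp add: powr_half_sqrt)
      also have "\<dots> = (s / a) powr (3 / 2)"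
        using a True by (cases "s = 0") (simp_all add: powr_realpow[symmetric] powr_powr)
      also have "\<dots> = a powr (- 3 / 2) * s powr (3 / 2)"
        using a True by (simp add: powr_divide powr_minus divide_simps)
      finally show ?thesis .
    qed
    have M: "emeasure ?M {..s} = ennreal (4 / 3 * pi * a powr (- 3 / 2) * s powr (3 / 2))"
      using a True by (simp add: emeasure_distr * emeasure_cball unit_ball_vol_3 c mult.assoc)
    define F where "F = (\<lambda>t. 4 / 3 * pi * a powr (- 3 / 2) * t powr (3 / 2))"
    have "emeasure ?N {..s} = (\<integral>\<^sup>+ t. ennreal (radial_density a t) * indicator {0..s} t \<partial>lborel)"
    proof -
      have "ennreal (radial_density a t) * indicator {..s} t
          = ennreal (radial_density a t) * indicator {0..s} t" for t
        by (auto simp: radial_density_def split: split_indicator)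
      then show ?thesis by (subst emeasure_density) auto
    qed
    also have "\<dots> = (\<integral>\<^sup>+ t. ennreal (radial_density a t * indicator {0..s} t) \<partial>lborel)"
      by (auto intro!: nn_integral_cong split: split_indicator)
    also have "\<dots> = ennreal (F s - F 0)"
    proof (rule nn_integral_has_integral_lborel)
      show "((\<lambda>t. radial_density a t * indicator {0..s} t) has_integral F s - F 0) UNIV"
      proof -
        have "(radial_density a has_integral F s - F 0) {0..s}"
        \<comment> \<open>At the endpoint 0 this form asks only for continuity; the derivative rule
          for \<open>powr\<close> covers positive arguments.\<close>
        proof (rule fundamental_theorem_of_calculus_interior[OF True])
          show "continuous_on {0..s} F"
            unfolding F_def by (intro continuous_on_mult continuous_on_const continuous_on_powr' continuous_on_id) auto
          fix t assume "t \<in> {0<..<s}"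
          then show "(F has_vector_derivative radial_density a t) (at t)"
            unfolding F_def radial_density_def has_real_derivative_iff_has_vector_derivative[symmetric]
            by (auto intro!: derivative_eq_intros simp: powr_half_sqrt)
        qed
        then have "((\<lambda>t. if t \<in> {0..s} then radial_density a t else 0) has_integral F s - F 0) UNIV"
          by (subst has_integral_restrict_UNIV)
        then show ?thesis
          by (rule has_integral_eq[rotated]) (auto split: split_indicator)
      qed
    qed (auto simp: radial_density_def split: split_indicator)
    finally have "emeasure ?N {..s} = ennreal (F s)"
      by (simp add: F_def)
    with M True show ?thesis by (simp add: F_def)
  qed
  show ?thesis
  proof (rule measure_eqI_generator_eq[where E = "range atMost" and \<Omega> = UNIV
        and A = "\<lambda>i. {..real i}"])
    show "Int_stable (range (atMost :: real \<Rightarrow> _))"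
      by (auto simp: Int_stable_def)
    show "sets ?M = sigma_sets UNIV (range atMost)" "sets ?N = sigma_sets UNIV (range atMost)"
      by (simp_all add: borel_eq_atMost)
    show "(\<Union>i. {..real i}) = UNIV"
      using real_arch_simple by auto
    show "emeasure ?M {..real i} \<noteq> \<infinity>" for i
      using emeas[of "real i"] by simp
    show "\<And>X. X \<in> range atMost \<Longrightarrow> emeasure ?M X = emeasure ?N X"
      using emeas by auto
  qed auto
qed

text \<open>The variable \<open>t = a * (norm g)\<^sup>2\<close> turns the integral into Euler's
  integral: \<open>p / 2\<close> powers of \<open>t\<close> come from the factor
  \<open>norm g powr p\<close> and a further 1/2 from the radial density, which gives the argument
  \<open>(p + 3) / 2\<close>.\<close>

lemma nn_integral_gaussian_powr:
  fixes a p :: real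
  assumes a: "0 < a" and p: "0 \<le> p"
  shows "(\<integral>\<^sup>+ g. ennreal (exp (- a * (norm (g :: vec3))\<^sup>2) * norm g powr p) \<partial>lborel)
    = ennreal (2 * pi * a powr (- (p + 3) / 2) * Gamma ((p + 3) / 2))"
proof -
  have [measurable]: "radial_density a \<in> borel_measurable borel"
    unfolding radial_density_def by measurable
  define k where "k = (\<lambda>t. ennreal (exp (- t) * (t / a) powr (p / 2)))"
  have [measurable]: "k \<in> borel_measurable borel" unfolding k_def by measurable
  have np: "norm g powr p = ((norm g)\<^sup>2) powr (p / 2)" for g :: vec3
  proof (cases "g = 0")
    case False
    then have "((norm g)\<^sup>2) powr (p / 2) = (norm g powr 2) powr (p / 2)" by simp
    also have "\<dots> = norm g powr p" by (subst powr_powr) simp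
    finally show ?thesis by simp
  qed simp
  have "(\<integral>\<^sup>+ g. ennreal (exp (- a * (norm (g :: vec3))\<^sup>2) * norm g powr p) \<partial>lborel)
      = (\<integral>\<^sup>+ g. k (a * (norm (g :: vec3))\<^sup>2) \<partial>lborel)"
    using a unfolding k_def np by (intro nn_integral_cong) simp
  also have "\<dots> = (\<integral>\<^sup>+ t. k t \<partial>distr lborel borel (\<lambda>g :: vec3. a * (norm g)\<^sup>2))"
    by (simp add: nn_integral_distr)
  also have "\<dots> = (\<integral>\<^sup>+ t. ennreal (radial_density a t) * k t \<partial>lborel)"
    by (simp add: distr_lborel_norm_square[OF a] nn_integral_density)
  also have "\<dots> = (\<integral>\<^sup>+ t. ennreal (2 * pi * a powr (- (p + 3) / 2)) *
      ennreal (indicator {0..} t * t powr ((p + 3) / 2 - 1) / exp t) \<partial>lborel)"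
  proof (intro nn_integral_cong)
    fix t :: real
    show "ennreal (radial_density a t) * k t = ennreal (2 * pi * a powr (- (p + 3) / 2)) *
      ennreal (indicator {0..} t * t powr ((p + 3) / 2 - 1) / exp t)"
    proof (cases "0 < t")
      case True
      have 1: "t powr ((p + 3) / 2 - 1) = t powr (p / 2) * sqrt t"
        using True by (simp add: powr_half_sqrt[symmetric] powr_add[symmetric] field_simps)
      have 2: "a powr (- (p + 3) / 2) = a powr (- 3 / 2) / a powr (p / 2)"
      proof -
        have "- (p + 3) / 2 = - 3 / 2 - p / 2" by (simp add: field_simps)
        then show ?thesis by (simp only: powr_diff)
      qed
      show ?thesis
        using True a unfolding 1 2 k_def radial_density_def
        by (simp add: ennreal_mult[symmetric] powr_divide exp_minus field_simps)
    next
      case False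
      then show ?thesis using p
        by (cases "t = 0") (auto simp: k_def radial_density_def)
    qed
  qed
  also have "\<dots> = ennreal (2 * pi * a powr (- (p + 3) / 2)) * ennreal (Gamma ((p + 3) / 2))"
    using p by (simp add: nn_integral_cmult Gamma_conv_nn_integral_real)
  also have "\<dots> = ennreal (2 * pi * a powr (- (p + 3) / 2) * Gamma ((p + 3) / 2))"
    using p by (simp add: ennreal_mult Gamma_real_nonneg)
  finally show ?thesis .
qed

section \<open>Gaussian moments\<close>

text \<open>The normal density with mean zero and variance \<open>1 / (2 * a)\<close> in each
  coordinate; the velocity part of a Maxwellian has
  \<open>a = m / (2 * kB * \<tau>)\<close>.\<close>

definition gaussian :: "real \<Rightarrow> vec3 \<Rightarrow> real" where
  "gaussian a w = (a / pi) powr (3 / 2) * exp (- a * (norm w)\<^sup>2)"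

lemma gaussian_nonneg [simp]: "0 \<le> gaussian a w"
  by (simp add: gaussian_def)

lemma borel_measurable_gaussian [measurable]: "gaussian a \<in> borel_measurable borel"
  unfolding gaussian_def[abs_def] by measurable

text \<open>A real order is needed for the power \<open>\<gamma> - 1\<close> of the relative speed;
  the orders 0, 2 and 3 yield the normalization, the second moment and the cubic majorant
  below.\<close>

lemma has_bochner_integral_gaussian_powr:
  assumes a: "0 < a" and p: "0 \<le> p"
  shows "has_bochner_integral lborel (\<lambda>w. gaussian a w * norm w powr p)
    (2 / sqrt pi * a powr (- p / 2) * Gamma ((p + 3) / 2))"
proof -
  have "has_bochner_integral lborel (\<lambda>g :: vec3. exp (- a * (norm g)\<^sup>2) * norm g powr p)
      (2 * pi * a powr (- (p + 3) / 2) * Gamma ((p + 3) / 2))"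
    using p by (intro has_bochner_integral_nn_integral nn_integral_gaussian_powr a)
      (auto simp: Gamma_real_nonneg)
  then have "has_bochner_integral lborel (\<lambda>w. gaussian a w * norm w powr p)
      ((a / pi) powr (3 / 2) * (2 * pi * a powr (- (p + 3) / 2) * Gamma ((p + 3) / 2)))"
    unfolding gaussian_def mult.assoc by (rule has_bochner_integral_mult_right)
  moreover have "(a / pi) powr (3 / 2) * (2 * pi * a powr (- (p + 3) / 2))
      = 2 / sqrt pi * a powr (- p / 2)"
  proof -
    have 1: "a powr (3 / 2) * a powr (- (p + 3) / 2) = a powr (- p / 2)"
      by (simp add: powr_add[symmetric] field_simps)
    have 2: "pi powr (3 / 2) = pi * sqrt pi"
    proof -
      have "pi powr (3 / 2) = pi powr (1 + 1 / 2)" by simp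
      also have "\<dots> = pi * sqrt pi" by (subst powr_add) (simp add: powr_half_sqrt)
      finally show ?thesis .
    qed
    have "(a / pi) powr (3 / 2) * (2 * pi * a powr (- (p + 3) / 2))
      = 2 * pi / pi powr (3 / 2) * (a powr (3 / 2) * a powr (- (p + 3) / 2))"
      using a by (simp add: powr_divide)
    also have "\<dots> = 2 / sqrt pi * a powr (- p / 2)"
      unfolding 1 2 by simp
    finally show ?thesis .
  qed
  ultimately show ?thesis by (simp only: mult.assoc[symmetric])
qed

lemma Gamma_three_halves: "Gamma (3 / 2 :: real) = sqrt pi / 2"
  and Gamma_five_halves: "Gamma (5 / 2 :: real) = 3 / 4 * sqrt pi"
proof -
  have "x \<notin> \<int>\<^sub>\<le>\<^sub>0" if "0 < x" for x :: real
    using that by (auto simp: nonpos_Ints_def)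
  then have "Gamma (1 / 2 + 1 :: real) = 1 / 2 * Gamma (1 / 2)"
    "Gamma (3 / 2 + 1 :: real) = 3 / 2 * Gamma (3 / 2)"
    by (simp_all only: Gamma_plus1 zero_less_divide_iff zero_less_numeral zero_less_one simp_thms)
  then show "Gamma (3 / 2 :: real) = sqrt pi / 2" "Gamma (5 / 2 :: real) = 3 / 4 * sqrt pi"
    by (simp_all add: Gamma_one_half_real)
qed

lemma norm_powr_numeral: "norm (w :: 'a :: real_normed_vector) powr numeral k = norm w ^ numeral k"
  by (cases "w = 0") (simp_all add: powr_numeral)

lemma has_bochner_integral_gaussian:
  assumes "0 < a"
  shows "has_bochner_integral lborel (gaussian a) 1"
proof -
  have "has_bochner_integral lborel (\<lambda>w. gaussian a w * norm w powr 0) 1"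
  proof -
    show ?thesis
      using has_bochner_integral_gaussian_powr[OF assms, of 0] assms by (simp add: Gamma_three_halves)
  qed
  \<comment> \<open>Since \<open>0 powr 0\<close> is 0, the two integrands differ at the origin and
    agree only almost everywhere.\<close>
  moreover have "AE w in lborel. gaussian a w * norm w powr 0 = gaussian a w"
    using AE_lborel_singleton[of 0] by eventually_elim simp
  ultimately show ?thesis
    by (subst has_bochner_integral_cong_AE[symmetric]) auto
qed

lemma has_bochner_integral_gaussian_norm_square:
  assumes "0 < a"
  shows "has_bochner_integral lborel (\<lambda>w. gaussian a w * (norm w)\<^sup>2) (3 / (2 * a))"
proof -
  show ?thesis
    using has_bochner_integral_gaussian_powr[OF assms, of 2] assms
    by (simp add: Gamma_five_halves norm_powr_numeral powr_minus divide_simps)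
qed

lemma le_one_add_cube:
  fixes x :: real
  assumes "0 \<le> x"
  shows "x \<le> 1 + x ^ 3" "x\<^sup>2 \<le> 1 + x ^ 3"
proof (atomize (full), cases "x \<le> 1")
  case True
  then have "x\<^sup>2 \<le> 1" using assms by (simp add: power_le_one)
  moreover have "0 \<le> x ^ 3" using assms by simp
  ultimately show "x \<le> 1 + x ^ 3 \<and> x\<^sup>2 \<le> 1 + x ^ 3"
    using True by linarith
next
  case False
  then have "x ^ 1 \<le> x ^ 3" "x ^ 2 \<le> x ^ 3" by (intro power_increasing; simp)+
  then show "x \<le> 1 + x ^ 3 \<and> x\<^sup>2 \<le> 1 + x ^ 3" by simp
qed

text \<open>Cubic growth is the worst that occurs in the transport moment, where the quadratic
  kinetic energy multiplies the linear derivative of the temperature.\<close>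

lemma integrable_gaussian_mult:
  assumes a: "0 < a" and F: "F \<in> borel_measurable borel"
    and bound: "\<And>w. \<bar>F w\<bar> \<le> C * (1 + norm w ^ 3)"
  shows "integrable lborel (\<lambda>w. gaussian a w * F w)"
proof (rule Bochner_Integration.integrable_bound)
  have "integrable lborel (\<lambda>w. gaussian a w * norm w ^ 3)"
    using has_bochner_integral_gaussian_powr[OF a, of 3]
    by (simp add: norm_powr_numeral has_bochner_integral_iff)
  then show "integrable lborel (\<lambda>w. C * (gaussian a w + gaussian a w * norm w ^ 3))"
    using has_bochner_integral_gaussian[OF a] by (auto simp: has_bochner_integral_iff)
  show "(\<lambda>w. gaussian a w * F w) \<in> borel_measurable lborel"
    using F by measurable
  show "AE w in lborel. norm (gaussian a w * F w) \<le> norm (C * (gaussian a w + gaussian a w * norm w ^ 3))"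
  proof (rule AE_I2)
    fix w :: vec3
    have "\<bar>gaussian a w * F w\<bar> = gaussian a w * \<bar>F w\<bar>"
      by (simp add: abs_mult)
    also have "\<dots> \<le> gaussian a w * (C * (1 + norm w ^ 3))"
      by (intro mult_left_mono bound) simp
    also have "\<dots> = C * (gaussian a w + gaussian a w * norm w ^ 3)"
      by (simp add: algebra_simps)
    finally show "norm (gaussian a w * F w) \<le> norm (C * (gaussian a w + gaussian a w * norm w ^ 3))"
      by simp
  qed
qed

lemma integrable_gaussian_linear:
  assumes a: "0 < a" and l: "bounded_linear (l :: vec3 \<Rightarrow> real)"
  shows "integrable lborel (\<lambda>w. gaussian a w * l w)"
proof -
  obtain K where K: "\<And>w. \<bar>l w\<bar> \<le> norm w * K" "0 \<le> K"
    using bounded_linear.nonneg_bounded[OF l] by auto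
  show ?thesis
  proof (rule integrable_gaussian_mult[OF a])
    show "l \<in> borel_measurable borel"
      using l by (intro borel_measurable_continuous_onI linear_continuous_on)
    fix w :: vec3
    note K(1)[of w]
    also have "norm w * K \<le> (1 + norm w ^ 3) * K"
      using K(2) by (intro mult_right_mono le_one_add_cube) auto
    finally show "\<bar>l w\<bar> \<le> K * (1 + norm w ^ 3)" by (simp only: mult.commute)
  qed
qed

lemma integral_lborel_orthogonal:
  fixes F :: "vec3 \<Rightarrow> real" and \<rho> :: "vec3 \<Rightarrow> vec3"
  assumes \<rho>: "orthogonal_transformation \<rho>" and F: "F \<in> borel_measurable borel"
  shows "(\<integral>w. F (\<rho> w) \<partial>lborel) = (\<integral>w. F w \<partial>lborel)"
proof -
  have "(\<integral>w. F w \<partial>distr lborel borel \<rho>) = (\<integral>w. F (\<rho> w) \<partial>lborel)"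
    using F borel_measurable_orthogonal[OF \<rho>] by (intro integral_distr) auto
  then show ?thesis by (simp add: distr_lborel_orthogonal[OF \<rho>])
qed

text \<open>Reflection in the origin is orthogonal and fixes the Gaussian, so the integral equals
  its own negative.\<close>

lemma integral_gaussian_odd:
  assumes F: "F \<in> borel_measurable borel" and odd: "\<And>w. F (- w) = - F w"
  shows "(\<integral>w. gaussian a w * F w \<partial>lborel) = 0"
proof -
  have "(\<integral>w. gaussian a (- w) * F (- w) \<partial>lborel) = (\<integral>w. gaussian a w * F w \<partial>lborel)"
    using F by (intro integral_lborel_orthogonal) (auto simp: orthogonal_transformation_neg)
  then show ?thesis by (simp add: odd gaussian_def)
qed

text \<open>By homogeneity and rotation invariance the second moment in direction \<open>e\<close>
  is \<open>(norm e)\<^sup>2\<close> times one constant. Summing over the three axes gives the known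
  moment \<open>3 / (2 * a)\<close>, so the constant is a third of it.\<close>

lemma has_bochner_integral_gaussian_inner_square:
  assumes a: "0 < a"
  shows "has_bochner_integral lborel (\<lambda>w. gaussian a w * (w \<bullet> e)\<^sup>2) ((norm e)\<^sup>2 / (2 * a))"
proof -
  define S where "S = (\<lambda>e. \<integral>w. gaussian a w * (w \<bullet> e)\<^sup>2 \<partial>lborel)"
  have int: "integrable lborel (\<lambda>w. gaussian a w * (w \<bullet> e)\<^sup>2)" for e
  proof (rule integrable_gaussian_mult[OF a])
    fix w :: vec3
    have "(w \<bullet> e)\<^sup>2 \<le> (norm w * norm e)\<^sup>2"
      using Cauchy_Schwarz_ineq2[of w e] by (simp add: abs_le_square_iff[symmetric])
    also have "\<dots> \<le> (norm e)\<^sup>2 * (1 + norm w ^ 3)"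
    proof -
      have "(norm w)\<^sup>2 \<le> 1 + norm w ^ 3" by (simp add: le_one_add_cube)
      then have "(norm e)\<^sup>2 * (norm w)\<^sup>2 \<le> (norm e)\<^sup>2 * (1 + norm w ^ 3)"
        by (rule mult_left_mono) simp
      then show ?thesis by (simp only: power_mult_distrib mult.commute)
    qed
    finally show "\<bar>(w \<bullet> e)\<^sup>2\<bar> \<le> (norm e)\<^sup>2 * (1 + norm w ^ 3)" by simp
  qed measurable
  have rot: "S (\<rho> e) = S e" if "orthogonal_transformation \<rho>" for \<rho> :: "vec3 \<Rightarrow> vec3" and e
  proof -
    have "S (\<rho> e) = (\<integral>w. gaussian a (\<rho> w) * (\<rho> w \<bullet> \<rho> e)\<^sup>2 \<partial>lborel)"
      unfolding S_def by (rule integral_lborel_orthogonal[OF that, symmetric]) measurable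
    also have "\<dots> = S e"
      using that by (simp add: S_def gaussian_def orthogonal_transformation_norm)
        (simp add: orthogonal_transformation_def)
    finally show ?thesis .
  qed
  have scale: "S (c *\<^sub>R e) = c\<^sup>2 * S e" for c e
  proof -
    have "S (c *\<^sub>R e) = (\<integral>w. c\<^sup>2 * (gaussian a w * (w \<bullet> e)\<^sup>2) \<partial>lborel)"
      unfolding S_def by (intro Bochner_Integration.integral_cong) (auto simp: power_mult_distrib)
    then show ?thesis by (simp add: S_def)
  qed
  have unit: "S e = S (axis 1 1)" if "norm e = 1" for e
  proof -
    have "norm (axis 1 1 :: vec3) = norm e" using that by (simp add: norm_axis_1)
    then obtain \<rho> where "orthogonal_transformation \<rho>" "\<rho> (axis 1 1 :: vec3) = e"
      by (rule orthogonal_transformation_exists)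
    then show ?thesis using rot by metis
  qed
  have "(\<Sum>i\<in>UNIV. S (axis i 1)) = (\<integral>w. (\<Sum>i\<in>UNIV. gaussian a w * (w \<bullet> axis i 1)\<^sup>2) \<partial>lborel)"
    unfolding S_def by (intro Bochner_Integration.integral_sum[symmetric] int)
  also have "(\<lambda>w. \<Sum>i\<in>UNIV. gaussian a w * (w \<bullet> axis i 1)\<^sup>2) = (\<lambda>w :: vec3. gaussian a w * (norm w)\<^sup>2)"
  proof
    fix w :: vec3
    have "(norm w)\<^sup>2 = (\<Sum>i\<in>UNIV. (w $ i)\<^sup>2)"
      unfolding power2_norm_eq_inner inner_vec_def by (simp add: power2_eq_square)
    then show "(\<Sum>i\<in>UNIV. gaussian a w * (w \<bullet> axis i 1)\<^sup>2) = gaussian a w * (norm w)\<^sup>2"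
      by (simp add: inner_axis sum_distrib_left)
  qed
  finally have "(\<Sum>i\<in>(UNIV :: 3 set). S (axis i 1)) = 3 / (2 * a)"
    using has_bochner_integral_gaussian_norm_square[OF a] by (simp add: has_bochner_integral_iff)
  moreover have "S (axis 2 1) = S (axis 1 1)" "S (axis 3 1) = S (axis 1 1)"
    by (rule unit, simp add: norm_axis_1)+
  ultimately have "S (axis 1 1) = 1 / (2 * a)"
    using a by (simp add: sum_3 field_simps)
  then have "S e = (norm e)\<^sup>2 / (2 * a)"
    using scale[of "norm e" "sgn e"] unit[of "sgn e"]
    by (cases "e = 0") (auto simp: norm_sgn sgn_div_norm S_def)
  with int show ?thesis by (simp add: S_def has_bochner_integral_iff)
qed

lemma has_bochner_integral_gaussian_inner:
  assumes a: "0 < a"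
  shows "has_bochner_integral lborel (\<lambda>w. gaussian a w * ((w \<bullet> e) * (w \<bullet> e'))) ((e \<bullet> e') / (2 * a))"
proof -
  \<comment> \<open>Polarization: the squares for \<open>e + e'\<close> and \<open>e - e'\<close>
    differ by four times the wanted product.\<close>
  have "has_bochner_integral lborel
      (\<lambda>w. 1 / 4 * (gaussian a w * (w \<bullet> (e + e'))\<^sup>2 - gaussian a w * (w \<bullet> (e - e'))\<^sup>2))
      (1 / 4 * ((norm (e + e'))\<^sup>2 / (2 * a) - (norm (e - e'))\<^sup>2 / (2 * a)))"
    by (intro has_bochner_integral_mult_right has_bochner_integral_diff
        has_bochner_integral_gaussian_inner_square a)
  moreover have "1 / 4 * (gaussian a w * (w \<bullet> (e + e'))\<^sup>2 - gaussian a w * (w \<bullet> (e - e'))\<^sup>2)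
      = gaussian a w * ((w \<bullet> e) * (w \<bullet> e'))" for w
    by (simp add: inner_add_right inner_diff_right power2_eq_square algebra_simps)
  moreover have "1 / 4 * ((norm (e + e'))\<^sup>2 / (2 * a) - (norm (e - e'))\<^sup>2 / (2 * a)) = (e \<bullet> e') / (2 * a)"
    using a by (simp add: power2_norm_eq_inner inner_add_left inner_add_right inner_diff_left inner_diff_right
        inner_commute[of e' e] field_simps)
  ultimately show ?thesis by simp
qed

text \<open>The covariance is a multiple of the identity, so only the trace of \<open>L\<close>
  survives. This is how the derivative of the drift velocity becomes a divergence.\<close>

lemma has_bochner_integral_gaussian_trace:
  assumes a: "0 < a" and L: "linear (L :: vec3 \<Rightarrow> vec3)"
  shows "has_bochner_integral lborel (\<lambda>w. gaussian a w * (w \<bullet> L w)) ((\<Sum>i\<in>UNIV. L (axis i 1) $ i) / (2 * a))"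
proof -
  have "has_bochner_integral lborel
      (\<lambda>w. \<Sum>i\<in>UNIV. gaussian a w * ((w \<bullet> axis i 1) * (w \<bullet> L (axis i 1))))
      (\<Sum>i\<in>UNIV. (axis i 1 \<bullet> L (axis i 1)) / (2 * a))"
    by (intro has_bochner_integral_sum has_bochner_integral_gaussian_inner a)
  moreover have "(\<Sum>i\<in>UNIV. gaussian a w * ((w \<bullet> axis i 1) * (w \<bullet> L (axis i 1))))
      = gaussian a w * (w \<bullet> L w)" for w
  proof -
    have "L w = L (\<Sum>i\<in>UNIV. (w $ i) *\<^sub>R axis i 1)"
      by (metis basis_expansion scalar_mult_eq_scaleR)
    also have "\<dots> = (\<Sum>i\<in>UNIV. (w $ i) *\<^sub>R L (axis i 1))"
      by (simp add: linear_sum[OF L] linear_scale[OF L])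
    finally show ?thesis
      by (simp add: inner_sum_right inner_axis sum_distrib_left mult.commute mult.left_commute)
  qed
  ultimately show ?thesis
    by (simp add: inner_axis' sum_divide_distrib)
qed

section \<open>Translation and product rules for integrals\<close>

lemma has_bochner_integral_lborel_translate:
  fixes F :: "'a :: euclidean_space \<Rightarrow> real"
  assumes "has_bochner_integral lborel (\<lambda>w. F (w + c)) r"
  shows "has_bochner_integral lborel F r"
proof -
  have F: "F \<in> borel_measurable borel"
  proof -
    have "(\<lambda>w. F (w + c)) \<in> borel_measurable borel"
      using assms by (auto simp: has_bochner_integral_iff)
    from measurable_compose[OF _ this, of "\<lambda>x. x - c" borel] show ?thesis by simp
  qed
  have "has_bochner_integral (distr lborel borel ((+) c)) F r"
    using assms F by (intro has_bochner_integral_distr) (auto simp: add.commute)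
  then show ?thesis by (simp add: lborel_distr_plus)
qed

lemma has_bochner_integral_pair_mult:
  fixes f :: "'a \<Rightarrow> real" and g :: "'b \<Rightarrow> real"
  assumes "sigma_finite_measure M" "sigma_finite_measure N"
    and f: "has_bochner_integral M f r" and g: "has_bochner_integral N g s"
  shows "has_bochner_integral (M \<Otimes>\<^sub>M N) (\<lambda>(x, y). f x * g y) (r * s)"
proof -
  interpret M: sigma_finite_measure M by fact
  interpret N: sigma_finite_measure N by fact
  interpret pair_sigma_finite M N ..
  have [measurable]: "f \<in> borel_measurable M" "g \<in> borel_measurable N"
    using f g by (auto simp: has_bochner_integral_iff)
  have int: "integrable (M \<Otimes>\<^sub>M N) (\<lambda>(x, y). f x * g y)"
  proof (rule Fubini_integrable)
    show "integrable M (\<lambda>x. \<integral>y. norm (case (x, y) of (x, y) \<Rightarrow> f x * g y) \<partial>N)"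
      using f by (auto simp: abs_mult has_bochner_integral_iff)
    show "AE x in M. integrable N (\<lambda>y. case (x, y) of (x, y) \<Rightarrow> f x * g y)"
      using g by (auto simp: has_bochner_integral_iff)
  qed measurable
  have "(\<integral>z. (case z of (x, y) \<Rightarrow> f x * g y) \<partial>(M \<Otimes>\<^sub>M N)) = (\<integral>x. (\<integral>y. f x * g y \<partial>N) \<partial>M)"
    using integral_fst'[OF int] by simp
  also have "\<dots> = r * s"
    using f g by (simp add: has_bochner_integral_iff)
  finally show ?thesis using int by (simp add: has_bochner_integral_iff)
qed

section \<open>Partition functions\<close>

lemma abs_exp_diff_le:
  fixes a b :: real
  shows "\<bar>exp a - exp b\<bar> \<le> \<bar>a - b\<bar> * exp (max a b)"
proof -
  have *: "exp a - exp b \<le> (a - b) * exp a" for a b :: real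
  proof -
    have "exp a * (1 + (b - a)) \<le> exp a * exp (b - a)"
      by (intro mult_left_mono exp_ge_add_one_self) auto
    then show ?thesis by (simp add: exp_diff algebra_simps)
  qed
  show ?thesis
    using *[of a b] *[of b a] by (cases "a \<le> b") (auto simp: max_def abs_if)
qed

lemma abs_exp_minus_linear_le:
  fixes y :: real
  shows "\<bar>exp y - 1 - y\<bar> \<le> y\<^sup>2 * exp \<bar>y\<bar>"
proof -
  have "0 \<le> exp y - 1 - y" using exp_ge_add_one_self[of y] by linarith
  \<comment> \<open>This is \<open>1 - y \<le> exp (- y)\<close> multiplied by
    \<open>exp y\<close>.\<close>
  moreover have "exp y - 1 - y \<le> y * (exp y - 1)"
  proof -
    have "exp y * (1 - y) \<le> exp y * exp (- y)"
      using exp_ge_add_one_self[of "- y"] by (intro mult_left_mono) auto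
    then show ?thesis by (simp add: exp_minus algebra_simps)
  qed
  moreover have "y * (exp y - 1) \<le> \<bar>y\<bar> * \<bar>exp y - 1\<bar>"
    by (metis abs_ge_self abs_mult)
  moreover have "\<bar>y\<bar> * \<bar>exp y - 1\<bar> \<le> \<bar>y\<bar> * (\<bar>y\<bar> * exp \<bar>y\<bar>)"
  proof (intro mult_left_mono)
    have "\<bar>y\<bar> * exp (max y 0) \<le> \<bar>y\<bar> * exp \<bar>y\<bar>"
      by (intro mult_left_mono) auto
    with abs_exp_diff_le[of y 0] show "\<bar>exp y - 1\<bar> \<le> \<bar>y\<bar> * exp \<bar>y\<bar>" by simp
  qed simp
  moreover have "\<bar>y\<bar> * (\<bar>y\<bar> * exp \<bar>y\<bar>) = y\<^sup>2 * exp \<bar>y\<bar>"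
    by (simp add: power2_eq_square mult.assoc[symmetric])
  ultimately show ?thesis by linarith
qed

text \<open>This bound and the next trade a power of the energy for an arbitrarily small rate
  \<open>c\<close> in the exponent, to be absorbed by a part of the Boltzmann decay.\<close>

lemma le_exp_scaled:
  fixes x c :: real
  assumes "0 < c"
  shows "x \<le> exp (c * x) / c"
proof -
  have "c * x \<le> exp (c * x)"
    using exp_ge_add_one_self[of "c * x"] by linarith
  with assms show ?thesis by (simp add: field_simps)
qed

lemma square_le_exp_scaled:
  fixes x c :: real
  assumes "0 < c" "0 \<le> x"
  shows "x\<^sup>2 \<le> 4 / c\<^sup>2 * exp (c * x)"
proof -
  have "x\<^sup>2 \<le> (exp (c / 2 * x) / (c / 2))\<^sup>2"
    using assms by (intro power_mono le_exp_scaled) auto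
  also have "\<dots> = 4 / c\<^sup>2 * exp (c * x)"
    by (simp add: power_divide power2_eq_square[of "exp _"] exp_add[symmetric])
  finally show ?thesis .
qed

text \<open>Almost-everywhere positivity makes the partition function nonzero and lets the weight of
  a moment cancel against the denominator of a collision operator. Convergence at every temperature
  means that the Laplace transform of \<open>\<phi>\<close> exists on the whole positive
  axis.\<close>

locale internal_weight =
  fixes kB :: real and \<phi> :: "real \<Rightarrow> real"
  assumes kB: "0 < kB"
    and weight_nonneg: "\<And>I. 0 \<le> I \<Longrightarrow> 0 \<le> \<phi> I"
    and weight_pos: "AE I in half_line. 0 < \<phi> I"
    and partition_conv: "\<And>\<tau>. 0 < \<tau> \<Longrightarrow> integrable half_line (\<lambda>I. \<phi> I * exp (- I / (kB * \<tau>)))"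
begin

lemma partition_fun_pos:
  assumes "0 < \<tau>"
  shows "0 < partition_fun kB \<phi> \<tau>"
proof -
  have nonneg: "AE I in half_line. 0 \<le> \<phi> I * exp (- I / (kB * \<tau>))"
    by (rule AE_I2) (simp add: weight_nonneg)
  have "partition_fun kB \<phi> \<tau> \<noteq> 0"
  proof
    assume "partition_fun kB \<phi> \<tau> = 0"
    then have "AE I in half_line. \<phi> I * exp (- I / (kB * \<tau>)) = 0"
      using integral_nonneg_eq_0_iff_AE[OF partition_conv[OF assms] nonneg] by (simp add: partition_fun_def)
    \<comment> \<open>A vanishing integral would make the half-line a null set, although its part
      from 0 to 1 has measure 1.\<close>
    with weight_pos have "AE I in half_line. False"
      by eventually_elim simp
    then obtain N where "{I \<in> space half_line. \<not> False} \<subseteq> N" "emeasure half_line N = 0" "N \<in> sets half_line"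
      by (rule AE_E)
    then have "emeasure half_line {0..1} \<le> 0"
      using emeasure_mono[of "{0..1}" N half_line] by (auto simp: subset_iff)
    moreover have "emeasure half_line {0..1} = 1"
      unfolding half_line_def by (subst emeasure_restrict_space) auto
    ultimately show False by simp
  qed
  moreover have "0 \<le> partition_fun kB \<phi> \<tau>"
    unfolding partition_fun_def by (rule integral_nonneg_AE[OF nonneg])
  ultimately show ?thesis by simp
qed

text \<open>The parameter \<open>s\<close> is the inverse temperature
  \<open>1 / (kB * \<tau>)\<close>. Differentiation is carried out in \<open>s\<close>, and the
  temperature enters later through the chain rule.\<close>

lemma integrable_laplace:
  assumes "0 < s"
  shows "integrable half_line (\<lambda>I. \<phi> I * exp (- (s * I)))"
  using partition_conv[of "1 / (kB * s)"] assms kB by (simp add: mult.commute)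

text \<open>Measurability of \<open>\<phi>\<close> is contained in the convergence of the partition
  function: undo the exponential factor of the integrable function.\<close>

lemma borel_measurable_weight [measurable]: "\<phi> \<in> borel_measurable half_line"
proof -
  note borel_measurable_half_line_ident[measurable]
  have [measurable]: "(\<lambda>I. \<phi> I * exp (- (1 * I))) \<in> borel_measurable half_line"
    using integrable_laplace[of 1] by auto
  have "(\<lambda>I. (\<phi> I * exp (- (1 * I))) * exp I) \<in> borel_measurable half_line"
    by measurable
  then show ?thesis by (simp add: mult.assoc exp_add[symmetric])
qed

lemma integrable_laplace_moment:
  assumes "0 < s"
  shows "integrable half_line (\<lambda>I. \<phi> I * (I * exp (- (s * I))))"
proof (rule Bochner_Integration.integrable_bound)
  note borel_measurable_half_line_ident[measurable]
  show "integrable half_line (\<lambda>I. 2 / s * (\<phi> I * exp (- (s / 2 * I))))"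
    using assms by (intro integrable_mult_right integrable_laplace) auto
  show "(\<lambda>I. \<phi> I * (I * exp (- (s * I)))) \<in> borel_measurable half_line"
    by measurable
  show "AE I in half_line. norm (\<phi> I * (I * exp (- (s * I)))) \<le> norm (2 / s * (\<phi> I * exp (- (s / 2 * I))))"
  proof (rule AE_I2)
    fix I assume "I \<in> space half_line"
    then have I: "0 \<le> I" by simp
    have "I * exp (- (s * I)) \<le> (exp (s / 2 * I) / (s / 2)) * exp (- (s * I))"
      using assms by (intro mult_right_mono le_exp_scaled) auto
    also have "\<dots> = 2 / s * exp (- (s / 2 * I))"
      by (simp add: exp_minus divide_simps exp_add[symmetric]) 
    finally have "\<phi> I * (I * exp (- (s * I))) \<le> \<phi> I * (2 / s * exp (- (s / 2 * I)))"
      by (intro mult_left_mono weight_nonneg I)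
    then show "norm (\<phi> I * (I * exp (- (s * I)))) \<le> norm (2 / s * (\<phi> I * exp (- (s / 2 * I))))"
      using I assms weight_nonneg[OF I] by (simp add: abs_mult mult.left_commute)
  qed
qed

text \<open>Differentiation under the integral sign with an explicit remainder: the integrand
  deviates from its linearization by \<open>h\<^sup>2\<close> times an integrable function that does
  not depend on \<open>h\<close>.\<close>

lemma laplace_has_derivative:
  assumes s: "0 < s"
  shows "DERIV (\<lambda>s. \<integral>I. \<phi> I * exp (- (s * I)) \<partial>half_line) s
    :> - (\<integral>I. \<phi> I * (I * exp (- (s * I))) \<partial>half_line)"
proof -
  define L where "L = (\<lambda>s. \<integral>I. \<phi> I * exp (- (s * I)) \<partial>half_line)"
  define L1 where "L1 = (\<integral>I. \<phi> I * (I * exp (- (s * I))) \<partial>half_line)"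
  \<comment> \<open>For \<open>\<bar>h\<bar> \<le> s / 2\<close> the factor
    \<open>exp \<bar>h * I\<bar>\<close> costs a rate \<open>s / 2\<close>, and the square of
    \<open>I\<close> costs \<open>s / 4\<close> with the constant
    \<open>4 / (s / 4)\<^sup>2\<close>. The rate \<open>s / 4\<close> that is left over is the
    argument of \<open>L\<close>.\<close>
  define K where "K = 64 / s\<^sup>2 * L (s / 4)"
  have bound: "\<bar>L (s + h) - L s + h * L1\<bar> \<le> h\<^sup>2 * K" if h: "\<bar>h\<bar> \<le> s / 2" for h
  proof -
    have "0 < s + h" using h s by (auto simp: abs_if split: if_splits)
    note int = integrable_laplace[OF this] integrable_laplace[OF s] integrable_laplace_moment[OF s]
    have "\<bar>L (s + h) - L s + h * L1\<bar>
        = \<bar>\<integral>I. \<phi> I * exp (- ((s + h) * I)) - \<phi> I * exp (- (s * I)) + h * (\<phi> I * (I * exp (- (s * I)))) \<partial>half_line\<bar>"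
      unfolding L_def L1_def using int by simp
    also have "\<dots> \<le> (\<integral>I. h\<^sup>2 * (64 / s\<^sup>2 * (\<phi> I * exp (- (s / 4 * I)))) \<partial>half_line)"
    proof (rule integral_abs_bound_integral)
      show "integrable half_line (\<lambda>I. \<phi> I * exp (- ((s + h) * I)) - \<phi> I * exp (- (s * I)) + h * (\<phi> I * (I * exp (- (s * I)))))"
        using int by simp
      show "integrable half_line (\<lambda>I. h\<^sup>2 * (64 / s\<^sup>2 * (\<phi> I * exp (- (s / 4 * I)))))"
        using s by (intro integrable_mult_right integrable_laplace) auto
      fix I assume "I \<in> space half_line"
      then have I: "0 \<le> I" by simp
      have "\<bar>\<phi> I * exp (- ((s + h) * I)) - \<phi> I * exp (- (s * I)) + h * (\<phi> I * (I * exp (- (s * I))))\<bar>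
          = \<bar>\<phi> I * exp (- (s * I)) * (exp (- (h * I)) - 1 - (- (h * I)))\<bar>"
      proof -
        have "exp (- ((s + h) * I)) = exp (- (s * I)) * exp (- (h * I))"
          by (simp add: exp_add[symmetric] algebra_simps)
        then show ?thesis by (simp add: algebra_simps)
      qed
      also have "\<dots> = \<phi> I * exp (- (s * I)) * \<bar>exp (- (h * I)) - 1 - (- (h * I))\<bar>"
        using weight_nonneg[OF I] by (simp add: abs_mult)
      also have "\<dots> \<le> \<phi> I * exp (- (s * I)) * ((- (h * I))\<^sup>2 * exp \<bar>- (h * I)\<bar>)"
        using weight_nonneg[OF I] by (intro mult_left_mono abs_exp_minus_linear_le) auto
      also have "\<dots> \<le> \<phi> I * exp (- (s * I)) * (h\<^sup>2 * (4 / (s / 4)\<^sup>2 * exp (s / 4 * I)) * exp (s / 2 * I))"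
      proof (intro mult_left_mono mult_mono)
        show "(- (h * I))\<^sup>2 \<le> h\<^sup>2 * (4 / (s / 4)\<^sup>2 * exp (s / 4 * I))"
          using s I unfolding power2_minus power_mult_distrib
          by (intro mult_left_mono square_le_exp_scaled) auto
        show "exp \<bar>- (h * I)\<bar> \<le> exp (s / 2 * I)"
          using mult_right_mono[OF h I] I by (simp add: abs_mult)
      qed (use weight_nonneg[OF I] in auto)
      also have "\<dots> = h\<^sup>2 * (64 / s\<^sup>2 * (\<phi> I * exp (- (s / 4 * I))))"
      proof -
        have "- (s * I) + s / 4 * I + s / 2 * I = - (s / 4 * I)" by (simp add: field_simps)
        then have 1: "exp (- (s * I)) * exp (s / 4 * I) * exp (s / 2 * I) = exp (- (s / 4 * I))"
          by (simp only: exp_add[symmetric])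
        have 2: "4 / (s / 4)\<^sup>2 = 64 / s\<^sup>2" by (simp add: power2_eq_square)
        show ?thesis unfolding 1[symmetric] 2 by (simp only: mult_ac)
      qed
      finally show "\<bar>\<phi> I * exp (- ((s + h) * I)) - \<phi> I * exp (- (s * I)) + h * (\<phi> I * (I * exp (- (s * I))))\<bar>
          \<le> h\<^sup>2 * (64 / s\<^sup>2 * (\<phi> I * exp (- (s / 4 * I))))" .
    qed
    also have "\<dots> = h\<^sup>2 * K" by (simp add: K_def L_def)
    finally show ?thesis .
  qed
  have "((\<lambda>h. (L (s + h) - L s) / h - (- L1)) \<longlongrightarrow> 0) (at 0)"
  proof (rule Lim_null_comparison)
    show "\<forall>\<^sub>F h in at 0. norm ((L (s + h) - L s) / h - - L1) \<le> \<bar>h\<bar> * K"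
    proof -
      have "\<forall>\<^sub>F h in at 0. \<bar>h :: real\<bar> \<le> s / 2"
        using s by (auto simp: eventually_at intro!: exI[of _ "s / 2"])
      moreover have "\<forall>\<^sub>F h in at 0. (h :: real) \<noteq> 0" by (simp add: eventually_at_filter)
      ultimately show ?thesis
      proof eventually_elim
        case (elim h)
        have "norm ((L (s + h) - L s) / h - - L1) = \<bar>L (s + h) - L s + h * L1\<bar> / \<bar>h\<bar>"
        proof -
          have "(L (s + h) - L s) / h - - L1 = (L (s + h) - L s + h * L1) / h"
            using elim(2) by (simp add: field_simps)
          then show ?thesis by simp
        qed
        also have "\<dots> \<le> h\<^sup>2 * K / \<bar>h\<bar>"
          by (intro divide_right_mono bound elim) simp
        also have "\<dots> = \<bar>h\<bar> * K"
          using elim(2) by (simp add: power2_eq_square abs_if)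
        finally show ?case .
      qed
    qed
    show "((\<lambda>h. \<bar>h\<bar> * K) \<longlongrightarrow> 0) (at 0)"
      by (auto intro!: tendsto_eq_intros)
  qed
  then show ?thesis
    unfolding DERIV_def L_def[symmetric] L1_def[symmetric] by (rule LIM_zero_cancel)
qed

definition partition_deriv :: "real \<Rightarrow> real" where
  "partition_deriv \<tau> = (\<integral>I. \<phi> I * (I * exp (- I / (kB * \<tau>))) \<partial>half_line) / (kB * \<tau>\<^sup>2)"

lemma partition_fun_has_derivative:
  assumes \<tau>: "0 < \<tau>"
  shows "DERIV (partition_fun kB \<phi>) \<tau> :> partition_deriv \<tau>"
proof -
  have "DERIV (\<lambda>\<tau>. 1 / (kB * \<tau>)) \<tau> :> - (1 / (kB * \<tau>\<^sup>2))"
    using \<tau> kB by (auto intro!: derivative_eq_intros simp: power2_eq_square field_simps)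
  from DERIV_chain2[OF laplace_has_derivative this] \<tau> kB
  show ?thesis
    unfolding partition_fun_def[abs_def] partition_deriv_def by simp
qed

text \<open>The Gibbs density of the internal energy with the weight included: a Maxwellian times
  its weight is the number density times two probability densities.\<close>

definition internal_density :: "real \<Rightarrow> real \<Rightarrow> real" where
  "internal_density \<tau> I = \<phi> I * exp (- I / (kB * \<tau>)) / partition_fun kB \<phi> \<tau>"

lemma has_bochner_integral_internal_density:
  assumes "0 < \<tau>"
  shows "has_bochner_integral half_line (internal_density \<tau>) 1"
proof -
  have "has_bochner_integral half_line (\<lambda>I. \<phi> I * exp (- I / (kB * \<tau>)) / partition_fun kB \<phi> \<tau>)
      (partition_fun kB \<phi> \<tau> / partition_fun kB \<phi> \<tau>)"
    using partition_conv[OF assms]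
    by (intro has_bochner_integral_divide_zero) (simp add: has_bochner_integral_iff partition_fun_def)
  then show ?thesis
    using partition_fun_pos[OF assms] by (simp add: internal_density_def[abs_def])
qed

text \<open>The factor in parentheses is the logarithmic derivative of
  \<open>internal_density \<tau> I\<close> in the temperature. Its mean is zero because the total
  mass is 1 at every temperature.\<close>

lemma has_bochner_integral_internal_density_deriv:
  assumes \<tau>: "0 < \<tau>"
  shows "has_bochner_integral half_line
    (\<lambda>I. internal_density \<tau> I * (I / (kB * \<tau>\<^sup>2) - partition_deriv \<tau> / partition_fun kB \<phi> \<tau>)) 0"
proof -
  let ?q = "partition_fun kB \<phi> \<tau>"
  have "integrable half_line (\<lambda>I. \<phi> I * (I * exp (- I / (kB * \<tau>))))"
    using integrable_laplace_moment[of "1 / (kB * \<tau>)"] \<tau> kB by simp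
  then have "has_bochner_integral half_line (\<lambda>I. \<phi> I * (I * exp (- I / (kB * \<tau>))) / (kB * \<tau>\<^sup>2 * ?q))
      (partition_deriv \<tau> / ?q)"
    unfolding partition_deriv_def divide_divide_eq_left
    by (intro has_bochner_integral_divide_zero) (simp add: has_bochner_integral_iff)
  moreover have "has_bochner_integral half_line (\<lambda>I. internal_density \<tau> I * (partition_deriv \<tau> / ?q))
      (1 * (partition_deriv \<tau> / ?q))"
    by (intro has_bochner_integral_mult_left has_bochner_integral_internal_density \<tau>)
  ultimately have "has_bochner_integral half_line
      (\<lambda>I. \<phi> I * (I * exp (- I / (kB * \<tau>))) / (kB * \<tau>\<^sup>2 * ?q) - internal_density \<tau> I * (partition_deriv \<tau> / ?q))
      (partition_deriv \<tau> / ?q - 1 * (partition_deriv \<tau> / ?q))"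
    by (rule has_bochner_integral_diff)
  moreover have "\<phi> I * (I * exp (- I / (kB * \<tau>))) / (kB * \<tau>\<^sup>2 * ?q) - internal_density \<tau> I * (partition_deriv \<tau> / ?q)
      = internal_density \<tau> I * (I / (kB * \<tau>\<^sup>2) - partition_deriv \<tau> / ?q)" for I
    unfolding internal_density_def right_diff_distrib by (simp add: mult_ac)
  ultimately show ?thesis by simp
qed

end

section \<open>Transport moments of Maxwellians\<close>

context internal_weight
begin

lemma maxwellian_eq_density:
  assumes "0 < m" "0 < \<tau>"
  shows "maxwellian kB m \<phi> n \<tau> u v I * \<phi> I
    = n * (internal_density \<tau> I * gaussian (m / (2 * kB * \<tau>)) (v - u))"
proof -
  have "- (m * (norm (v - u))\<^sup>2 + 2 * I) / (2 * kB * \<tau>)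
      = - I / (kB * \<tau>) + - (m / (2 * kB * \<tau>)) * (norm (v - u))\<^sup>2"
    using kB assms by (simp add: field_simps)
  then have "exp (- (m * (norm (v - u))\<^sup>2 + 2 * I) / (2 * kB * \<tau>))
      = exp (- I / (kB * \<tau>)) * exp (- (m / (2 * kB * \<tau>)) * (norm (v - u))\<^sup>2)"
    by (simp only: exp_add)
  moreover have "m / (2 * pi * kB * \<tau>) = m / (2 * kB * \<tau>) / pi"
    by simp
  ultimately show ?thesis
    unfolding maxwellian_def internal_density_def gaussian_def by (simp only: mult_ac times_divide_eq_right times_divide_eq_left)
qed

text \<open>All temperature dependence outside the exponential, isolated so that the exact
  derivative and the perturbation bound can both treat it as one differentiable function.\<close>

definition maxwellian_prefactor :: "real \<Rightarrow> real \<Rightarrow> real" where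
  "maxwellian_prefactor m \<tau> = (m / (2 * pi * kB * \<tau>)) powr (3 / 2) / partition_fun kB \<phi> \<tau>"

lemma maxwellian_prefactor_has_derivative:
  assumes m: "0 < m" and \<tau>: "0 < \<tau>"
  shows "DERIV (maxwellian_prefactor m) \<tau> :>
    maxwellian_prefactor m \<tau> * (- 3 / (2 * \<tau>) - partition_deriv \<tau> / partition_fun kB \<phi> \<tau>)"
proof -
  have q: "partition_fun kB \<phi> \<tau> \<noteq> 0" using partition_fun_pos[OF \<tau>] by simp
  have pos: "0 < m / (2 * pi * kB * \<tau>)" using m \<tau> kB by simp
  have 1: "DERIV (\<lambda>\<tau>. m / (2 * pi * kB * \<tau>)) \<tau> :> - (m / (2 * pi * kB * \<tau>)) / \<tau>"
    using m \<tau> kB by (auto intro!: derivative_eq_intros simp: divide_simps)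
  have "DERIV (\<lambda>\<tau>. (m / (2 * pi * kB * \<tau>)) powr (3 / 2)) \<tau> :>
      (m / (2 * pi * kB * \<tau>)) powr (3 / 2) * (- 3 / (2 * \<tau>))"
  proof -
    have "DERIV (\<lambda>\<tau>. (m / (2 * pi * kB * \<tau>)) powr (3 / 2)) \<tau> :>
        3 / 2 * (m / (2 * pi * kB * \<tau>)) powr (3 / 2 - 1) * (- (m / (2 * pi * kB * \<tau>)) / \<tau>)"
      using DERIV_fun_powr[OF 1 pos, of "3 / 2"] by simp
    moreover have "(m / (2 * pi * kB * \<tau>)) powr (3 / 2)
        = (m / (2 * pi * kB * \<tau>)) powr (3 / 2 - 1) * (m / (2 * pi * kB * \<tau>))"
      using pos by (metis powr_add powr_one diff_add_cancel order_less_imp_le)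
    ultimately show ?thesis by (simp add: algebra_simps)
  qed
  from DERIV_divide[OF this partition_fun_has_derivative[OF \<tau>] q]
  show ?thesis
    unfolding maxwellian_prefactor_def[abs_def]
    by (rule DERIV_cong) (use q in \<open>simp add: divide_simps algebra_simps\<close>)
qed

lemma maxwellian_eq_prefactor:
  "maxwellian kB m \<phi> n \<tau> u v I
    = n * maxwellian_prefactor m \<tau> * exp (- (m * (norm (v - u))\<^sup>2 + 2 * I) / (2 * kB * \<tau>))"
  by (simp add: maxwellian_def maxwellian_prefactor_def)

text \<open>Logarithmic differentiation in temperature and drift. The Maxwellian of density 1 is
  factored out instead of the full one, so that the derivative of the density appears as
  \<open>N' d\<close> without a quotient by \<open>N p\<close>.\<close>

lemma maxwellian_has_derivative:
  fixes N \<Theta> :: "'a :: real_normed_vector \<Rightarrow> real" and U :: "'a \<Rightarrow> vec3"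
  assumes m: "0 < m" and \<Theta>: "0 < \<Theta> p"
    and N': "(N has_derivative N') (at p)" and \<Theta>': "(\<Theta> has_derivative \<Theta>') (at p)"
    and U': "(U has_derivative U') (at p)"
  shows "((\<lambda>p. maxwellian kB m \<phi> (N p) (\<Theta> p) (U p) v I) has_derivative
    (\<lambda>d. maxwellian kB m \<phi> 1 (\<Theta> p) (U p) v I * (N' d + N p *
       (((m * (norm (v - U p))\<^sup>2 / 2 + I) / (kB * (\<Theta> p)\<^sup>2) - 3 / (2 * \<Theta> p)
          - partition_deriv (\<Theta> p) / partition_fun kB \<phi> (\<Theta> p)) * \<Theta>' d
        + m / (kB * \<Theta> p) * ((v - U p) \<bullet> U' d))))) (at p)"
proof -
  define c where "c = maxwellian_prefactor m"
  define c' where "c' = - 3 / (2 * \<Theta> p) - partition_deriv (\<Theta> p) / partition_fun kB \<phi> (\<Theta> p)"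
  define e where "e = (\<lambda>p. - (m * ((v - U p) \<bullet> (v - U p)) + 2 * I) / (2 * kB * \<Theta> p))"
  have eq: "maxwellian kB m \<phi> n (\<Theta> p) (U p) v I = n * c (\<Theta> p) * exp (e p)" for n p
    by (simp add: maxwellian_eq_prefactor c_def e_def power2_norm_eq_inner)
  have c: "((\<lambda>p. c (\<Theta> p)) has_derivative (\<lambda>d. c (\<Theta> p) * c' * \<Theta>' d)) (at p)"
    using has_derivative_compose[OF \<Theta>' maxwellian_prefactor_has_derivative[OF m \<Theta>, unfolded has_field_derivative_def]]
    by (simp add: c_def c'_def)
  have e: "(e has_derivative (\<lambda>d. m / (kB * \<Theta> p) * ((v - U p) \<bullet> U' d)
      + (m * ((v - U p) \<bullet> (v - U p)) / 2 + I) / (kB * (\<Theta> p)\<^sup>2) * \<Theta>' d)) (at p)"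
    unfolding e_def using kB \<Theta>
    by (auto intro!: derivative_eq_intros N' \<Theta>' U', simp add: fun_eq_iff inner_commute[of "U' _"] power2_eq_square divide_simps,
      simp add: algebra_simps)
  have "((\<lambda>p. N p * c (\<Theta> p) * exp (e p)) has_derivative
      (\<lambda>d. c (\<Theta> p) * exp (e p) * (N' d + N p * (((m * (norm (v - U p))\<^sup>2 / 2 + I) / (kB * (\<Theta> p)\<^sup>2) + c') * \<Theta>' d
        + m / (kB * \<Theta> p) * ((v - U p) \<bullet> U' d))))) (at p)"
    by (rule has_derivative_eq_rhs[OF has_derivative_mult[OF has_derivative_mult[OF N' c]
            has_derivative_exp[OF e]]])
      (auto simp: fun_eq_iff power2_norm_eq_inner algebra_simps)
  then show ?thesis
    unfolding eq by (simp add: c'_def diff_diff_eq add_diff_eq algebra_simps)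
qed

text \<open>The pair \<open>(\<epsilon>, v)\<close> is the direction in which the space-time
  derivative is the transport operator, and \<open>u\<close> stands for the full mean velocity, with
  its factor epsilon included when the lemma is applied.\<close>

lemma maxwellian_transport_moment:
  fixes N' \<Theta>' :: "real \<times> vec3 \<Rightarrow> real" and U' :: "real \<times> vec3 \<Rightarrow> vec3"
  assumes m: "0 < m" and \<tau>: "0 < \<tau>"
    and N': "bounded_linear N'" and \<Theta>': "bounded_linear \<Theta>'" and U': "bounded_linear U'"
  shows "has_bochner_integral state_measure
    (\<lambda>(v, I). maxwellian kB m \<phi> 1 \<tau> u v I * (N' (\<epsilon>, v) + n *
       (((m * (norm (v - u))\<^sup>2 / 2 + I) / (kB * \<tau>\<^sup>2) - 3 / (2 * \<tau>)
          - partition_deriv \<tau> / partition_fun kB \<phi> \<tau>) * \<Theta>' (\<epsilon>, v)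
        + m / (kB * \<tau>) * ((v - u) \<bullet> U' (\<epsilon>, v)))) * \<phi> I)
    (N' (\<epsilon>, u) + n * (\<Sum>i\<in>UNIV. U' (0, axis i 1) $ i))"
proof -
  interpret N': bounded_linear N' by fact
  interpret \<Theta>': bounded_linear \<Theta>' by fact
  interpret U': bounded_linear U' by fact
  define a where "a = m / (2 * kB * \<tau>)"
  have a: "0 < a" using m \<tau> kB by (simp add: a_def)
  define d where "d = partition_deriv \<tau> / partition_fun kB \<phi> \<tau>"
  define L where "L = (\<lambda>w. U' (0, w))"
  have bl: "bounded_linear (\<lambda>w :: vec3. (0 :: real, w))"
    by (intro bounded_linear_Pair bounded_linear_zero bounded_linear_ident)
  have linL: "bounded_linear L" unfolding L_def
    using bounded_linear_compose[OF U' bl] by simp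
  have linN: "bounded_linear (\<lambda>w. N' (0, w))"
    using bounded_linear_compose[OF N' bl] by simp
  have lin\<Theta>: "bounded_linear (\<lambda>w. \<Theta>' (0, w))"
    using bounded_linear_compose[OF \<Theta>' bl] by simp
  have measb [measurable]: "L \<in> borel_measurable borel" "(\<lambda>w. N' (0, w)) \<in> borel_measurable borel"
      "(\<lambda>w. \<Theta>' (0, w)) \<in> borel_measurable borel"
    using linL linN lin\<Theta> by (auto intro!: borel_measurable_continuous_onI linear_continuous_on)
  obtain KT where KT: "\<bar>\<Theta>' (0, w)\<bar> \<le> norm w * KT" for w
    using bounded_linear.bounded[OF lin\<Theta>] by auto
  have iT: "integrable lborel (\<lambda>w. gaussian a w * \<Theta>' (0, w))"
    by (rule integrable_gaussian_linear[OF a lin\<Theta>])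
  \<comment> \<open>All terms of odd degree in the centred velocity \<open>w\<close>: even
    polynomials times a derivative along \<open>w\<close>, and the drift derivative in the fixed
    direction \<open>(\<epsilon>, u)\<close> paired with \<open>w\<close>.\<close>
  define odd where "odd = (\<lambda>w. N' (0, w) + n * ((m * (norm w)\<^sup>2 / (2 * kB * \<tau>\<^sup>2) - 3 / (2 * \<tau>)) * \<Theta>' (0, w)
      + m / (kB * \<tau>) * (w \<bullet> U' (\<epsilon>, u))))"
  have [measurable]: "odd \<in> borel_measurable borel" unfolding odd_def by measurable
  have int_odd: "integrable lborel (\<lambda>w. gaussian a w * odd w)"
  proof -
    define e where "e = U' (\<epsilon>, u)"
    have iN: "integrable lborel (\<lambda>w. gaussian a w * N' (0, w))"
      by (rule integrable_gaussian_linear[OF a linN])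
    have iT2: "integrable lborel (\<lambda>w. gaussian a w * ((norm w)\<^sup>2 * \<Theta>' (0, w)))"
    proof (rule integrable_gaussian_mult[OF a, where C = "\<bar>KT\<bar>"])
      fix w :: vec3
      have "\<bar>\<Theta>' (0, w)\<bar> \<le> norm w * \<bar>KT\<bar>"
        using KT[of w] by (meson abs_ge_self mult_left_mono norm_ge_zero order_trans)
      then have "(norm w)\<^sup>2 * \<bar>\<Theta>' (0, w)\<bar> \<le> (norm w)\<^sup>2 * (norm w * \<bar>KT\<bar>)"
        by (intro mult_left_mono) auto
      also have "\<dots> = \<bar>KT\<bar> * norm w ^ 3" by (simp add: power2_eq_square power3_eq_cube)
      also have "\<dots> \<le> \<bar>KT\<bar> * (1 + norm w ^ 3)" by (intro mult_left_mono) auto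
      finally show "\<bar>(norm w)\<^sup>2 * \<Theta>' (0, w)\<bar> \<le> \<bar>KT\<bar> * (1 + norm w ^ 3)" by (simp add: abs_mult)
    qed measurable
    have iU: "integrable lborel (\<lambda>w. gaussian a w * (w \<bullet> e))"
      by (intro integrable_gaussian_linear a bounded_linear_inner_left)
    have "integrable lborel (\<lambda>w. gaussian a w * N' (0, w) + n * m / (2 * kB * \<tau>\<^sup>2) * (gaussian a w * ((norm w)\<^sup>2 * \<Theta>' (0, w)))
      - 3 * n / (2 * \<tau>) * (gaussian a w * \<Theta>' (0, w)) + n * m / (kB * \<tau>) * (gaussian a w * (w \<bullet> e)))"
      by (intro Bochner_Integration.integrable_add Bochner_Integration.integrable_diff integrable_mult_right iN iT iT2 iU)
    then show ?thesis
      by (rule Bochner_Integration.integrable_cong[THEN iffD1, rotated -1])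
        (auto simp: odd_def e_def algebra_simps)
  qed
  have odd: "has_bochner_integral lborel (\<lambda>w. gaussian a w * odd w) 0"
    unfolding has_bochner_integral_iff
  proof
    have "odd (- w) = - odd w" for w
    proof -
      have "(0 :: real, - w) = - (0, w)" by simp
      then have "N' (0, - w) = - N' (0, w)" "\<Theta>' (0, - w) = - \<Theta>' (0, w)"
        by (simp_all only: N'.neg \<Theta>'.neg)
      then show ?thesis by (simp add: odd_def algebra_simps)
    qed
    then show "(\<integral>w. gaussian a w * odd w \<partial>lborel) = 0"
      by (intro integral_gaussian_odd) auto
  qed (rule int_odd)
  \<comment> \<open>With \<open>2 * a = m / (kB * \<tau>)\<close> the mean kinetic energy cancels
    the term \<open>3 / (2 * \<tau>)\<close> of the prefactor, and the trace gets exactly the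
    coefficient \<open>n\<close>.\<close>
  have even: "has_bochner_integral lborel
      (\<lambda>w. (N' (\<epsilon>, u) - 3 * n / (2 * \<tau>) * \<Theta>' (\<epsilon>, u)) * gaussian a w
        + n * m / (2 * kB * \<tau>\<^sup>2) * \<Theta>' (\<epsilon>, u) * (gaussian a w * (norm w)\<^sup>2)
        + n * m / (kB * \<tau>) * (gaussian a w * (w \<bullet> L w)))
      (N' (\<epsilon>, u) + n * (\<Sum>i\<in>UNIV. L (axis i 1) $ i))"
  proof (rule has_bochner_integral_cong[OF refl refl, THEN iffD1])
    show "has_bochner_integral lborel
      (\<lambda>w. (N' (\<epsilon>, u) - 3 * n / (2 * \<tau>) * \<Theta>' (\<epsilon>, u)) * gaussian a w
        + n * m / (2 * kB * \<tau>\<^sup>2) * \<Theta>' (\<epsilon>, u) * (gaussian a w * (norm w)\<^sup>2)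
        + n * m / (kB * \<tau>) * (gaussian a w * (w \<bullet> L w)))
      ((N' (\<epsilon>, u) - 3 * n / (2 * \<tau>) * \<Theta>' (\<epsilon>, u)) * 1 + n * m / (2 * kB * \<tau>\<^sup>2) * \<Theta>' (\<epsilon>, u) * (3 / (2 * a))
        + n * m / (kB * \<tau>) * ((\<Sum>i\<in>UNIV. L (axis i 1) $ i) / (2 * a)))"
      by (intro has_bochner_integral_add has_bochner_integral_mult_right has_bochner_integral_gaussian
          has_bochner_integral_gaussian_norm_square has_bochner_integral_gaussian_trace a
          bounded_linear.linear linL)
    show "(N' (\<epsilon>, u) - 3 * n / (2 * \<tau>) * \<Theta>' (\<epsilon>, u)) * 1 + n * m / (2 * kB * \<tau>\<^sup>2) * \<Theta>' (\<epsilon>, u) * (3 / (2 * a))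
        + n * m / (kB * \<tau>) * ((\<Sum>i\<in>UNIV. L (axis i 1) $ i) / (2 * a))
        = N' (\<epsilon>, u) + n * (\<Sum>i\<in>UNIV. L (axis i 1) $ i)"
      unfolding a_def using m \<tau> kB by (simp add: power2_eq_square field_simps)
  qed
  \<comment> \<open>\<open>G1\<close> multiplies the internal density itself, whereas
    \<open>G2\<close> multiplies its centred logarithmic derivative; the temperature terms are
    distributed so that each product separates velocity from internal energy.\<close>
  define G1 where "G1 = (\<lambda>v. gaussian a (v - u) * (N' (\<epsilon>, v) + n * ((m * (norm (v - u))\<^sup>2 / (2 * kB * \<tau>\<^sup>2) - 3 / (2 * \<tau>)) * \<Theta>' (\<epsilon>, v)
      + m / (kB * \<tau>) * ((v - u) \<bullet> U' (\<epsilon>, v)))))"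
  define G2 where "G2 = (\<lambda>v. gaussian a (v - u) * (n * \<Theta>' (\<epsilon>, v)))"
  have comm: "(\<epsilon>, w + u) = (\<epsilon>, u) + (0, w)" for w :: vec3 by simp
  have G1: "has_bochner_integral lborel G1 (N' (\<epsilon>, u) + n * (\<Sum>i\<in>UNIV. L (axis i 1) $ i))"
  proof (rule has_bochner_integral_lborel_translate)
    have "G1 (w + u) = (N' (\<epsilon>, u) - 3 * n / (2 * \<tau>) * \<Theta>' (\<epsilon>, u)) * gaussian a w
        + n * m / (2 * kB * \<tau>\<^sup>2) * \<Theta>' (\<epsilon>, u) * (gaussian a w * (norm w)\<^sup>2)
        + n * m / (kB * \<tau>) * (gaussian a w * (w \<bullet> L w)) + gaussian a w * odd w" for w
      unfolding G1_def odd_def L_def comm N'.add \<Theta>'.add U'.add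
      by (simp add: inner_add_right algebra_simps add_divide_distrib diff_divide_distrib)
    with has_bochner_integral_add[OF even odd]
    show "has_bochner_integral lborel (\<lambda>w. G1 (w + u)) (N' (\<epsilon>, u) + n * (\<Sum>i\<in>UNIV. L (axis i 1) $ i))"
      by simp
  qed
  \<comment> \<open>The value \<open>r\<close> need only exist: it is multiplied by the zero mean of
    the internal factor.\<close>
  obtain r where G2: "has_bochner_integral lborel G2 r"
  proof -
    have "integrable lborel (\<lambda>w. n * \<Theta>' (\<epsilon>, u) * gaussian a w + n * (gaussian a w * \<Theta>' (0, w)))"
      using iT has_bochner_integral_gaussian[OF a]
      by (intro Bochner_Integration.integrable_add integrable_mult_right) (auto simp: has_bochner_integral_iff)
    moreover have "n * \<Theta>' (\<epsilon>, u) * gaussian a w + n * (gaussian a w * \<Theta>' (0, w)) = G2 (w + u)" for w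
      unfolding G2_def comm \<Theta>'.add by (simp add: algebra_simps)
    ultimately have "has_bochner_integral lborel (\<lambda>w. G2 (w + u)) (\<integral>w. G2 (w + u) \<partial>lborel)"
      by (simp add: has_bochner_integral_iff)
    then show thesis by (rule that[OF has_bochner_integral_lborel_translate])
  qed
  have "has_bochner_integral state_measure
      (\<lambda>z. (case z of (v, I) \<Rightarrow> G1 v * internal_density \<tau> I)
        + (case z of (v, I) \<Rightarrow> G2 v * (internal_density \<tau> I * (I / (kB * \<tau>\<^sup>2) - partition_deriv \<tau> / partition_fun kB \<phi> \<tau>))))
      ((N' (\<epsilon>, u) + n * (\<Sum>i\<in>UNIV. L (axis i 1) $ i)) * 1 + r * 0)"
    unfolding state_measure_def
    by (intro has_bochner_integral_add has_bochner_integral_pair_mult G1 G2 sigma_finite_half_line sigma_finite_lborel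
        has_bochner_integral_internal_density has_bochner_integral_internal_density_deriv \<tau>)
  moreover have "(case z of (v, I) \<Rightarrow> G1 v * internal_density \<tau> I)
        + (case z of (v, I) \<Rightarrow> G2 v * (internal_density \<tau> I * (I / (kB * \<tau>\<^sup>2) - partition_deriv \<tau> / partition_fun kB \<phi> \<tau>)))
      = (case z of (v, I) \<Rightarrow> maxwellian kB m \<phi> 1 \<tau> u v I * (N' (\<epsilon>, v) + n *
       (((m * (norm (v - u))\<^sup>2 / 2 + I) / (kB * \<tau>\<^sup>2) - 3 / (2 * \<tau>)
          - partition_deriv \<tau> / partition_fun kB \<phi> \<tau>) * \<Theta>' (\<epsilon>, v)
        + m / (kB * \<tau>) * ((v - u) \<bullet> U' (\<epsilon>, v)))) * \<phi> I)" for z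
  proof -
    obtain v I where z: "z = (v, I)" by (cases z)
    have "maxwellian kB m \<phi> 1 \<tau> u v I * X * \<phi> I = internal_density \<tau> I * gaussian a (v - u) * X" for X
    proof -
      have "maxwellian kB m \<phi> 1 \<tau> u v I * X * \<phi> I = (maxwellian kB m \<phi> 1 \<tau> u v I * \<phi> I) * X"
        by (simp only: mult_ac)
      then show ?thesis
        unfolding maxwellian_eq_density[OF m \<tau>] by (simp add: a_def)
    qed
    moreover have "(m * (norm (v - u))\<^sup>2 / 2 + I) / (kB * \<tau>\<^sup>2) - 3 / (2 * \<tau>) - d
        = (m * (norm (v - u))\<^sup>2 / (2 * kB * \<tau>\<^sup>2) - 3 / (2 * \<tau>)) + (I / (kB * \<tau>\<^sup>2) - d)"
      by (simp add: add_divide_distrib)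
    moreover have "g * (x + n * (A * y + K)) * D + g * (n * y) * (D * B) = D * g * (x + n * ((A + B) * y + K))"
      for g x A y K D B :: real
      by (simp add: algebra_simps)
    ultimately show ?thesis
      unfolding z d_def[symmetric] G1_def G2_def prod.case by (simp only:)
  qed
  ultimately show ?thesis by (simp add: L_def)
qed

end

section \<open>Partial derivatives in time and space, and the divergence\<close>

lemma has_derivative_pair_time:
  fixes F :: "real \<Rightarrow> 'b :: real_normed_vector \<Rightarrow> real"
  assumes "((\<lambda>(s, z). F s z) has_derivative F') (at (t, x))"
  shows "deriv (\<lambda>s. F s x) t = F' (1, 0)"
proof -
  have "((\<lambda>s. (s, x)) has_derivative (\<lambda>d. (d, 0))) (at t)"
    by (auto intro!: derivative_eq_intros)
  from has_derivative_compose[OF this assms]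
  have "((\<lambda>s. F s x) has_derivative (\<lambda>d. F' (d, 0))) (at t)" by simp
  moreover have "(\<lambda>d. F' (d, 0)) = (\<lambda>d. F' (1, 0) * d)"
  proof
    fix d
    have "F' (d *\<^sub>R (1, 0)) = d *\<^sub>R F' (1, 0)"
      using has_derivative_linear[OF assms] by (rule linear_scale)
    then have "F' (d, 0) = d * F' (1, 0)"
      unfolding scaleR_Pair real_scaleR_def mult_1_right scaleR_zero_right .
    then show "F' (d, 0) = F' (1, 0) * d" by (rule trans) (rule mult.commute)
  qed
  ultimately show ?thesis
    by (intro DERIV_imp_deriv) (simp only: has_field_derivative_def)
qed

lemma has_derivative_pair_space:
  fixes F :: "real \<Rightarrow> 'b :: real_normed_vector \<Rightarrow> 'c :: real_normed_vector"
  assumes "((\<lambda>(s, z). F s z) has_derivative F') (at (t, x))"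
  shows "((\<lambda>z. F t z) has_derivative (\<lambda>d. F' (0, d))) (at x)"
proof -
  have "((\<lambda>z. (t, z)) has_derivative (\<lambda>d. (0, d))) (at x)"
    by (auto intro!: derivative_eq_intros)
  from has_derivative_compose[OF this assms] show ?thesis by simp
qed

lemma divergence_scaleR:
  fixes g :: "vec3 \<Rightarrow> real" and U :: "vec3 \<Rightarrow> vec3"
  assumes g: "(g has_derivative g') (at x)" and U: "(U has_derivative U') (at x)"
  shows "divergence (\<lambda>z. g z *\<^sub>R U z) x = g' (U x) + g x * (\<Sum>i\<in>UNIV. U' (axis i 1) $ i)"
proof -
  have "((\<lambda>z. g z *\<^sub>R U z) has_derivative (\<lambda>d. g x *\<^sub>R U' d + g' d *\<^sub>R U x)) (at x)"
    by (rule has_derivative_scaleR[OF g U])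
  then have "divergence (\<lambda>z. g z *\<^sub>R U z) x = (\<Sum>i\<in>UNIV. g x * U' (axis i 1) $ i + g' (axis i 1) * U x $ i)"
    unfolding divergence_def by (simp add: frechet_derivative_at[symmetric])
  moreover have "g' (U x) = (\<Sum>i\<in>UNIV. g' (axis i 1) * U x $ i)"
  proof -
    have "g' (U x) = g' (\<Sum>i\<in>UNIV. (U x $ i) *\<^sub>R axis i 1)"
      by (metis basis_expansion scalar_mult_eq_scaleR)
    also have "\<dots> = (\<Sum>i\<in>UNIV. g' (axis i 1) * U x $ i)"
      using has_derivative_linear[OF g] by (simp add: linear_sum linear_scale mult.commute)
    finally show ?thesis .
  qed
  ultimately show ?thesis by (simp add: sum.distrib sum_distrib_left)
qed

context internal_weight
begin

text \<open>Differentiability in space-time merges the time derivative and the directional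
  derivative along \<open>v\<close> into one derivative in direction \<open>(\<epsilon>, v)\<close>.
  The Maxwellian form is asked for on an open set, as derivatives are taken, and for nonnegative
  \<open>I\<close>, which is what the state measure sees.\<close>

lemma maxwellian_field_moment:
  fixes n \<Theta> :: "real \<Rightarrow> vec3 \<Rightarrow> real" and u :: "real \<Rightarrow> vec3 \<Rightarrow> vec3"
    and F :: "real \<Rightarrow> vec3 \<Rightarrow> vec3 \<Rightarrow> real \<Rightarrow> real"
  assumes m: "0 < m" and \<Theta>: "0 < \<Theta> t x"
    and diff: "(\<lambda>(s, z). n s z) differentiable at (t, x)"
      "(\<lambda>(s, z). \<Theta> s z) differentiable at (t, x)" "(\<lambda>(s, z). u s z) differentiable at (t, x)"
    and S: "open S" "(t, x) \<in> S"
    and F: "\<And>s z v I. (s, z) \<in> S \<Longrightarrow> 0 \<le> I \<Longrightarrow>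
      F s z v I = maxwellian kB m \<phi> (n s z) (\<Theta> s z) (\<epsilon> *\<^sub>R u s z) v I"
  shows "has_bochner_integral state_measure
    (\<lambda>(v, I). (\<epsilon> * deriv (\<lambda>s. F s x v I) t + frechet_derivative (\<lambda>z. F t z v I) (at x) v) * \<phi> I)
    (\<epsilon> * (deriv (\<lambda>s. n s x) t + divergence (\<lambda>z. n t z *\<^sub>R u t z) x))"
proof -
  obtain n' \<Theta>' u' where n': "((\<lambda>(s, z). n s z) has_derivative n') (at (t, x))"
    and \<Theta>': "((\<lambda>(s, z). \<Theta> s z) has_derivative \<Theta>') (at (t, x))"
    and u': "((\<lambda>(s, z). u s z) has_derivative u') (at (t, x))"
    using diff unfolding differentiable_def by blast
  define U' where "U' = (\<lambda>d. \<epsilon> *\<^sub>R u' d)"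
  have U': "((\<lambda>(s, z). \<epsilon> *\<^sub>R u s z) has_derivative U') (at (t, x))"
    using has_derivative_scaleR_right[OF u', of \<epsilon>] by (simp add: U'_def case_prod_unfold)
  define D where "D = (\<lambda>v I d. maxwellian kB m \<phi> 1 (\<Theta> t x) (\<epsilon> *\<^sub>R u t x) v I * (n' d + n t x *
       (((m * (norm (v - \<epsilon> *\<^sub>R u t x))\<^sup>2 / 2 + I) / (kB * (\<Theta> t x)\<^sup>2) - 3 / (2 * \<Theta> t x)
          - partition_deriv (\<Theta> t x) / partition_fun kB \<phi> (\<Theta> t x)) * \<Theta>' d
        + m / (kB * \<Theta> t x) * ((v - \<epsilon> *\<^sub>R u t x) \<bullet> U' d))))"
  have D: "((\<lambda>(s, z). F s z v I) has_derivative D v I) (at (t, x))" if "0 \<le> I" for v I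
  proof (rule has_derivative_transform_within_open[OF _ S])
    show "((\<lambda>p. maxwellian kB m \<phi> (case p of (s, z) \<Rightarrow> n s z) (case p of (s, z) \<Rightarrow> \<Theta> s z)
        (case p of (s, z) \<Rightarrow> \<epsilon> *\<^sub>R u s z) v I) has_derivative D v I) (at (t, x))"
      using maxwellian_has_derivative[OF m _ n' \<Theta>' U', of v I] \<Theta> by (simp add: D_def)
  qed (use that F in auto)
  have lhs: "\<epsilon> * deriv (\<lambda>s. F s x v I) t + frechet_derivative (\<lambda>z. F t z v I) (at x) v = D v I (\<epsilon>, v)"
    if "0 \<le> I" for v I
  proof -
    have "frechet_derivative (\<lambda>z. F t z v I) (at x) = (\<lambda>d. D v I (0, d))"
      using frechet_derivative_at[OF has_derivative_pair_space[OF D[OF that]]] by simp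
    then have "\<epsilon> * deriv (\<lambda>s. F s x v I) t + frechet_derivative (\<lambda>z. F t z v I) (at x) v
        = \<epsilon> *\<^sub>R D v I (1, 0) + D v I (0, v)"
      using has_derivative_pair_time[OF D[OF that]] by simp
    also have "\<dots> = D v I (\<epsilon> *\<^sub>R (1, 0) + (0, v))"
      using has_derivative_linear[OF D[OF that]] by (simp only: linear_add linear_scale)
    finally show ?thesis by simp
  qed
  have "has_bochner_integral state_measure (\<lambda>(v, I). D v I (\<epsilon>, v) * \<phi> I)
      (n' (\<epsilon>, \<epsilon> *\<^sub>R u t x) + n t x * (\<Sum>i\<in>UNIV. U' (0, axis i 1) $ i))"
    unfolding D_def
    by (intro maxwellian_transport_moment m \<Theta> has_derivative_bounded_linear[OF n']
        has_derivative_bounded_linear[OF \<Theta>'] has_derivative_bounded_linear[OF U'])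
  moreover have "n' (\<epsilon>, \<epsilon> *\<^sub>R u t x) + n t x * (\<Sum>i\<in>UNIV. U' (0, axis i 1) $ i)
      = \<epsilon> * (deriv (\<lambda>s. n s x) t + divergence (\<lambda>z. n t z *\<^sub>R u t z) x)"
  proof -
    \<comment> \<open>The drift is of order epsilon, so a factor epsilon comes out of the time
      derivative, the advection term and the trace alike; the product rule then reassembles the
      divergence of the flux.\<close>
    have "n' (\<epsilon>, \<epsilon> *\<^sub>R u t x) = n' (\<epsilon> *\<^sub>R ((1, 0) + (0, u t x)))" by simp
    also have "\<dots> = \<epsilon> * (n' (1, 0) + n' (0, u t x))"
      using has_derivative_linear[OF n'] by (simp only: linear_add linear_scale real_scaleR_def)
    finally show ?thesis
      using divergence_scaleR[OF has_derivative_pair_space[OF n'] has_derivative_pair_space[OF u']]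
        has_derivative_pair_time[OF n']
      by (simp add: U'_def sum_distrib_left algebra_simps)
  qed
  ultimately have "has_bochner_integral state_measure (\<lambda>(v, I). D v I (\<epsilon>, v) * \<phi> I)
    (\<epsilon> * (deriv (\<lambda>s. n s x) t + divergence (\<lambda>z. n t z *\<^sub>R u t z) x))"
    by simp
  then show ?thesis
    by (rule has_bochner_integral_cong[THEN iffD1, rotated -1])
      (auto simp: state_measure_def space_pair_measure lhs)
qed

text \<open>One constant serves all velocities and energies. The two size bounds accompany the
  difference because the reaction bracket is quadratic: in a difference of products, the unchanged
  factor has to be bounded too.\<close>

lemma maxwellian_perturbation:
  fixes n \<theta> :: "real \<Rightarrow> real" and u :: "real \<Rightarrow> vec3"
  assumes m: "0 < m" and T: "0 < T"
    and n: "n \<in> O[at_right 0](\<lambda>_. 1)" and \<theta>: "\<theta> \<in> O[at_right 0](\<lambda>_. 1)"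
    and u: "(\<lambda>\<epsilon>. norm (u \<epsilon>)) \<in> O[at_right 0](\<lambda>_. 1)"
  shows "\<exists>C. \<forall>\<^sub>F \<epsilon> in at_right 0. \<forall>v. \<forall>I\<ge>0.
    \<bar>maxwellian kB m \<phi> (n \<epsilon>) (T + \<epsilon> * \<theta> \<epsilon>) (\<epsilon> *\<^sub>R u \<epsilon>) v I - maxwellian kB m \<phi> (n \<epsilon>) T 0 v I\<bar>
      \<le> C * \<epsilon> * exp (- (m * (norm v)\<^sup>2 / 2 + I) / (2 * kB * T)) \<and>
    \<bar>maxwellian kB m \<phi> (n \<epsilon>) (T + \<epsilon> * \<theta> \<epsilon>) (\<epsilon> *\<^sub>R u \<epsilon>) v I\<bar>
      \<le> C * exp (- (m * (norm v)\<^sup>2 / 2 + I) / (2 * kB * T)) \<and>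
    \<bar>maxwellian kB m \<phi> (n \<epsilon>) T 0 v I\<bar>
      \<le> C * exp (- (m * (norm v)\<^sup>2 / 2 + I) / (2 * kB * T))"
proof -
  define c where "c = maxwellian_prefactor m"
  obtain Kn K\<theta> Ku where K: "\<forall>\<^sub>F \<epsilon> in at_right 0. \<bar>n \<epsilon>\<bar> \<le> Kn" "\<forall>\<^sub>F \<epsilon> in at_right 0. \<bar>\<theta> \<epsilon>\<bar> \<le> K\<theta>"
      "\<forall>\<^sub>F \<epsilon> in at_right 0. norm (u \<epsilon>) \<le> Ku"
    using n \<theta> u by (auto elim!: landau_o.bigE)
  define K where "K = max 1 (max Kn (max K\<theta> Ku))"
  have K1: "1 \<le> K" by (simp add: K_def)
  obtain c' where c': "DERIV c T :> c'"
    using maxwellian_prefactor_has_derivative[OF m T] unfolding c_def by blast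
  define \<kappa> where "\<kappa> = 1 / (kB * T)"
  have \<kappa>: "0 < \<kappa>" using kB T by (simp add: \<kappa>_def)
  \<comment> \<open>Change of the exponent per unit of \<open>\<epsilon> * (1 + h)\<close>: the
    first summand comes from the drift, the second from the temperature, with denominators bounded
    by means of \<open>T / 2 \<le> \<tau>\<close>.\<close>
  define B where "B = (m * (K + K\<^sup>2) + 2 * K) / (kB * T) + 2 * K / (kB * T\<^sup>2)"
  have B: "0 < B"
    using m K1 kB T by (auto simp: B_def intro!: add_pos_pos divide_pos_pos mult_pos_pos zero_less_power)
  \<comment> \<open>Differentiability at the single point \<open>T\<close> yields this one-sided
    form of a Lipschitz bound, with the derivative enlarged by 1.\<close>
  obtain \<delta> where \<delta>: "0 < \<delta>" and lip: "\<And>\<tau>. \<bar>\<tau> - T\<bar> < \<delta> \<Longrightarrow> \<bar>c \<tau> - c T\<bar> \<le> (\<bar>c'\<bar> + 1) * \<bar>\<tau> - T\<bar>"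
  proof -
    have "((\<lambda>\<tau>. (c \<tau> - c T) / (\<tau> - T)) \<longlongrightarrow> c') (at T)"
      using c' by (simp add: has_field_derivative_iff)
    then obtain \<delta> where \<delta>: "0 < \<delta>"
      and *: "\<And>\<tau>. \<tau> \<noteq> T \<Longrightarrow> \<bar>\<tau> - T\<bar> < \<delta> \<Longrightarrow> \<bar>(c \<tau> - c T) / (\<tau> - T) - c'\<bar> < 1"
      unfolding tendsto_iff eventually_at dist_real_def
      by (metis UNIV_I zero_less_one)
    have "\<bar>c \<tau> - c T\<bar> \<le> (\<bar>c'\<bar> + 1) * \<bar>\<tau> - T\<bar>" if "\<bar>\<tau> - T\<bar> < \<delta>" for \<tau>
    proof (cases "\<tau> = T")
      case False
      then have "\<bar>(c \<tau> - c T) / (\<tau> - T)\<bar> \<le> \<bar>c'\<bar> + 1"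
        using *[OF False that] by linarith
      then show ?thesis using False by (simp add: field_simps)
    qed simp
    with \<delta> show thesis by (rule that)
  qed
  define C1 where "C1 = \<bar>c T\<bar> + (\<bar>c'\<bar> + 1) * K"
  define C where "C = K * ((\<bar>c'\<bar> + 1) * K * exp 1 + \<bar>c T\<bar> * (B * exp 1 * (1 + 4 / \<kappa>))) + K * C1 * exp 1"
  have C1: "\<bar>c T\<bar> \<le> C1" "0 \<le> C1" using K1 by (auto simp: C1_def)
  have Cle: "K * ((\<bar>c'\<bar> + 1) * K * exp 1 + \<bar>c T\<bar> * (B * exp 1 * (1 + 4 / \<kappa>))) \<le> C" "K * C1 * exp 1 \<le> C"
    using K1 C1 B \<kappa> by (auto simp: C_def)
  \<comment> \<open>The five entries secure in turn \<open>\<epsilon> \<le> 1\<close>, a temperature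
    of at least \<open>T / 2\<close>, a temperature within \<open>\<delta>\<close> of
    \<open>T\<close>, and the two bounds that give
    \<open>B * \<epsilon> * (1 + h) \<le> 1 + \<kappa> / 4 * h\<close>.\<close>
  define \<epsilon>1 where "\<epsilon>1 = Min {1, T / (2 * K), \<delta> / (2 * K), 1 / B, \<kappa> / (4 * B)}"
  have \<epsilon>1: "0 < \<epsilon>1" using K1 T \<delta> B \<kappa> by (auto simp: \<epsilon>1_def)
  have "\<forall>\<^sub>F \<epsilon> in at_right 0. 0 < \<epsilon> \<and> \<epsilon> < \<epsilon>1"
    using \<epsilon>1 by (auto simp: eventually_at_right intro!: exI[of _ \<epsilon>1])
  then show ?thesis
    using K
  proof (intro exI[of _ C], eventually_elim)
    case (elim \<epsilon>)
    then have \<epsilon>: "0 < \<epsilon>" "\<epsilon> \<le> 1" "\<epsilon> * K \<le> T / 2" "\<epsilon> * K < \<delta>" "B * \<epsilon> \<le> 1" "B * \<epsilon> \<le> \<kappa> / 4"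
      using K1 B \<delta> by (auto simp: \<epsilon>1_def field_simps)
    have bnd: "\<bar>n \<epsilon>\<bar> \<le> K" "\<bar>\<theta> \<epsilon>\<bar> \<le> K" "norm (u \<epsilon>) \<le> K"
      using elim by (auto simp: K_def)
    define \<tau> where "\<tau> = T + \<epsilon> * \<theta> \<epsilon>"
    have \<tau>T: "\<bar>\<tau> - T\<bar> \<le> \<epsilon> * K"
      using \<epsilon>(1) bnd(2) by (simp add: \<tau>_def abs_mult)
    have \<tau>: "T / 2 \<le> \<tau>" "0 < \<tau>"
      using \<tau>T \<epsilon>(3) T by linarith+
    have cdiff: "\<bar>c \<tau> - c T\<bar> \<le> (\<bar>c'\<bar> + 1) * K * \<epsilon>"
    proof -
      have "\<bar>c \<tau> - c T\<bar> \<le> (\<bar>c'\<bar> + 1) * \<bar>\<tau> - T\<bar>"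
        using \<tau>T \<epsilon>(4) by (intro lip) linarith
      also have "\<dots> \<le> (\<bar>c'\<bar> + 1) * (\<epsilon> * K)"
        using \<tau>T by (intro mult_left_mono) auto
      finally show ?thesis by (simp add: mult_ac)
    qed
    have ctau: "\<bar>c \<tau>\<bar> \<le> C1"
    proof -
      have "(\<bar>c'\<bar> + 1) * K * \<epsilon> \<le> (\<bar>c'\<bar> + 1) * K * 1"
        using \<epsilon>(2) K1 by (intro mult_left_mono) auto
      with cdiff show ?thesis unfolding C1_def by linarith
    qed
    show ?case
    proof (intro allI impI)
      fix v :: vec3 and I :: real
      assume I: "0 \<le> I"
      define h where "h = m * (norm v)\<^sup>2 / 2 + I"
      define a where "a = (m * (norm (v - \<epsilon> *\<^sub>R u \<epsilon>))\<^sup>2 / 2 + I) / (kB * \<tau>)"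
      define a0 where "a0 = \<kappa> * h"
      have h: "0 \<le> h" "m * (norm v)\<^sup>2 \<le> 2 * h" using m I by (auto simp: h_def)
      have M: "maxwellian kB m \<phi> (n \<epsilon>) \<tau> (\<epsilon> *\<^sub>R u \<epsilon>) v I = n \<epsilon> * c \<tau> * exp (- a)"
        unfolding maxwellian_eq_prefactor a_def c_def by (simp add: add_divide_distrib mult_ac diff_divide_distrib)
      have M0: "maxwellian kB m \<phi> (n \<epsilon>) T 0 v I = n \<epsilon> * c T * exp (- a0)"
        unfolding maxwellian_eq_prefactor a0_def \<kappa>_def h_def c_def by (simp add: add_divide_distrib mult_ac diff_divide_distrib)
      have e: "exp (- (m * (norm v)\<^sup>2 / 2 + I) / (2 * kB * T)) = exp (- (\<kappa> / 2 * h))"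
        using kB T by (simp add: h_def \<kappa>_def field_simps)
      have adiff: "\<bar>a - a0\<bar> \<le> B * \<epsilon> * (1 + h)"
      proof -
        define p where "p = m * ((norm (v - \<epsilon> *\<^sub>R u \<epsilon>))\<^sup>2 - (norm v)\<^sup>2) / 2"
        have "a - a0 = p / (kB * \<tau>) + h * (1 / (kB * \<tau>) - 1 / (kB * T))"
          using kB T \<tau> by (simp add: a_def a0_def p_def h_def \<kappa>_def field_simps)
        then have "\<bar>a - a0\<bar> \<le> \<bar>p / (kB * \<tau>)\<bar> + \<bar>h * (1 / (kB * \<tau>) - 1 / (kB * T))\<bar>"
          by (metis abs_triangle_ineq)
        moreover have "\<bar>p / (kB * \<tau>)\<bar> \<le> (m * (K + K\<^sup>2) + 2 * K) / (kB * T) * \<epsilon> * (1 + h)"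
        proof -
          have "(norm (v - \<epsilon> *\<^sub>R u \<epsilon>))\<^sup>2 - (norm v)\<^sup>2 = \<epsilon> * (\<epsilon> * (norm (u \<epsilon>))\<^sup>2 - 2 * (v \<bullet> u \<epsilon>))"
            unfolding power2_norm_eq_inner inner_diff_left inner_diff_right inner_scaleR_left inner_scaleR_right
              inner_commute[of "u \<epsilon>" v] by algebra
          moreover have "\<bar>\<epsilon> * (norm (u \<epsilon>))\<^sup>2 - 2 * (v \<bullet> u \<epsilon>)\<bar> \<le> K + K\<^sup>2 + K * (norm v)\<^sup>2"
          proof -
            have "\<epsilon> * (norm (u \<epsilon>))\<^sup>2 \<le> 1 * K\<^sup>2"
              using \<epsilon> bnd by (intro mult_mono power_mono) auto
            moreover have "\<bar>v \<bullet> u \<epsilon>\<bar> \<le> norm v * K"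
              using Cauchy_Schwarz_ineq2[of v "u \<epsilon>"] bnd(3)
              by (meson mult_left_mono norm_ge_zero order_trans)
            moreover have "2 * (norm v * K) \<le> K + K * (norm v)\<^sup>2"
            proof -
              have "0 \<le> K * (norm v - 1)\<^sup>2" using K1 by simp
              then show ?thesis by (simp add: power2_eq_square algebra_simps)
            qed
            moreover have "0 \<le> \<epsilon> * (norm (u \<epsilon>))\<^sup>2" using \<epsilon> by simp
            ultimately show ?thesis by linarith
          qed
          ultimately have "\<bar>(norm (v - \<epsilon> *\<^sub>R u \<epsilon>))\<^sup>2 - (norm v)\<^sup>2\<bar> \<le> \<epsilon> * (K + K\<^sup>2 + K * (norm v)\<^sup>2)"
            using \<epsilon>(1) by (simp add: abs_mult mult_left_mono)
          then have "\<bar>p\<bar> \<le> m / 2 * (\<epsilon> * (K + K\<^sup>2 + K * (norm v)\<^sup>2))"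
            using m by (simp add: p_def abs_mult)
          also have "\<dots> = \<epsilon> / 2 * (m * (K + K\<^sup>2) + K * (m * (norm v)\<^sup>2))"
            by (simp add: algebra_simps)
          also have "\<dots> \<le> \<epsilon> / 2 * (m * (K + K\<^sup>2) + K * (2 * h))"
            using \<epsilon>(1) K1 by (intro mult_left_mono add_left_mono h) auto
          also have "\<dots> \<le> \<epsilon> / 2 * ((m * (K + K\<^sup>2) + 2 * K) * (1 + h))"
          proof (intro mult_left_mono)
            have "0 \<le> m * (K + K\<^sup>2) * h" "0 \<le> 2 * K" using m K1 h by auto
            then show "m * (K + K\<^sup>2) + K * (2 * h) \<le> (m * (K + K\<^sup>2) + 2 * K) * (1 + h)"
              by (simp add: algebra_simps)
          qed (use \<epsilon> in auto)
          finally have "\<bar>p\<bar> / (kB * \<tau>) \<le> (\<epsilon> / 2 * ((m * (K + K\<^sup>2) + 2 * K) * (1 + h))) / (kB * (T / 2))"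
            using kB \<tau> T m K1 h \<epsilon> by (intro frac_le mult_left_mono) auto
          also have "\<dots> = (m * (K + K\<^sup>2) + 2 * K) / (kB * T) * \<epsilon> * (1 + h)"
          proof -
            have "(\<epsilon> / 2 * (x * (1 + h))) / (kB * (T / 2)) = x / (kB * T) * \<epsilon> * (1 + h)" for x
              using kB T by (simp add: field_simps)
            then show ?thesis .
          qed
          finally show ?thesis using kB \<tau> by (simp only: abs_divide abs_mult abs_of_pos)
        qed
        moreover have "\<bar>h * (1 / (kB * \<tau>) - 1 / (kB * T))\<bar> \<le> 2 * K / (kB * T\<^sup>2) * \<epsilon> * (1 + h)"
        proof -
          have "1 / (kB * \<tau>) - 1 / (kB * T) = (T - \<tau>) / (kB * T * \<tau>)"
            using kB T \<tau> by (simp add: field_simps)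
          then have "\<bar>1 / (kB * \<tau>) - 1 / (kB * T)\<bar> = \<bar>\<tau> - T\<bar> / (kB * T * \<tau>)"
            using kB T \<tau> by (simp add: abs_mult abs_minus_commute)
          also have "\<dots> \<le> (\<epsilon> * K) / (kB * T * (T / 2))"
            using kB T \<tau> \<tau>T \<epsilon> K1 by (intro frac_le mult_left_mono) auto
          also have "\<dots> = 2 * K / (kB * T\<^sup>2) * \<epsilon>"
            by (simp add: power2_eq_square mult_ac)
          finally have "\<bar>1 / (kB * \<tau>) - 1 / (kB * T)\<bar> \<le> 2 * K / (kB * T\<^sup>2) * \<epsilon>" .
          then have "\<bar>1 / (kB * \<tau>) - 1 / (kB * T)\<bar> * h \<le> 2 * K / (kB * T\<^sup>2) * \<epsilon> * (1 + h)"
            using h K1 \<epsilon> kB by (intro mult_mono) auto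
          then show ?thesis using h by (simp add: abs_mult mult.commute)
        qed
        ultimately show ?thesis by (simp add: B_def algebra_simps)
      qed
      \<comment> \<open>A quarter of the decay rate \<open>\<kappa>\<close> pays for the change of
        the exponent; the factor \<open>1 + h\<close> in \<open>ediff\<close> will cost another
        quarter, and \<open>\<kappa> / 2\<close> is left. That is the Boltzmann rate at temperature
        2T.\<close>
      have low: "- a \<le> 1 - 3 / 4 * \<kappa> * h" "- a0 \<le> 1 - 3 / 4 * \<kappa> * h"
      proof -
        have "B * \<epsilon> * (1 + h) \<le> 1 + \<kappa> / 4 * h"
        proof -
          have "B * \<epsilon> * h \<le> \<kappa> / 4 * h" using \<epsilon> h by (intro mult_right_mono) auto
          with \<epsilon> show ?thesis by (simp add: algebra_simps)
        qed
        with adiff show "- a \<le> 1 - 3 / 4 * \<kappa> * h" unfolding a0_def by linarith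
        have "0 \<le> \<kappa> * h" using \<kappa> h by simp
        then show "- a0 \<le> 1 - 3 / 4 * \<kappa> * h" unfolding a0_def by linarith
      qed
      have weak: "exp (1 - 3 / 4 * \<kappa> * h) \<le> exp 1 * exp (- (\<kappa> / 2 * h))"
        using \<kappa> h by (simp add: exp_add[symmetric])
      have ea: "exp (- a) \<le> exp 1 * exp (- (\<kappa> / 2 * h))"
        using low(1) weak by (meson exp_le_cancel_iff order_trans)
      have ea0: "exp (- a0) \<le> exp 1 * exp (- (\<kappa> / 2 * h))"
        using low(2) weak by (meson exp_le_cancel_iff order_trans)
      have ediff: "\<bar>exp (- a) - exp (- a0)\<bar> \<le> B * exp 1 * (1 + 4 / \<kappa>) * \<epsilon> * exp (- (\<kappa> / 2 * h))"
      proof -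
        have "\<bar>exp (- a) - exp (- a0)\<bar> \<le> \<bar>- a - - a0\<bar> * exp (max (- a) (- a0))"
          by (rule abs_exp_diff_le)
        also have "\<dots> \<le> (B * \<epsilon> * (1 + h)) * exp (1 - 3 / 4 * \<kappa> * h)"
          using adiff low by (intro mult_mono) auto
        also have "\<dots> = B * \<epsilon> * (exp 1 * ((1 + h) * exp (- (3 / 4 * \<kappa> * h))))"
        proof -
          have "exp (1 - 3 / 4 * \<kappa> * h) = exp 1 * exp (- (3 / 4 * \<kappa> * h))"
            by (simp add: exp_add[symmetric])
          then show ?thesis by (simp only: mult_ac)
        qed
        also have "\<dots> \<le> B * \<epsilon> * (exp 1 * ((1 + 4 / \<kappa>) * exp (- (\<kappa> / 2 * h))))"
        proof -
          have "1 \<le> exp (\<kappa> / 4 * h)" using \<kappa> h by simp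
          moreover have "h \<le> exp (\<kappa> / 4 * h) / (\<kappa> / 4)" using \<kappa> by (intro le_exp_scaled) auto
          ultimately have "1 + h \<le> exp (\<kappa> / 4 * h) + exp (\<kappa> / 4 * h) / (\<kappa> / 4)" by (rule add_mono)
          then have "1 + h \<le> (1 + 4 / \<kappa>) * exp (\<kappa> / 4 * h)"
            by (simp add: algebra_simps)
          then have "(1 + h) * exp (- (3 / 4 * \<kappa> * h)) \<le> (1 + 4 / \<kappa>) * exp (\<kappa> / 4 * h) * exp (- (3 / 4 * \<kappa> * h))"
            by (rule mult_right_mono) simp
          also have "\<dots> = (1 + 4 / \<kappa>) * exp (- (\<kappa> / 2 * h))"
            by (simp add: mult.assoc exp_add[symmetric])
          finally show ?thesis
            using B \<epsilon> by (intro mult_left_mono) auto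
        qed
        finally show ?thesis by (simp only: mult_ac)
      qed
      have 1: "\<bar>n \<epsilon> * c \<tau> * exp (- a) - n \<epsilon> * c T * exp (- a0)\<bar> \<le> C * \<epsilon> * exp (- (\<kappa> / 2 * h))"
      proof -
        have "n \<epsilon> * c \<tau> * exp (- a) - n \<epsilon> * c T * exp (- a0)
            = n \<epsilon> * ((c \<tau> - c T) * exp (- a) + c T * (exp (- a) - exp (- a0)))"
          by (simp add: algebra_simps)
        then have "\<bar>n \<epsilon> * c \<tau> * exp (- a) - n \<epsilon> * c T * exp (- a0)\<bar>
            = \<bar>n \<epsilon>\<bar> * \<bar>(c \<tau> - c T) * exp (- a) + c T * (exp (- a) - exp (- a0))\<bar>"
          by (simp only: abs_mult)
        also have "\<dots> \<le> K * (((\<bar>c'\<bar> + 1) * K * \<epsilon>) * (exp 1 * exp (- (\<kappa> / 2 * h)))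
            + \<bar>c T\<bar> * (B * exp 1 * (1 + 4 / \<kappa>) * \<epsilon> * exp (- (\<kappa> / 2 * h))))"
        proof (intro mult_mono bnd)
          have "\<bar>(c \<tau> - c T) * exp (- a) + c T * (exp (- a) - exp (- a0))\<bar>
              \<le> \<bar>c \<tau> - c T\<bar> * exp (- a) + \<bar>c T\<bar> * \<bar>exp (- a) - exp (- a0)\<bar>"
            by (rule order_trans[OF abs_triangle_ineq]) (simp add: abs_mult)
          also have "\<dots> \<le> ((\<bar>c'\<bar> + 1) * K * \<epsilon>) * (exp 1 * exp (- (\<kappa> / 2 * h)))
            + \<bar>c T\<bar> * (B * exp 1 * (1 + 4 / \<kappa>) * \<epsilon> * exp (- (\<kappa> / 2 * h)))"
            using K1 \<epsilon> by (intro add_mono mult_mono cdiff ea ediff) auto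
          finally show "\<bar>(c \<tau> - c T) * exp (- a) + c T * (exp (- a) - exp (- a0))\<bar> \<le> \<dots>" .
        qed (use K1 in auto)
        also have "\<dots> = K * ((\<bar>c'\<bar> + 1) * K * exp 1 + \<bar>c T\<bar> * (B * exp 1 * (1 + 4 / \<kappa>))) * \<epsilon> * exp (- (\<kappa> / 2 * h))"
          by (simp only: ring_distribs mult_ac)
        also have "\<dots> \<le> C * \<epsilon> * exp (- (\<kappa> / 2 * h))"
          using Cle(1) \<epsilon> by (intro mult_right_mono) auto
        finally show ?thesis .
      qed
      have size: "\<bar>n \<epsilon> * x * y\<bar> \<le> C * exp (- (\<kappa> / 2 * h))"
        if "\<bar>x\<bar> \<le> C1" "0 \<le> y" "y \<le> exp 1 * exp (- (\<kappa> / 2 * h))" for x y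
      proof -
        have "\<bar>n \<epsilon> * x * y\<bar> = \<bar>n \<epsilon>\<bar> * \<bar>x\<bar> * y" using that by (simp add: abs_mult)
        also have "\<dots> \<le> K * C1 * (exp 1 * exp (- (\<kappa> / 2 * h)))"
          using that bnd K1 C1 by (intro mult_mono) auto
        also have "\<dots> = K * C1 * exp 1 * exp (- (\<kappa> / 2 * h))" by simp
        also have "\<dots> \<le> C * exp (- (\<kappa> / 2 * h))"
          using Cle(2) by (intro mult_right_mono) auto
        finally show ?thesis .
      qed
      show "\<bar>maxwellian kB m \<phi> (n \<epsilon>) (T + \<epsilon> * \<theta> \<epsilon>) (\<epsilon> *\<^sub>R u \<epsilon>) v I - maxwellian kB m \<phi> (n \<epsilon>) T 0 v I\<bar>
          \<le> C * \<epsilon> * exp (- (m * (norm v)\<^sup>2 / 2 + I) / (2 * kB * T)) \<and>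
        \<bar>maxwellian kB m \<phi> (n \<epsilon>) (T + \<epsilon> * \<theta> \<epsilon>) (\<epsilon> *\<^sub>R u \<epsilon>) v I\<bar>
          \<le> C * exp (- (m * (norm v)\<^sup>2 / 2 + I) / (2 * kB * T)) \<and>
        \<bar>maxwellian kB m \<phi> (n \<epsilon>) T 0 v I\<bar>
          \<le> C * exp (- (m * (norm v)\<^sup>2 / 2 + I) / (2 * kB * T))"
        unfolding \<tau>_def[symmetric] M M0 e
        using 1 size[OF ctau _ ea] size[OF C1(1) _ ea0] by simp
    qed
  qed
qed

end

section \<open>Two-particle integrals\<close>

text \<open>Collision integrals group the variables by particle, whereas the factorization of the
  rate wants both velocities on one side and all remaining parameters on the other. By Tonelli this
  amounts to exchanging the two middle variables.\<close>

lemma distr_pair_interchange: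
  assumes A: "sigma_finite_measure A" and B: "sigma_finite_measure B"
    and C: "sigma_finite_measure C" and D: "sigma_finite_measure D"
  shows "distr ((A \<Otimes>\<^sub>M B) \<Otimes>\<^sub>M (C \<Otimes>\<^sub>M D)) ((A \<Otimes>\<^sub>M C) \<Otimes>\<^sub>M (B \<Otimes>\<^sub>M D))
      (\<lambda>z. ((fst (fst z), fst (snd z)), (snd (fst z), snd (snd z))))
    = (A \<Otimes>\<^sub>M C) \<Otimes>\<^sub>M (B \<Otimes>\<^sub>M D)"
proof (rule measure_eqI)
  interpret A: sigma_finite_measure A by fact
  interpret B: sigma_finite_measure B by fact
  interpret C: sigma_finite_measure C by fact
  interpret D: sigma_finite_measure D by fact
  interpret CD: sigma_finite_measure "C \<Otimes>\<^sub>M D" by (rule sigma_finite_pair_measure[OF C D])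
  interpret BD: sigma_finite_measure "B \<Otimes>\<^sub>M D" by (rule sigma_finite_pair_measure[OF B D])
  interpret BC: pair_sigma_finite B C ..
  let ?re = "\<lambda>z. ((fst (fst z), fst (snd z)), (snd (fst z), snd (snd z)))"
  fix X assume "X \<in> sets (distr ((A \<Otimes>\<^sub>M B) \<Otimes>\<^sub>M (C \<Otimes>\<^sub>M D)) ((A \<Otimes>\<^sub>M C) \<Otimes>\<^sub>M (B \<Otimes>\<^sub>M D)) ?re)"
  then have X [measurable]: "X \<in> sets ((A \<Otimes>\<^sub>M C) \<Otimes>\<^sub>M (B \<Otimes>\<^sub>M D))" by simp
  let ?f = "indicator X :: _ \<Rightarrow> ennreal"
  have "emeasure (distr ((A \<Otimes>\<^sub>M B) \<Otimes>\<^sub>M (C \<Otimes>\<^sub>M D)) ((A \<Otimes>\<^sub>M C) \<Otimes>\<^sub>M (B \<Otimes>\<^sub>M D)) ?re) X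
      = (\<integral>\<^sup>+ z. ?f z \<partial>distr ((A \<Otimes>\<^sub>M B) \<Otimes>\<^sub>M (C \<Otimes>\<^sub>M D)) ((A \<Otimes>\<^sub>M C) \<Otimes>\<^sub>M (B \<Otimes>\<^sub>M D)) ?re)"
    by simp
  also have "\<dots> = (\<integral>\<^sup>+ z. ?f (?re z) \<partial>((A \<Otimes>\<^sub>M B) \<Otimes>\<^sub>M (C \<Otimes>\<^sub>M D)))"
  proof (rule nn_integral_distr)
    show "?re \<in> measurable ((A \<Otimes>\<^sub>M B) \<Otimes>\<^sub>M (C \<Otimes>\<^sub>M D)) ((A \<Otimes>\<^sub>M C) \<Otimes>\<^sub>M (B \<Otimes>\<^sub>M D))"
      by measurable
  qed simp
  also have "\<dots> = (\<integral>\<^sup>+ ab. \<integral>\<^sup>+ cd. ?f (?re (ab, cd)) \<partial>(C \<Otimes>\<^sub>M D) \<partial>(A \<Otimes>\<^sub>M B))"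
    by (rule CD.nn_integral_fst[symmetric]) measurable
  also have "\<dots> = (\<integral>\<^sup>+ a. \<integral>\<^sup>+ b. \<integral>\<^sup>+ cd. ?f (?re ((a, b), cd)) \<partial>(C \<Otimes>\<^sub>M D) \<partial>B \<partial>A)"
    by (rule B.nn_integral_fst[symmetric]) measurable
  also have "\<dots> = (\<integral>\<^sup>+ a. \<integral>\<^sup>+ b. \<integral>\<^sup>+ c. \<integral>\<^sup>+ d. ?f ((a, c), (b, d)) \<partial>D \<partial>C \<partial>B \<partial>A)"
  proof (intro nn_integral_cong)
    fix a b assume [measurable]: "a \<in> space A" "b \<in> space B"
    have "(\<integral>\<^sup>+ cd. ?f (?re ((a, b), cd)) \<partial>(C \<Otimes>\<^sub>M D)) = (\<integral>\<^sup>+ c. \<integral>\<^sup>+ d. ?f (?re ((a, b), (c, d))) \<partial>D \<partial>C)"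
      by (rule D.nn_integral_fst[symmetric]) measurable
    then show "(\<integral>\<^sup>+ cd. ?f (?re ((a, b), cd)) \<partial>(C \<Otimes>\<^sub>M D)) = (\<integral>\<^sup>+ c. \<integral>\<^sup>+ d. ?f ((a, c), (b, d)) \<partial>D \<partial>C)"
      by simp
  qed
  also have "\<dots> = (\<integral>\<^sup>+ a. \<integral>\<^sup>+ c. \<integral>\<^sup>+ b. \<integral>\<^sup>+ d. ?f ((a, c), (b, d)) \<partial>D \<partial>B \<partial>C \<partial>A)"
  proof (intro nn_integral_cong)
    fix a assume [measurable]: "a \<in> space A"
    show "(\<integral>\<^sup>+ b. \<integral>\<^sup>+ c. \<integral>\<^sup>+ d. ?f ((a, c), (b, d)) \<partial>D \<partial>C \<partial>B) = (\<integral>\<^sup>+ c. \<integral>\<^sup>+ b. \<integral>\<^sup>+ d. ?f ((a, c), (b, d)) \<partial>D \<partial>B \<partial>C)"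
      by (rule BC.Fubini'[symmetric]) measurable
  qed
  also have "\<dots> = (\<integral>\<^sup>+ a. \<integral>\<^sup>+ c. \<integral>\<^sup>+ bd. ?f ((a, c), bd) \<partial>(B \<Otimes>\<^sub>M D) \<partial>C \<partial>A)"
  proof (intro nn_integral_cong)
    fix a c assume [measurable]: "a \<in> space A" "c \<in> space C"
    show "(\<integral>\<^sup>+ b. \<integral>\<^sup>+ d. ?f ((a, c), (b, d)) \<partial>D \<partial>B) = (\<integral>\<^sup>+ bd. ?f ((a, c), bd) \<partial>(B \<Otimes>\<^sub>M D))"
      by (rule D.nn_integral_fst) measurable
  qed
  also have "\<dots> = (\<integral>\<^sup>+ ac. \<integral>\<^sup>+ bd. ?f (ac, bd) \<partial>(B \<Otimes>\<^sub>M D) \<partial>(A \<Otimes>\<^sub>M C))"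
    by (rule C.nn_integral_fst) measurable
  also have "\<dots> = (\<integral>\<^sup>+ z. ?f z \<partial>((A \<Otimes>\<^sub>M C) \<Otimes>\<^sub>M (B \<Otimes>\<^sub>M D)))"
    by (rule BD.nn_integral_fst) measurable
  also have "\<dots> = emeasure ((A \<Otimes>\<^sub>M C) \<Otimes>\<^sub>M (B \<Otimes>\<^sub>M D)) X" by simp
  finally show "emeasure (distr ((A \<Otimes>\<^sub>M B) \<Otimes>\<^sub>M (C \<Otimes>\<^sub>M D)) ((A \<Otimes>\<^sub>M C) \<Otimes>\<^sub>M (B \<Otimes>\<^sub>M D)) ?re) X
    = emeasure ((A \<Otimes>\<^sub>M C) \<Otimes>\<^sub>M (B \<Otimes>\<^sub>M D)) X" .
qed simp

lemma sigma_finite_unit_interval: "sigma_finite_measure unit_interval"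
  using finite_measure_unit_interval by (simp add: finite_measure_def)

lemma sigma_finite_sphere_measure: "sigma_finite_measure sphere_measure"
  using finite_measure_sphere by (simp add: finite_measure_def)

lemmas sigma_finite_intros = sigma_finite_pair_measure sigma_finite_half_line sigma_finite_unit_interval
  sigma_finite_sphere_measure sigma_finite_lborel

lemma sigma_finite_state_measure: "sigma_finite_measure state_measure"
  unfolding state_measure_def by (intro sigma_finite_intros)

lemma sigma_finite_collision_measure: "sigma_finite_measure collision_measure"
  unfolding collision_measure_def by (intro sigma_finite_intros)

lemma sigma_finite_parameter_measure: "sigma_finite_measure parameter_measure"
  unfolding parameter_measure_def by (intro sigma_finite_intros)

lemma has_bochner_integral_state_collision:
  fixes f :: "(vec3 \<times> vec3) \<times> (real \<times> real \<times> real \<times> real \<times> vec3) \<Rightarrow> real"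
  assumes "has_bochner_integral ((lborel \<Otimes>\<^sub>M lborel) \<Otimes>\<^sub>M parameter_measure) f r"
  shows "has_bochner_integral (state_measure \<Otimes>\<^sub>M collision_measure)
    (\<lambda>((v, I), (w, J, R, r, \<sigma>)). f ((v, w), (I, J, R, r, \<sigma>))) r"
proof -
  let ?D = "half_line \<Otimes>\<^sub>M unit_interval \<Otimes>\<^sub>M unit_interval \<Otimes>\<^sub>M sphere_measure"
  have eq: "distr (state_measure \<Otimes>\<^sub>M collision_measure) ((lborel \<Otimes>\<^sub>M lborel) \<Otimes>\<^sub>M parameter_measure)
      (\<lambda>z. ((fst (fst z), fst (snd z)), (snd (fst z), snd (snd z)))) = (lborel \<Otimes>\<^sub>M lborel) \<Otimes>\<^sub>M parameter_measure"
    unfolding state_measure_def collision_measure_def parameter_measure_def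
    by (rule distr_pair_interchange) (intro sigma_finite_intros)+
  have meas: "(\<lambda>z. ((fst (fst z), fst (snd z)), (snd (fst z), snd (snd z)))) \<in> measurable (state_measure \<Otimes>\<^sub>M collision_measure)
      ((lborel \<Otimes>\<^sub>M lborel) \<Otimes>\<^sub>M parameter_measure)"
    unfolding state_measure_def collision_measure_def parameter_measure_def by measurable
  have "integrable (distr (state_measure \<Otimes>\<^sub>M collision_measure) ((lborel \<Otimes>\<^sub>M lborel) \<Otimes>\<^sub>M parameter_measure)
      (\<lambda>z. ((fst (fst z), fst (snd z)), (snd (fst z), snd (snd z))))) f"
    and "integral\<^sup>L (distr (state_measure \<Otimes>\<^sub>M collision_measure) ((lborel \<Otimes>\<^sub>M lborel) \<Otimes>\<^sub>M parameter_measure)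
      (\<lambda>z. ((fst (fst z), fst (snd z)), (snd (fst z), snd (snd z))))) f = r"
    unfolding eq using assms by (auto simp: has_bochner_integral_iff)
  moreover have "f \<in> borel_measurable ((lborel \<Otimes>\<^sub>M lborel) \<Otimes>\<^sub>M parameter_measure)"
    using assms by (auto simp: has_bochner_integral_iff)
  ultimately show ?thesis
    using meas by (simp add: has_bochner_integral_iff integrable_distr_eq integral_distr case_prod_unfold)
qed

lemma distr_pair_snd:
  assumes M: "sigma_finite_measure M" and N: "sigma_finite_measure N"
    and f: "f \<in> measurable N N" and eq: "distr N N f = N"
  shows "distr (M \<Otimes>\<^sub>M N) (M \<Otimes>\<^sub>M N) (\<lambda>(x, y). (x, f y)) = M \<Otimes>\<^sub>M N"
  using pair_measure_distr[of "\<lambda>x. x" M M f N N] f N by (simp add: eq distr_id)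

lemma distr_parameter_measure_orthogonal:
  assumes \<rho>: "orthogonal_transformation \<rho>"
  shows "(\<lambda>(I, J, R, r, \<sigma>). (I, J, R, r, \<rho> \<sigma>)) \<in> measurable parameter_measure parameter_measure"
    and "distr parameter_measure parameter_measure (\<lambda>(I, J, R, r, \<sigma>). (I, J, R, r, \<rho> \<sigma>)) = parameter_measure"
proof -
  note [measurable] = borel_measurable_orthogonal[OF \<rho>]
  have 0: "\<rho> \<in> measurable sphere_measure sphere_measure" by measurable
  have 1: "(\<lambda>(r, \<sigma>). (r, \<rho> \<sigma>)) \<in> measurable (unit_interval \<Otimes>\<^sub>M sphere_measure) (unit_interval \<Otimes>\<^sub>M sphere_measure)"
    by measurable
  have 2: "(\<lambda>(R, r, \<sigma>). (R, r, \<rho> \<sigma>)) \<in> measurable (unit_interval \<Otimes>\<^sub>M unit_interval \<Otimes>\<^sub>M sphere_measure)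
      (unit_interval \<Otimes>\<^sub>M unit_interval \<Otimes>\<^sub>M sphere_measure)"
    by measurable
  have 3: "(\<lambda>(J, R, r, \<sigma>). (J, R, r, \<rho> \<sigma>)) \<in> measurable (half_line \<Otimes>\<^sub>M unit_interval \<Otimes>\<^sub>M unit_interval \<Otimes>\<^sub>M sphere_measure)
      (half_line \<Otimes>\<^sub>M unit_interval \<Otimes>\<^sub>M unit_interval \<Otimes>\<^sub>M sphere_measure)"
    by measurable
  show "(\<lambda>(I, J, R, r, \<sigma>). (I, J, R, r, \<rho> \<sigma>)) \<in> measurable parameter_measure parameter_measure"
    unfolding parameter_measure_def by measurable
  note d1 = distr_pair_snd[OF sigma_finite_unit_interval sigma_finite_sphere_measure 0
      distr_sphere_measure_orthogonal[OF \<rho>]]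
  note d2 = distr_pair_snd[OF sigma_finite_unit_interval _ 1 d1, OF sigma_finite_pair_measure[OF sigma_finite_unit_interval sigma_finite_sphere_measure]]
  have d2': "distr (unit_interval \<Otimes>\<^sub>M unit_interval \<Otimes>\<^sub>M sphere_measure) (unit_interval \<Otimes>\<^sub>M unit_interval \<Otimes>\<^sub>M sphere_measure)
      (\<lambda>(R, r, \<sigma>). (R, r, \<rho> \<sigma>)) = unit_interval \<Otimes>\<^sub>M unit_interval \<Otimes>\<^sub>M sphere_measure"
    using d2 by (simp add: case_prod_unfold)
  have d3: "distr (half_line \<Otimes>\<^sub>M unit_interval \<Otimes>\<^sub>M unit_interval \<Otimes>\<^sub>M sphere_measure)
      (half_line \<Otimes>\<^sub>M unit_interval \<Otimes>\<^sub>M unit_interval \<Otimes>\<^sub>M sphere_measure)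
      (\<lambda>(J, R, r, \<sigma>). (J, R, r, \<rho> \<sigma>)) = half_line \<Otimes>\<^sub>M unit_interval \<Otimes>\<^sub>M unit_interval \<Otimes>\<^sub>M sphere_measure"
    using distr_pair_snd[OF sigma_finite_half_line _ 2 d2'] 
    by (simp add: case_prod_unfold sigma_finite_intros)
  show "distr parameter_measure parameter_measure (\<lambda>(I, J, R, r, \<sigma>). (I, J, R, r, \<rho> \<sigma>)) = parameter_measure"
    using distr_pair_snd[OF sigma_finite_half_line _ 3 d3]
    by (simp add: parameter_measure_def case_prod_unfold sigma_finite_intros)
qed

text \<open>A rotation that takes \<open>y'\<close> to \<open>y\<close> acts on \<sigma> alone and
  preserves both the angle and the sphere measure. The version with absolute values supplies the
  integrability test of Fubini's theorem for a kernel of unspecified sign.\<close>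

lemma rate_integrand_rotate:
  assumes y: "norm y = 1" and y': "norm y' = 1"
    and int: "integrable parameter_measure (rate_integrand kB \<Phi> b y \<tau>)"
  shows "integrable parameter_measure (rate_integrand kB \<Phi> b y' \<tau>)"
    and "integral\<^sup>L parameter_measure (rate_integrand kB \<Phi> b y' \<tau>)
      = integral\<^sup>L parameter_measure (rate_integrand kB \<Phi> b y \<tau>)"
    and "(\<integral>p. \<bar>rate_integrand kB \<Phi> b y' \<tau> p\<bar> \<partial>parameter_measure)
      = (\<integral>p. \<bar>rate_integrand kB \<Phi> b y \<tau> p\<bar> \<partial>parameter_measure)"
proof -
  obtain \<rho> :: "vec3 \<Rightarrow> vec3" where \<rho>: "orthogonal_transformation \<rho>" "\<rho> y' = y"
    using orthogonal_transformation_exists[of y' y] y y' by auto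
  let ?\<rho> = "\<lambda>(I, J, R, r, \<sigma>). (I, J, R, r, \<rho> \<sigma>) :: real \<times> real \<times> real \<times> real \<times> vec3"
  note \<rho>_meas = distr_parameter_measure_orthogonal[OF \<rho>(1)]
  have eq: "rate_integrand kB \<Phi> b y \<tau> (?\<rho> p) = rate_integrand kB \<Phi> b y' \<tau> p" for p
    using cos_theta_orthogonal[OF \<rho>(1), of y'] \<rho>(2) by (simp add: rate_integrand_def case_prod_unfold)
  have meas: "rate_integrand kB \<Phi> b y \<tau> \<in> borel_measurable parameter_measure"
    using int by auto
  show "integrable parameter_measure (rate_integrand kB \<Phi> b y' \<tau>)"
    using integrable_distr_eq[OF \<rho>_meas(1) meas] int by (simp add: \<rho>_meas(2) eq)
  show "integral\<^sup>L parameter_measure (rate_integrand kB \<Phi> b y' \<tau>)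
      = integral\<^sup>L parameter_measure (rate_integrand kB \<Phi> b y \<tau>)"
    using integral_distr[OF \<rho>_meas(1) meas] by (simp add: \<rho>_meas(2) eq)
  show "(\<integral>p. \<bar>rate_integrand kB \<Phi> b y' \<tau> p\<bar> \<partial>parameter_measure)
      = (\<integral>p. \<bar>rate_integrand kB \<Phi> b y \<tau> p\<bar> \<partial>parameter_measure)"
    using integral_distr[OF \<rho>_meas(1) borel_measurable_abs[OF meas]] by (simp add: \<rho>_meas(2) eq)
qed

section \<open>Relative and mean velocity of two Gaussians\<close>

lemma nn_integral_lborel_translate:
  fixes F :: "'a :: euclidean_space \<Rightarrow> ennreal"
  assumes "F \<in> borel_measurable borel"
  shows "(\<integral>\<^sup>+ w. F (w + c) \<partial>lborel) = (\<integral>\<^sup>+ w. F w \<partial>lborel)"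
proof -
  have "(\<integral>\<^sup>+ w. F w \<partial>distr lborel borel ((+) c)) = (\<integral>\<^sup>+ w. F (c + w) \<partial>lborel)"
    using assms by (intro nn_integral_distr) auto
  then show ?thesis by (simp add: lborel_distr_plus add.commute)
qed

text \<open>Completing the square in \<open>w\<close> at fixed relative velocity \<open>g\<close>.
  The relative velocity receives the parameter \<open>a * b / (a + b)\<close>, which for two
  Maxwellians of equal temperature is where the reduced mass comes from.\<close>

lemma gaussian_mult_gaussian:
  assumes "0 < a" "0 < b"
  shows "gaussian a (g + w) * gaussian b w
    = gaussian (a * b / (a + b)) g * gaussian (a + b) (w + (a / (a + b)) *\<^sub>R g)"
proof -
  have ab: "a + b \<noteq> 0" "a + b > 0" using assms by auto
  have "(a + b) * (a * (norm (g + w))\<^sup>2 + b * (norm w)\<^sup>2)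
      = a * b * (norm g)\<^sup>2 + (norm ((a + b) *\<^sub>R w + a *\<^sub>R g))\<^sup>2"
    unfolding power2_norm_eq_inner inner_add_left inner_add_right inner_scaleR_left inner_scaleR_right inner_commute[of g w]
    by algebra
  moreover have "(a + b) *\<^sub>R w + a *\<^sub>R g = (a + b) *\<^sub>R (w + (a / (a + b)) *\<^sub>R g)"
    using ab by (simp add: scaleR_add_right)
  then have "(norm ((a + b) *\<^sub>R w + a *\<^sub>R g))\<^sup>2 = (a + b)\<^sup>2 * (norm (w + (a / (a + b)) *\<^sub>R g))\<^sup>2"
    by (simp add: power_mult_distrib)
  ultimately have "- a * (norm (g + w))\<^sup>2 + - b * (norm w)\<^sup>2
      = - (a * b / (a + b)) * (norm g)\<^sup>2 + - (a + b) * (norm (w + (a / (a + b)) *\<^sub>R g))\<^sup>2"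
    using ab by (simp add: divide_simps power2_eq_square[of "a + b"]) algebra
  then have "exp (- a * (norm (g + w))\<^sup>2) * exp (- b * (norm w)\<^sup>2)
      = exp (- (a * b / (a + b)) * (norm g)\<^sup>2) * exp (- (a + b) * (norm (w + (a / (a + b)) *\<^sub>R g))\<^sup>2)"
    by (simp only: exp_add[symmetric])
  moreover have "(a / pi) powr (3 / 2) * (b / pi) powr (3 / 2) = (a * b / (a + b) / pi) powr (3 / 2) * ((a + b) / pi) powr (3 / 2)"
    using assms ab by (simp add: powr_mult[symmetric] power2_eq_square)
  moreover have "x * e * (y * f) = x' * e' * (y' * f')" if "e * f = e' * f'" "x * y = x' * y'"
    for x y e f x' y' e' f' :: real
    using that by algebra
  ultimately show ?thesis
    unfolding gaussian_def by blast
qed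

text \<open>After the shift \<open>v = g + w\<close> the integral over \<open>w\<close> is 1 for
  every \<open>g\<close>, and a single Gaussian moment in \<open>g\<close> remains.\<close>

lemma has_bochner_integral_two_gaussians:
  assumes a: "0 < a" and b: "0 < b" and p: "0 \<le> p"
  shows "has_bochner_integral (lborel \<Otimes>\<^sub>M lborel) (\<lambda>(v, w). gaussian a v * gaussian b w * norm (v - w) powr p)
    (2 / sqrt pi * (a * b / (a + b)) powr (- p / 2) * Gamma ((p + 3) / 2))"
proof (rule has_bochner_integral_nn_integral)
  let ?c = "a * b / (a + b)"
  have c: "0 < ?c" using a b by simp
  show "(\<lambda>(v, w). gaussian a v * gaussian b w * norm (v - w) powr p) \<in> borel_measurable (lborel \<Otimes>\<^sub>M lborel)"
    by measurable
  show "AE z in lborel \<Otimes>\<^sub>M lborel. 0 \<le> (case z of (v, w) \<Rightarrow> gaussian a v * gaussian b w * norm (v - w) powr p)"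
    by (auto simp: case_prod_unfold)
  show "0 \<le> 2 / sqrt pi * ?c powr (- p / 2) * Gamma ((p + 3) / 2)"
    using p by (auto intro!: mult_nonneg_nonneg Gamma_real_nonneg)
  have one: "(\<integral>\<^sup>+ w. ennreal (gaussian (a + b) w) \<partial>lborel) = 1"
    using has_bochner_integral_gaussian[of "a + b"] a b
    by (subst nn_integral_eq_integral) (auto simp: has_bochner_integral_iff)
  have "(\<integral>\<^sup>+ z. ennreal (case z of (v, w) \<Rightarrow> gaussian a v * gaussian b w * norm (v - w) powr p) \<partial>(lborel \<Otimes>\<^sub>M lborel))
      = (\<integral>\<^sup>+ w. \<integral>\<^sup>+ v. ennreal (gaussian a v * gaussian b w * norm (v - w) powr p) \<partial>lborel \<partial>lborel)"
    by (subst lborel_pair.nn_integral_snd[symmetric]) auto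
  also have "\<dots> = (\<integral>\<^sup>+ w. \<integral>\<^sup>+ g. ennreal (gaussian a (g + w) * gaussian b w * norm g powr p) \<partial>lborel \<partial>lborel)"
  proof (rule nn_integral_cong)
    fix w :: vec3
    have "(\<lambda>v. ennreal (gaussian a v * gaussian b w * norm (v - w) powr p)) \<in> borel_measurable borel"
      by measurable
    from nn_integral_lborel_translate[OF this, of w]
    show "(\<integral>\<^sup>+ v. ennreal (gaussian a v * gaussian b w * norm (v - w) powr p) \<partial>lborel)
        = (\<integral>\<^sup>+ g. ennreal (gaussian a (g + w) * gaussian b w * norm g powr p) \<partial>lborel)"
      by simp
  qed
  also have "\<dots> = (\<integral>\<^sup>+ g. \<integral>\<^sup>+ w. ennreal (gaussian a (g + w) * gaussian b w * norm g powr p) \<partial>lborel \<partial>lborel)"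
    by (rule lborel_pair.Fubini') measurable
  also have "\<dots> = (\<integral>\<^sup>+ g. ennreal (gaussian ?c g * norm g powr p) \<partial>lborel)"
  proof (rule nn_integral_cong)
    fix g :: vec3
    have "(\<integral>\<^sup>+ w. ennreal (gaussian a (g + w) * gaussian b w * norm g powr p) \<partial>lborel)
        = (\<integral>\<^sup>+ w. ennreal (gaussian ?c g * norm g powr p) * ennreal (gaussian (a + b) (w + (a / (a + b)) *\<^sub>R g)) \<partial>lborel)"
      unfolding gaussian_mult_gaussian[OF a b]
      by (intro nn_integral_cong) (simp add: ennreal_mult[symmetric] mult_ac)
    also have "\<dots> = ennreal (gaussian ?c g * norm g powr p) * (\<integral>\<^sup>+ w. ennreal (gaussian (a + b) (w + (a / (a + b)) *\<^sub>R g)) \<partial>lborel)"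
      by (rule nn_integral_cmult) measurable
    also have "(\<integral>\<^sup>+ w. ennreal (gaussian (a + b) (w + (a / (a + b)) *\<^sub>R g)) \<partial>lborel) = 1"
      by (subst nn_integral_lborel_translate) (auto simp: one)
    finally show "(\<integral>\<^sup>+ w. ennreal (gaussian a (g + w) * gaussian b w * norm g powr p) \<partial>lborel)
        = ennreal (gaussian ?c g * norm g powr p)" by simp
  qed
  also have "\<dots> = ennreal (2 / sqrt pi * ?c powr (- p / 2) * Gamma ((p + 3) / 2))"
    using has_bochner_integral_gaussian_powr[OF c p]
    by (subst nn_integral_eq_integral) (auto simp: has_bochner_integral_iff)
  finally show "(\<integral>\<^sup>+ z. ennreal (case z of (v, w) \<Rightarrow> gaussian a v * gaussian b w * norm (v - w) powr p) \<partial>(lborel \<Otimes>\<^sub>M lborel))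
      = ennreal (2 / sqrt pi * ?c powr (- p / 2) * Gamma ((p + 3) / 2))" .
qed

section \<open>The backward reaction\<close>

text \<open>The kernel of the species 3 operator without the denominator \<open>\<phi> 3 I\<close>,
  which the weight of the moment cancels.\<close>

definition kernel_weight ::
    "(nat \<Rightarrow> real) \<Rightarrow> real \<Rightarrow> (real \<Rightarrow> real \<Rightarrow> real \<Rightarrow> real \<Rightarrow> real) \<Rightarrow> (real \<Rightarrow> real)
     \<Rightarrow> vec3 \<Rightarrow> real \<Rightarrow> vec3 \<Rightarrow> real \<Rightarrow> real \<Rightarrow> real \<Rightarrow> vec3 \<Rightarrow> real" where
  "kernel_weight m \<gamma> \<Phi> b v I w J R r \<sigma> = kernel \<gamma> \<Phi> b v I w J R r \<sigma>
     * (2 * cos_theta (sgn (v - w)) \<sigma> * (1 - R) / ((m 3 * m 4)\<^sup>2 * norm (v - w)))"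

lemma exp_mult_kernel_weight:
  "exp (- (I + J) / (kB * \<tau>)) * kernel_weight m \<gamma> \<Phi> b v I w J R r \<sigma>
    = 2 / (m 3 * m 4)\<^sup>2 * (norm (v - w) powr (\<gamma> - 1) * rate_integrand kB \<Phi> b (sgn (v - w)) \<tau> (I, J, R, r, \<sigma>))"
proof -
  \<comment> \<open>For \<open>v = w\<close> both sides are 0, by the conventions for division by
    zero and for \<open>0 powr x\<close>, even if \<gamma> is 1.\<close>
  have eq: "norm (v - w) powr \<gamma> / norm (v - w) = norm (v - w) powr (\<gamma> - 1)"
    by (cases "v = w") (simp_all add: powr_diff)
  show ?thesis
    unfolding kernel_weight_def kernel_def rate_integrand_def prod.case eq[symmetric]
    by (simp only: times_divide_eq_right times_divide_eq_left divide_divide_eq_left mult_ac)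
qed

text \<open>The value is \<open>((v1, I1), (v2, I2))\<close>: the post-collisional states of species 1 and 2.\<close>

definition backward_state ::
    "(nat \<Rightarrow> real) \<Rightarrow> real \<Rightarrow> (vec3 \<times> real) \<times> (vec3 \<times> real \<times> real \<times> real \<times> vec3)
     \<Rightarrow> (vec3 \<times> real) \<times> (vec3 \<times> real)" where
  "backward_state m E = (\<lambda>((v, I), (w, J, R, r, \<sigma>)).
     let G = mass_center m 3 4 v w;
         \<E> = collision_energy m 3 4 v I w J + E / 2;
         \<mu> = reduced_mass m 1 2
     in ((G + (m 2 / (m 1 + m 2) * sqrt (2 / \<mu>) * sqrt (R * \<E> + E / 6)) *\<^sub>R \<sigma>, r * (1 - R) * \<E> + E / 6),
         (G - (m 1 / (m 1 + m 2) * sqrt (2 / \<mu>) * sqrt (R * \<E> + E / 6)) *\<^sub>R \<sigma>, (1 - r) * (1 - R) * \<E> + E / 6)))"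

definition backward_integrand ::
    "(nat \<Rightarrow> real) \<Rightarrow> real \<Rightarrow> real \<Rightarrow> (real \<Rightarrow> real \<Rightarrow> real \<Rightarrow> real \<Rightarrow> real) \<Rightarrow> (real \<Rightarrow> real)
     \<Rightarrow> (nat \<Rightarrow> vec3 \<Rightarrow> real \<Rightarrow> real) \<Rightarrow> (vec3 \<times> real) \<times> (vec3 \<times> real \<times> real \<times> real \<times> vec3) \<Rightarrow> real" where
  "backward_integrand m E \<gamma> \<Phi> b f = (\<lambda>z. case backward_state m E z of ((v1, I1), (v2, I2)) \<Rightarrow>
     case z of ((v, I), (w, J, R, r, \<sigma>)) \<Rightarrow>
       ((m 3 * m 4 / (m 1 * m 2)) ^ 3 * (f 1 v1 I1 * f 2 v2 I2) - f 3 v I * f 4 w J)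
       * kernel_weight m \<gamma> \<Phi> b v I w J R r \<sigma>)"

lemma react_integrand_backward:
  "react_integrand m E \<phi> \<gamma> \<Phi> b f 3 v I p = backward_integrand m E \<gamma> \<Phi> b f ((v, I), p) / \<phi> 3 I"
  by (cases p) (simp add: react_integrand_def backward_integrand_def backward_state_def kernel_weight_def
      reaction_partners_def reaction_sign_def threshold_def Let_def mult.commute[of "m 2" "m 1"])

abbreviation two_particle_measure where
  "two_particle_measure \<equiv> state_measure \<Otimes>\<^sub>M collision_measure"

section \<open>Measurability on the two-particle space\<close>

lemma borel_measurable_coordinates [measurable]:
  "(\<lambda>z. fst (fst z)) \<in> borel_measurable two_particle_measure"
  "(\<lambda>z. snd (fst z)) \<in> measurable two_particle_measure half_line"
  "(\<lambda>z. fst (snd z)) \<in> borel_measurable two_particle_measure"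
  "(\<lambda>z. fst (snd (snd z))) \<in> measurable two_particle_measure half_line"
  "(\<lambda>z. fst (snd (snd (snd z)))) \<in> measurable two_particle_measure unit_interval"
  "(\<lambda>z. fst (snd (snd (snd (snd z))))) \<in> measurable two_particle_measure unit_interval"
  "(\<lambda>z. snd (snd (snd (snd (snd z))))) \<in> borel_measurable two_particle_measure"
  unfolding state_measure_def collision_measure_def by measurable

lemma borel_measurable_real_coordinates [measurable]:
  "(\<lambda>z. snd (fst z)) \<in> borel_measurable two_particle_measure"
  "(\<lambda>z. fst (snd (snd z))) \<in> borel_measurable two_particle_measure"
  "(\<lambda>z. fst (snd (snd (snd z)))) \<in> borel_measurable two_particle_measure"
  "(\<lambda>z. fst (snd (snd (snd (snd z))))) \<in> borel_measurable two_particle_measure"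
  using measurable_compose[OF borel_measurable_coordinates(2) borel_measurable_half_line_ident]
    measurable_compose[OF borel_measurable_coordinates(4) borel_measurable_half_line_ident]
    measurable_compose[OF borel_measurable_coordinates(5) borel_measurable_unit_interval_ident]
    measurable_compose[OF borel_measurable_coordinates(6) borel_measurable_unit_interval_ident]
  by simp_all

lemma borel_measurable_backward_state [measurable]:
  "(\<lambda>z. fst (fst (backward_state m E z))) \<in> borel_measurable two_particle_measure"
  "(\<lambda>z. snd (fst (backward_state m E z))) \<in> borel_measurable two_particle_measure"
  "(\<lambda>z. fst (snd (backward_state m E z))) \<in> borel_measurable two_particle_measure"
  "(\<lambda>z. snd (snd (backward_state m E z))) \<in> borel_measurable two_particle_measure"
  unfolding backward_state_def Let_def case_prod_unfold fst_conv snd_conv mass_center_def collision_energy_def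
  by measurable

text \<open>The target is \<open>unit_interval\<close> because the angular kernel is assumed
  measurable only there.\<close>

lemma borel_measurable_cos_theta:
  "(\<lambda>z. cos_theta (sgn (fst (fst z) - fst (snd z))) (snd (snd (snd (snd (snd z))))))
    \<in> measurable two_particle_measure unit_interval"
proof -
  have "(\<lambda>z. cos_theta (sgn (fst (fst z) - fst (snd z))) (snd (snd (snd (snd (snd z))))))
      \<in> borel_measurable two_particle_measure"
    unfolding cos_theta_def by measurable
  then show ?thesis
    unfolding unit_interval_def using cos_theta_sgn_bounds
    by (intro measurable_restrict_space2) auto
qed

lemma borel_measurable_maxwellian:
  assumes [measurable]: "V \<in> borel_measurable M" "J \<in> borel_measurable M"
  shows "(\<lambda>z. maxwellian kB m \<phi> n \<tau> u (V z) (J z)) \<in> borel_measurable M"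
  unfolding maxwellian_def by measurable

text \<open>Before and after the reaction, kinetic energy splits into a mean and a relative part,
  and the mean velocity is unchanged since the total masses agree. The shares \<open>R\<close>,
  \<open>r * (1 - R)\<close> and \<open>(1 - r) * (1 - R)\<close> add up to 1; the three shifts
  \<open>E / 6\<close> and the shift \<open>E / 2\<close> of the collision energy add up to
  \<open>E\<close>.\<close>

lemma backward_state_energy:
  assumes m: "0 < m 1" "0 < m 2" "0 < m 3" "0 < m 4" and mass: "m 1 + m 2 = m 3 + m 4"
    and E: "0 \<le> E" and nonneg: "0 \<le> I" "0 \<le> J" "0 \<le> R" and \<sigma>: "norm \<sigma> = 1"
    and state: "backward_state m E ((v, I), (w, J, R, r, \<sigma>)) = ((v1, I1), (v2, I2))"
  shows "m 1 * (norm v1)\<^sup>2 / 2 + I1 + (m 2 * (norm v2)\<^sup>2 / 2 + I2)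
    = m 3 * (norm v)\<^sup>2 / 2 + I + (m 4 * (norm w)\<^sup>2 / 2 + J) + E"
proof -
  define M where "M = m 1 + m 2"
  have M: "0 < M" "m 1 + m 2 = M" "m 3 + m 4 = M" using m mass by (auto simp: M_def)
  define G where "G = mass_center m 3 4 v w"
  define \<E> where "\<E> = collision_energy m 3 4 v I w J + E / 2"
  define S where "S = R * \<E> + E / 6"
  define c where "c = sqrt (2 / reduced_mass m 1 2) * sqrt S"
  have \<E>0: "0 \<le> \<E>"
    using m E nonneg by (simp add: \<E>_def collision_energy_def reduced_mass_def)
  then have S0: "0 \<le> S" using E nonneg by (simp add: S_def)
  have st: "v1 = G + (m 2 / M * c) *\<^sub>R \<sigma>" "I1 = r * (1 - R) * \<E> + E / 6"
    "v2 = G - (m 1 / M * c) *\<^sub>R \<sigma>" "I2 = (1 - r) * (1 - R) * \<E> + E / 6"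
    using state by (auto simp: backward_state_def Let_def G_def \<E>_def c_def S_def M_def)
  have c: "m 1 * m 2 * c\<^sup>2 = 2 * M * S"
    using m M S0 by (simp add: c_def power_mult_distrib reduced_mass_def field_simps)
  have \<sigma>\<sigma>: "\<sigma> \<bullet> \<sigma> = 1" using \<sigma> by (simp add: dot_square_norm)
  have "m 1 * (norm v1)\<^sup>2 + m 2 * (norm v2)\<^sup>2 = M * (norm G)\<^sup>2 + 2 * S"
  proof -
    define x where "x = c / M"
    have *: "v1 = G + (m 2 * x) *\<^sub>R \<sigma>" "v2 = G - (m 1 * x) *\<^sub>R \<sigma>"
      by (simp_all add: st x_def)
    have "m 1 * (norm v1)\<^sup>2 + m 2 * (norm v2)\<^sup>2 = (m 1 + m 2) * (G \<bullet> G) + m 1 * m 2 * (m 1 + m 2) * x\<^sup>2 * (\<sigma> \<bullet> \<sigma>)"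
      unfolding * power2_norm_eq_inner inner_add_left inner_add_right inner_diff_left inner_diff_right
        inner_scaleR_left inner_scaleR_right inner_commute[of \<sigma> G] by algebra
    also have "\<dots> = M * (norm G)\<^sup>2 + (m 1 * m 2 * c\<^sup>2) / M"
      unfolding \<sigma>\<sigma> M(2) x_def power2_norm_eq_inner using M(1) by (simp add: power2_eq_square)
    also have "\<dots> = M * (norm G)\<^sup>2 + 2 * S"
      unfolding c using M(1) by simp
    finally show ?thesis .
  qed
  moreover have "M * (norm G)\<^sup>2 + reduced_mass m 3 4 * (norm (v - w))\<^sup>2 = m 3 * (norm v)\<^sup>2 + m 4 * (norm w)\<^sup>2"
  proof -
    have "M *\<^sub>R G = m 3 *\<^sub>R v + m 4 *\<^sub>R w"
      using M by (simp add: G_def mass_center_def scaleR_add_right)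
    moreover have "M * (M * (norm G)\<^sup>2) = (norm (M *\<^sub>R G))\<^sup>2"
      by (simp add: power_mult_distrib power2_eq_square)
    ultimately have "M * (M * (norm G)\<^sup>2) = (norm (m 3 *\<^sub>R v + m 4 *\<^sub>R w))\<^sup>2"
      by (simp only:)
    also have "\<dots> + m 3 * m 4 * (norm (v - w))\<^sup>2 = (m 3 + m 4) * (m 3 * (norm v)\<^sup>2 + m 4 * (norm w)\<^sup>2)"
      unfolding power2_norm_eq_inner inner_add_left inner_add_right inner_diff_left inner_diff_right
        inner_scaleR_left inner_scaleR_right inner_commute[of w v] by algebra
    finally have "M * (M * (norm G)\<^sup>2) + m 3 * m 4 * (norm (v - w))\<^sup>2 = M * (m 3 * (norm v)\<^sup>2 + m 4 * (norm w)\<^sup>2)"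
      by (simp add: M)
    moreover have "m 3 * m 4 = M * reduced_mass m 3 4"
      using M by (simp add: reduced_mass_def)
    ultimately have "M * (M * (norm G)\<^sup>2 + reduced_mass m 3 4 * (norm (v - w))\<^sup>2) = M * (m 3 * (norm v)\<^sup>2 + m 4 * (norm w)\<^sup>2)"
      by (simp add: distrib_left)
    then show ?thesis using M(1) by simp
  qed
  moreover have "S + I1 + I2 = reduced_mass m 3 4 * (norm (v - w))\<^sup>2 / 2 + I + J + E"
  proof -
    have "R * \<E> + r * (1 - R) * \<E> + (1 - r) * (1 - R) * \<E> = \<E>" by (simp add: algebra_simps)
    then show ?thesis by (simp add: st S_def \<E>_def collision_energy_def)
  qed
  ultimately show ?thesis by simp
qed

text \<open>Convergence is asked for one reference direction \<open>y\<close>, the others following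
  by rotation, but for all temperatures, because the perturbation majorant lives at 2T. A
  nonnegative \<open>E\<close> keeps the radicands of the backward velocities nonnegative.\<close>

locale reaction_kernel =
  fixes kB E \<gamma> :: real and m :: "nat \<Rightarrow> real"
    and \<Phi> :: "real \<Rightarrow> real \<Rightarrow> real \<Rightarrow> real \<Rightarrow> real" and b :: "real \<Rightarrow> real" and y :: vec3
  assumes kB: "0 < kB" and mass_pos: "\<And>i. i \<in> {1..4} \<Longrightarrow> 0 < m i"
    and mass_cons: "m 1 + m 2 = m 3 + m 4" and E: "0 \<le> E" and gamma: "1 \<le> \<gamma>" and unit: "norm y = 1"
    and \<Phi>_meas: "(\<lambda>(I, J, R, r). \<Phi> I J R r) \<in> borel_measurable
          (half_line \<Otimes>\<^sub>M half_line \<Otimes>\<^sub>M unit_interval \<Otimes>\<^sub>M unit_interval)"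
    and b_meas: "b \<in> borel_measurable unit_interval"
    and rate_conv: "\<And>\<tau>. 0 < \<tau> \<Longrightarrow> integrable parameter_measure (rate_integrand kB \<Phi> b y \<tau>)"
begin

lemma masses: "0 < m 1" "0 < m 2" "0 < m 3" "0 < m 4"
  by (auto intro: mass_pos)

lemma borel_measurable_kernel_weight [measurable]:
  "(\<lambda>z. kernel_weight m \<gamma> \<Phi> b (fst (fst z)) (snd (fst z)) (fst (snd z)) (fst (snd (snd z)))
      (fst (snd (snd (snd z)))) (fst (snd (snd (snd (snd z))))) (snd (snd (snd (snd (snd z))))))
    \<in> borel_measurable two_particle_measure"
proof -
  have [measurable]: "(\<lambda>z. b (cos_theta (sgn (fst (fst z) - fst (snd z))) (snd (snd (snd (snd (snd z)))))))
      \<in> borel_measurable two_particle_measure"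
    by (rule measurable_compose[OF borel_measurable_cos_theta b_meas])
  have "(\<lambda>z. (snd (fst z), fst (snd (snd z)), fst (snd (snd (snd z))), fst (snd (snd (snd (snd z))))))
      \<in> measurable two_particle_measure (half_line \<Otimes>\<^sub>M half_line \<Otimes>\<^sub>M unit_interval \<Otimes>\<^sub>M unit_interval)"
    by measurable
  from measurable_compose[OF this \<Phi>_meas]
  have [measurable]: "(\<lambda>z. \<Phi> (snd (fst z)) (fst (snd (snd z))) (fst (snd (snd (snd z)))) (fst (snd (snd (snd (snd z))))))
      \<in> borel_measurable two_particle_measure"
    by simp
  show ?thesis
    unfolding kernel_weight_def kernel_def cos_theta_def[of "sgn _"]
    unfolding cos_theta_def[symmetric] using borel_measurable_cos_theta[THEN measurable_compose, OF borel_measurable_unit_interval_ident]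
    by measurable
qed

text \<open>At fixed velocities the parameter integral is a constant times a power of the relative
  speed, so the two integrations separate. The factor 4 collects the 2 of the collision kernel and
  the 2 of the Gaussian moment.\<close>

lemma has_bochner_integral_gaussian_kernel:
  assumes \<tau>: "0 < \<tau>"
  shows "has_bochner_integral two_particle_measure
    (\<lambda>((v, I), (w, J, R, r, \<sigma>)). gaussian (m 3 / (2 * kB * \<tau>)) v * gaussian (m 4 / (2 * kB * \<tau>)) w
       * exp (- (I + J) / (kB * \<tau>)) * kernel_weight m \<gamma> \<Phi> b v I w J R r \<sigma>)
    (4 / (sqrt pi * (m 3 * m 4)\<^sup>2) * (2 * kB * \<tau> / reduced_mass m 3 4) powr ((\<gamma> - 1) / 2)
       * Gamma ((\<gamma> + 2) / 2) * integral\<^sup>L parameter_measure (rate_integrand kB \<Phi> b y \<tau>))"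
proof -
  define G where "G = (\<lambda>(v, w). gaussian (m 3 / (2 * kB * \<tau>)) v * gaussian (m 4 / (2 * kB * \<tau>)) w * norm (v - w) powr (\<gamma> - 1))"
  define A where "A = integral\<^sup>L parameter_measure (rate_integrand kB \<Phi> b y \<tau>)"
  define K where "K = 2 / sqrt pi * (2 * kB * \<tau> / reduced_mass m 3 4) powr ((\<gamma> - 1) / 2) * Gamma ((\<gamma> + 2) / 2)"
  have G: "has_bochner_integral (lborel \<Otimes>\<^sub>M lborel) G K"
  proof -
    have a: "0 < m 3 / (2 * kB * \<tau>)" "0 < m 4 / (2 * kB * \<tau>)" using masses kB \<tau> by auto
    define \<mu> where "\<mu> = reduced_mass m 3 4"
    have \<mu>: "0 < \<mu>" using masses by (simp add: \<mu>_def reduced_mass_def)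
    have "m 3 / (2 * kB * \<tau>) * (m 4 / (2 * kB * \<tau>)) / (m 3 / (2 * kB * \<tau>) + m 4 / (2 * kB * \<tau>)) = \<mu> / (2 * kB * \<tau>)"
    proof -
      have "m 3 / (2 * kB * \<tau>) + m 4 / (2 * kB * \<tau>) = (m 3 + m 4) / (2 * kB * \<tau>)" by (simp add: add_divide_distrib)
      moreover have "m 3 + m 4 \<noteq> 0" using masses by linarith
      ultimately show ?thesis using kB \<tau> by (simp add: \<mu>_def reduced_mass_def)
    qed
    moreover have "(\<mu> / (2 * kB * \<tau>)) powr (- (\<gamma> - 1) / 2) = (2 * kB * \<tau> / \<mu>) powr ((\<gamma> - 1) / 2)"
    proof -
      have "(\<mu> / (2 * kB * \<tau>)) powr (- ((\<gamma> - 1) / 2)) = inverse (\<mu> / (2 * kB * \<tau>)) powr ((\<gamma> - 1) / 2)"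
        using \<mu> kB \<tau> by (simp add: powr_minus inverse_powr del: inverse_divide)
      then show ?thesis by (simp only: inverse_divide minus_divide_left)
    qed
    moreover have "\<gamma> - 1 + 3 = \<gamma> + 2" by simp
    ultimately show ?thesis
      using has_bochner_integral_two_gaussians[OF a, of "\<gamma> - 1"] gamma
      by (simp only: G_def K_def \<mu>_def diff_ge_0_iff_ge)
  qed
  have "integrable parameter_measure (rate_integrand kB \<Phi> b y \<tau>)" by (rule rate_conv[OF \<tau>])
  note rot = rate_integrand_rotate[OF unit _ this]
  define g where "g = (\<lambda>((v, I), (w, J, R, r, \<sigma>)). gaussian (m 3 / (2 * kB * \<tau>)) v * gaussian (m 4 / (2 * kB * \<tau>)) w
       * exp (- (I + J) / (kB * \<tau>)) * kernel_weight m \<gamma> \<Phi> b v I w J R r \<sigma>)"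
  define F where "F = (\<lambda>((v, w), (I, J, R, r, \<sigma>)). g ((v, I), (w, J, R, r, \<sigma>)))"
  define C where "C = 2 / (m 3 * m 4)\<^sup>2"
  have F: "F ((v, w), p) = C * (G (v, w) * rate_integrand kB \<Phi> b (sgn (v - w)) \<tau> p)" for v w p
  proof (cases p)
    case (fields I J R r \<sigma>)
    then show ?thesis
      unfolding F_def g_def prod.case mult.assoc exp_mult_kernel_weight C_def G_def by (simp add: mult_ac)
  qed
  have [measurable]: "F \<in> borel_measurable ((lborel \<Otimes>\<^sub>M lborel) \<Otimes>\<^sub>M parameter_measure)"
  proof -
    have "g \<in> borel_measurable two_particle_measure"
      unfolding g_def case_prod_unfold by measurable
    moreover have "(\<lambda>z. ((fst (fst z), fst (snd z)), (snd (fst z), snd (snd z))))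
        \<in> measurable ((lborel \<Otimes>\<^sub>M lborel) \<Otimes>\<^sub>M parameter_measure) two_particle_measure"
      unfolding state_measure_def collision_measure_def parameter_measure_def by measurable
    ultimately have "(\<lambda>z. g ((fst (fst z), fst (snd z)), (snd (fst z), snd (snd z))))
        \<in> borel_measurable ((lborel \<Otimes>\<^sub>M lborel) \<Otimes>\<^sub>M parameter_measure)"
      by (rule measurable_compose[rotated])
    then show ?thesis by (simp add: F_def case_prod_unfold)
  qed
  interpret sigma_finite_measure parameter_measure by (rule sigma_finite_parameter_measure)
  interpret vw: sigma_finite_measure "lborel \<Otimes>\<^sub>M lborel :: (vec3 \<times> vec3) measure"
    by (intro sigma_finite_intros)
  interpret P: pair_sigma_finite "lborel \<Otimes>\<^sub>M lborel :: (vec3 \<times> vec3) measure" parameter_measure ..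
  \<comment> \<open>On the diagonal \<open>sgn (v - w)\<close> is not a unit vector and rotation
    says nothing; there \<open>0 powr x = 0\<close> makes the integrand vanish, also when \<gamma>
    is 1.\<close>
  have G0: "G (v, v) = 0" for v by (simp add: G_def)
  have Gnn: "0 \<le> G z" for z by (auto simp: G_def split: prod.split)
  have C0: "0 \<le> C" by (simp add: C_def)
  have "has_bochner_integral ((lborel \<Otimes>\<^sub>M lborel) \<Otimes>\<^sub>M parameter_measure) F (C * (K * A))"
  proof -
    define A' where "A' = (\<integral>p. \<bar>rate_integrand kB \<Phi> b y \<tau> p\<bar> \<partial>parameter_measure)"
    have inner: "(\<integral>p. F (z, p) \<partial>parameter_measure) = C * (G z * A)"
      and inner_abs: "(\<integral>p. norm (F (z, p)) \<partial>parameter_measure) = C * (G z * A')"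
      and inner_int: "integrable parameter_measure (\<lambda>p. F (z, p))" for z
    proof -
      obtain v w where z: "z = (v, w)" by (cases z)
      have "(\<integral>p. F (z, p) \<partial>parameter_measure) = C * (G z * A)
          \<and> (\<integral>p. norm (F (z, p)) \<partial>parameter_measure) = C * (G z * A')
          \<and> integrable parameter_measure (\<lambda>p. F (z, p))"
      proof (cases "v = w")
        case True
        then show ?thesis by (simp add: z F G0)
      next
        case False
        then have "norm (sgn (v - w)) = 1" by (simp add: norm_sgn)
        note rot' = rot[OF this]
        show ?thesis
          using rot' Gnn[of "(v, w)"] C0 by (simp add: z F abs_mult A_def A'_def)
      qed
      then show "(\<integral>p. F (z, p) \<partial>parameter_measure) = C * (G z * A)"
        "(\<integral>p. norm (F (z, p)) \<partial>parameter_measure) = C * (G z * A')"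
        "integrable parameter_measure (\<lambda>p. F (z, p))" by blast+
    qed
    have int: "integrable ((lborel \<Otimes>\<^sub>M lborel) \<Otimes>\<^sub>M parameter_measure) F"
    proof (rule P.Fubini_integrable)
      show "integrable (lborel \<Otimes>\<^sub>M lborel) (\<lambda>z. \<integral>p. norm (F (z, p)) \<partial>parameter_measure)"
        unfolding inner_abs using G by (auto simp: has_bochner_integral_iff)
      show "AE z in lborel \<Otimes>\<^sub>M lborel. integrable parameter_measure (\<lambda>p. F (z, p))"
        using inner_int by auto
    qed measurable
    moreover have "integral\<^sup>L ((lborel \<Otimes>\<^sub>M lborel) \<Otimes>\<^sub>M parameter_measure) F = C * (K * A)"
      using P.integral_fst'[OF int] G unfolding inner by (simp add: has_bochner_integral_iff)
    ultimately show ?thesis by (simp add: has_bochner_integral_iff)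
  qed
  from has_bochner_integral_state_collision[OF this]
  have "has_bochner_integral two_particle_measure g (C * (K * A))"
    by (simp add: F_def case_prod_unfold)
  then show ?thesis
    by (simp add: g_def C_def K_def A_def mult_ac)
qed

end

section \<open>Almost-everywhere properties of collision states\<close>

lemma AE_pair_snd:
  assumes M: "sigma_finite_measure M" and N: "sigma_finite_measure N"
    and P [measurable]: "Measurable.pred N P" and AE: "AE y in N. P y"
  shows "AE z in M \<Otimes>\<^sub>M N. P (snd z)"
proof -
  interpret M: sigma_finite_measure M by fact
  interpret N: sigma_finite_measure N by fact
  interpret pair_sigma_finite M N ..
  show ?thesis
    by (rule AE_pair_measure) (use AE in auto)
qed

text \<open>The variable \<sigma> ranges over the whole space, but energy conservation needs a unit
  vector; identities for the reaction bracket therefore hold almost everywhere.\<close>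

lemma AE_two_particle_measure_norm:
  "AE z in two_particle_measure. norm (snd (snd (snd (snd (snd z))))) = 1"
proof -
  have m0: "Measurable.pred sphere_measure (\<lambda>z. norm z = 1)" by measurable
  have m1: "Measurable.pred (unit_interval \<Otimes>\<^sub>M sphere_measure) (\<lambda>z. norm (snd z) = 1)" by measurable
  have m2: "Measurable.pred (unit_interval \<Otimes>\<^sub>M unit_interval \<Otimes>\<^sub>M sphere_measure) (\<lambda>z. norm (snd (snd z)) = 1)"
    by measurable
  have m3: "Measurable.pred (half_line \<Otimes>\<^sub>M unit_interval \<Otimes>\<^sub>M unit_interval \<Otimes>\<^sub>M sphere_measure)
      (\<lambda>z. norm (snd (snd (snd z))) = 1)"
    by measurable
  have s1: "sigma_finite_measure (unit_interval \<Otimes>\<^sub>M sphere_measure)"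
    and s2: "sigma_finite_measure (unit_interval \<Otimes>\<^sub>M unit_interval \<Otimes>\<^sub>M sphere_measure)"
    and s3: "sigma_finite_measure (half_line \<Otimes>\<^sub>M unit_interval \<Otimes>\<^sub>M unit_interval \<Otimes>\<^sub>M sphere_measure)"
    by (intro sigma_finite_intros)+
  note 1 = AE_pair_snd[OF sigma_finite_unit_interval sigma_finite_sphere_measure m0 AE_sphere_measure_norm]
  note 2 = AE_pair_snd[OF sigma_finite_unit_interval s1 m1 1]
  note 3 = AE_pair_snd[OF sigma_finite_half_line s2 m2 2]
  have 4: "AE z in collision_measure. norm (snd (snd (snd (snd z)))) = 1"
    unfolding collision_measure_def
    by (rule AE_pair_snd[OF sigma_finite_lborel s3 m3 3])
  have "Measurable.pred collision_measure (\<lambda>z. norm (snd (snd (snd (snd z)))) = 1)"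
    unfolding collision_measure_def by measurable
  from AE_pair_snd[OF sigma_finite_state_measure sigma_finite_collision_measure this 4]
  show ?thesis .
qed

lemma in_space_two_particle_measure:
  "((v, I), (w, J, R, r, \<sigma>)) \<in> space two_particle_measure \<longleftrightarrow> 0 \<le> I \<and> 0 \<le> J \<and> 0 \<le> R \<and> R \<le> 1 \<and> 0 \<le> r \<and> r \<le> 1"
  by (auto simp: state_measure_def collision_measure_def space_pair_measure)

text \<open>The Maxwellian form is known only for nonnegative internal energies, so those of the
  products must be checked before it is substituted.\<close>

lemma backward_state_nonneg:
  assumes m: "0 < m 3" "0 < m 4" and E: "0 \<le> E"
    and z: "((v, I), p) \<in> space two_particle_measure"
    and state: "backward_state m E ((v, I), p) = ((v1, I1), (v2, I2))"
  shows "0 \<le> I1" "0 \<le> I2"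
proof -
  obtain w J R r \<sigma> where p: "p = (w, J, R, r, \<sigma>)" by (cases p)
  define \<E> where "\<E> = collision_energy m 3 4 v I w J + E / 2"
  have nonneg: "0 \<le> I" "0 \<le> J" "0 \<le> R" "R \<le> 1" "0 \<le> r" "r \<le> 1"
    using z unfolding p in_space_two_particle_measure by auto
  then have "0 \<le> \<E>"
    using m E by (simp add: \<E>_def collision_energy_def reduced_mass_def)
  then show "0 \<le> I1" "0 \<le> I2"
    using state nonneg E unfolding p by (auto simp: backward_state_def Let_def \<E>_def)
qed

section \<open>Boltzmann factors and the backward integrand\<close>

context reaction_kernel
begin

lemma backward_integrand_cong:
  assumes z: "z \<in> space two_particle_measure"
    and eq: "\<And>k v I. k \<in> {1..4} \<Longrightarrow> 0 \<le> I \<Longrightarrow> f k v I = g k v I"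
  shows "backward_integrand m E \<gamma> \<Phi> b f z = backward_integrand m E \<gamma> \<Phi> b g z"
proof -
  obtain v I w J R r \<sigma> where zz: "z = ((v, I), (w, J, R, r, \<sigma>))" by (cases z) auto
  obtain v1 I1 v2 I2 where state: "backward_state m E z = ((v1, I1), (v2, I2))" by (metis prod.exhaust)
  have "0 \<le> I1" "0 \<le> I2"
    using backward_state_nonneg[OF masses(3,4) E] z state unfolding zz by blast+
  moreover have "0 \<le> I" "0 \<le> J" using z unfolding zz in_space_two_particle_measure by auto
  ultimately show ?thesis
    using state by (simp add: backward_integrand_def zz eq)
qed

text \<open>The Boltzmann factor of one particle, without normalization: products of such factors
  depend on the total energy only, so conservation acts on them directly. At temperature 2T it is
  the majorant.\<close>

definition energy_weight :: "real \<Rightarrow> nat \<Rightarrow> vec3 \<Rightarrow> real \<Rightarrow> real" where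
  "energy_weight \<tau> k v I = exp (- (m k * (norm v)\<^sup>2 / 2 + I) / (kB * \<tau>))"

lemma energy_weight_pos [simp]: "0 < energy_weight \<tau> k v I" "0 \<le> energy_weight \<tau> k v I"
  by (simp_all add: energy_weight_def)

lemma energy_weight_eq_gaussian:
  assumes \<tau>: "0 < \<tau>" and k: "k \<in> {1..4}"
  shows "gaussian (m k / (2 * kB * \<tau>)) v * exp (- I / (kB * \<tau>))
    = (m k / (2 * pi * kB * \<tau>)) powr (3 / 2) * energy_weight \<tau> k v I"
proof -
  have "- (m k * (norm v)\<^sup>2 / 2 + I) / (kB * \<tau>) = - (m k / (2 * kB * \<tau>)) * (norm v)\<^sup>2 + - I / (kB * \<tau>)"
    using kB \<tau> by (simp add: field_simps)
  then have "energy_weight \<tau> k v I = exp (- (m k / (2 * kB * \<tau>)) * (norm v)\<^sup>2) * exp (- I / (kB * \<tau>))"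
    unfolding energy_weight_def by (simp only: exp_add)
  moreover have "m k / (2 * pi * kB * \<tau>) = m k / (2 * kB * \<tau>) / pi" by simp
  ultimately show ?thesis
    unfolding gaussian_def by (simp only: mult.assoc)
qed

lemma maxwellian_rest_eq:
  assumes \<tau>: "0 < \<tau>"
  shows "maxwellian kB (m k) \<psi> n \<tau> 0 v I
    = n / partition_fun kB \<psi> \<tau> * (m k / (2 * pi * kB * \<tau>)) powr (3 / 2) * energy_weight \<tau> k v I"
proof -
  have "- (m k * (norm v)\<^sup>2 + 2 * I) / (2 * kB * \<tau>) = - (m k * (norm v)\<^sup>2 / 2 + I) / (kB * \<tau>)"
    using kB \<tau> by (simp add: field_simps)
  then show ?thesis by (simp add: maxwellian_def energy_weight_def)
qed

lemma energy_weight_kernel_integral: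
  assumes \<tau>: "0 < \<tau>"
  shows "has_bochner_integral two_particle_measure
    (\<lambda>((v, I), (w, J, R, r, \<sigma>)). (m 3 / (2 * pi * kB * \<tau>)) powr (3 / 2) * (m 4 / (2 * pi * kB * \<tau>)) powr (3 / 2)
       * (energy_weight \<tau> 3 v I * energy_weight \<tau> 4 w J * kernel_weight m \<gamma> \<Phi> b v I w J R r \<sigma>))
    (4 / (sqrt pi * (m 3 * m 4)\<^sup>2) * (2 * kB * \<tau> / reduced_mass m 3 4) powr ((\<gamma> - 1) / 2)
       * Gamma ((\<gamma> + 2) / 2) * integral\<^sup>L parameter_measure (rate_integrand kB \<Phi> b y \<tau>))"
proof -
  have "(m 3 / (2 * pi * kB * \<tau>)) powr (3 / 2) * (m 4 / (2 * pi * kB * \<tau>)) powr (3 / 2)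
       * (energy_weight \<tau> 3 v I * energy_weight \<tau> 4 w J * kernel_weight m \<gamma> \<Phi> b v I w J R r \<sigma>)
      = gaussian (m 3 / (2 * kB * \<tau>)) v * gaussian (m 4 / (2 * kB * \<tau>)) w
       * exp (- (I + J) / (kB * \<tau>)) * kernel_weight m \<gamma> \<Phi> b v I w J R r \<sigma>" for v I w J R r \<sigma>
  proof -
    have "exp (- (I + J) / (kB * \<tau>)) = exp (- I / (kB * \<tau>)) * exp (- J / (kB * \<tau>))"
      by (simp add: exp_add[symmetric] add_divide_distrib diff_divide_distrib)
    then have "gaussian (m 3 / (2 * kB * \<tau>)) v * gaussian (m 4 / (2 * kB * \<tau>)) w * exp (- (I + J) / (kB * \<tau>))
        = (gaussian (m 3 / (2 * kB * \<tau>)) v * exp (- I / (kB * \<tau>))) * (gaussian (m 4 / (2 * kB * \<tau>)) w * exp (- J / (kB * \<tau>)))"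
      by (simp only: mult_ac)
    also have "\<dots> = ((m 3 / (2 * pi * kB * \<tau>)) powr (3 / 2) * energy_weight \<tau> 3 v I)
        * ((m 4 / (2 * pi * kB * \<tau>)) powr (3 / 2) * energy_weight \<tau> 4 w J)"
    proof -
      have "gaussian (m 3 / (2 * kB * \<tau>)) v * exp (- I / (kB * \<tau>)) = (m 3 / (2 * pi * kB * \<tau>)) powr (3 / 2) * energy_weight \<tau> 3 v I"
        "gaussian (m 4 / (2 * kB * \<tau>)) w * exp (- J / (kB * \<tau>)) = (m 4 / (2 * pi * kB * \<tau>)) powr (3 / 2) * energy_weight \<tau> 4 w J"
        by (rule energy_weight_eq_gaussian[OF \<tau>]; simp)+
      then show ?thesis by (simp only:)
    qed
    finally show ?thesis by (simp only: mult_ac)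
  qed
  then show ?thesis
    using has_bochner_integral_gaussian_kernel[OF \<tau>] by (simp only:)
qed

lemma integrable_energy_weight_kernel:
  assumes \<tau>: "0 < \<tau>"
  shows "integrable two_particle_measure
    (\<lambda>((v, I), (w, J, R, r, \<sigma>)). energy_weight \<tau> 3 v I * energy_weight \<tau> 4 w J * kernel_weight m \<gamma> \<Phi> b v I w J R r \<sigma>)"
proof -
  let ?c = "(m 3 / (2 * pi * kB * \<tau>)) powr (3 / 2) * (m 4 / (2 * pi * kB * \<tau>)) powr (3 / 2)"
  have "?c \<noteq> 0" using masses kB \<tau> by simp
  moreover have "integrable two_particle_measure
    (\<lambda>((v, I), (w, J, R, r, \<sigma>)). ?c * (energy_weight \<tau> 3 v I * energy_weight \<tau> 4 w J * kernel_weight m \<gamma> \<Phi> b v I w J R r \<sigma>))"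
    using energy_weight_kernel_integral[OF \<tau>] unfolding has_bochner_integral_iff by (rule conjunct1)
  ultimately show ?thesis
    by (simp add: case_prod_unfold)
qed

lemma backward_energy_weight:
  assumes z: "((v, I), (w, J, R, r, \<sigma>)) \<in> space two_particle_measure" and \<sigma>: "norm \<sigma> = 1"
    and state: "backward_state m E ((v, I), (w, J, R, r, \<sigma>)) = ((v1, I1), (v2, I2))"
  shows "energy_weight \<tau> 1 v1 I1 * energy_weight \<tau> 2 v2 I2
    = energy_weight \<tau> 3 v I * energy_weight \<tau> 4 w J * exp (- E / (kB * \<tau>))"
proof -
  have "0 \<le> I" "0 \<le> J" "0 \<le> R" using z unfolding in_space_two_particle_measure by auto
  note energy = backward_state_energy[OF masses mass_cons E this \<sigma> state]
  have "- (m 1 * (norm v1)\<^sup>2 / 2 + I1) / (kB * \<tau>) + - (m 2 * (norm v2)\<^sup>2 / 2 + I2) / (kB * \<tau>)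
      = - (m 1 * (norm v1)\<^sup>2 / 2 + I1 + (m 2 * (norm v2)\<^sup>2 / 2 + I2)) / (kB * \<tau>)"
    by (simp add: add_divide_distrib diff_divide_distrib)
  also have "\<dots> = - (m 3 * (norm v)\<^sup>2 / 2 + I) / (kB * \<tau>) + - (m 4 * (norm w)\<^sup>2 / 2 + J) / (kB * \<tau>) + - E / (kB * \<tau>)"
    unfolding energy by (simp add: add_divide_distrib diff_divide_distrib)
  finally show ?thesis
    unfolding energy_weight_def by (simp only: exp_add[symmetric])
qed

text \<open>Changing one factor at a time, a product of two distribution functions moves by two
  terms of size \<open>C\<^sup>2 * \<epsilon>\<close>. The gain enters with the cubed mass ratio and
  the loss with 1, which gives the constant.\<close>

lemma backward_integrand_perturbation:
  assumes \<tau>: "0 < \<tau>" and C: "0 \<le> C" and \<epsilon>: "0 \<le> \<epsilon>"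
    and diff: "\<And>k v I. k \<in> {1..4} \<Longrightarrow> 0 \<le> I \<Longrightarrow> \<bar>f k v I - g k v I\<bar> \<le> C * \<epsilon> * energy_weight \<tau> k v I"
    and f: "\<And>k v I. k \<in> {1..4} \<Longrightarrow> 0 \<le> I \<Longrightarrow> \<bar>f k v I\<bar> \<le> C * energy_weight \<tau> k v I"
    and g: "\<And>k v I. k \<in> {1..4} \<Longrightarrow> 0 \<le> I \<Longrightarrow> \<bar>g k v I\<bar> \<le> C * energy_weight \<tau> k v I"
    and z: "((v, I), (w, J, R, r, \<sigma>)) \<in> space two_particle_measure" and \<sigma>: "norm \<sigma> = 1"
  shows "\<bar>backward_integrand m E \<gamma> \<Phi> b f ((v, I), (w, J, R, r, \<sigma>)) - backward_integrand m E \<gamma> \<Phi> b g ((v, I), (w, J, R, r, \<sigma>))\<bar>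
    \<le> ((m 3 * m 4 / (m 1 * m 2)) ^ 3 + 1) * (2 * C\<^sup>2) * \<epsilon>
      * \<bar>energy_weight \<tau> 3 v I * energy_weight \<tau> 4 w J * kernel_weight m \<gamma> \<Phi> b v I w J R r \<sigma>\<bar>"
proof -
  obtain v1 I1 v2 I2 where state: "backward_state m E ((v, I), (w, J, R, r, \<sigma>)) = ((v1, I1), (v2, I2))"
    by (metis prod.exhaust)
  have I12: "0 \<le> I1" "0 \<le> I2"
    using backward_state_nonneg[OF masses(3,4) E z state] by auto
  have IJ: "0 \<le> I" "0 \<le> J" using z unfolding in_space_two_particle_measure by auto
  have prod: "\<bar>f j a p * f k c q - g j a p * g k c q\<bar>
      \<le> 2 * C\<^sup>2 * \<epsilon> * (energy_weight \<tau> j a p * energy_weight \<tau> k c q)"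
    if "j \<in> {1..4}" "k \<in> {1..4}" "0 \<le> p" "0 \<le> q" for j k a c p q
  proof -
    have "f j a p * f k c q - g j a p * g k c q = (f j a p - g j a p) * f k c q + g j a p * (f k c q - g k c q)"
      by (simp add: algebra_simps)
    then have "\<bar>f j a p * f k c q - g j a p * g k c q\<bar> \<le> \<bar>f j a p - g j a p\<bar> * \<bar>f k c q\<bar> + \<bar>g j a p\<bar> * \<bar>f k c q - g k c q\<bar>"
      by (metis abs_mult abs_triangle_ineq)
    also have "\<dots> \<le> (C * \<epsilon> * energy_weight \<tau> j a p) * (C * energy_weight \<tau> k c q)
        + (C * energy_weight \<tau> j a p) * (C * \<epsilon> * energy_weight \<tau> k c q)"
      using that C \<epsilon> by (intro add_mono mult_mono diff f g) auto
    also have "\<dots> = 2 * C\<^sup>2 * \<epsilon> * (energy_weight \<tau> j a p * energy_weight \<tau> k c q)"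
      by (simp add: power2_eq_square)
    finally show ?thesis .
  qed
  define \<rho> where "\<rho> = (m 3 * m 4 / (m 1 * m 2)) ^ 3"
  have \<rho>: "0 \<le> \<rho>" using masses by (simp add: \<rho>_def)
  let ?W = "energy_weight \<tau> 3 v I * energy_weight \<tau> 4 w J"
  \<comment> \<open>The product states carry the additional energy \<open>E\<close>, which is
    nonnegative, so their Boltzmann factor is the smaller one and the majorant of the loss also
    covers the gain.\<close>
  have W: "energy_weight \<tau> 1 v1 I1 * energy_weight \<tau> 2 v2 I2 \<le> ?W"
    unfolding backward_energy_weight[OF z \<sigma> state]
    using E kB \<tau> by (intro mult_right_le_one_le) auto
  have gain: "\<bar>f 1 v1 I1 * f 2 v2 I2 - g 1 v1 I1 * g 2 v2 I2\<bar> \<le> 2 * C\<^sup>2 * \<epsilon> * ?W"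
  proof -
    have "\<bar>f 1 v1 I1 * f 2 v2 I2 - g 1 v1 I1 * g 2 v2 I2\<bar>
        \<le> 2 * C\<^sup>2 * \<epsilon> * (energy_weight \<tau> 1 v1 I1 * energy_weight \<tau> 2 v2 I2)"
      by (rule prod) (use I12 in auto)
    also have "\<dots> \<le> 2 * C\<^sup>2 * \<epsilon> * ?W"
      using W \<epsilon> by (intro mult_left_mono) auto
    finally show ?thesis .
  qed
  have loss: "\<bar>f 3 v I * f 4 w J - g 3 v I * g 4 w J\<bar> \<le> 2 * C\<^sup>2 * \<epsilon> * ?W"
    by (rule prod) (use IJ in auto)
  have "\<bar>backward_integrand m E \<gamma> \<Phi> b f ((v, I), (w, J, R, r, \<sigma>)) - backward_integrand m E \<gamma> \<Phi> b g ((v, I), (w, J, R, r, \<sigma>))\<bar>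
      = \<bar>(\<rho> * (f 1 v1 I1 * f 2 v2 I2 - g 1 v1 I1 * g 2 v2 I2) - (f 3 v I * f 4 w J - g 3 v I * g 4 w J))
        * kernel_weight m \<gamma> \<Phi> b v I w J R r \<sigma>\<bar>"
    unfolding backward_integrand_def state \<rho>_def[symmetric] by (simp add: algebra_simps)
  also have "\<dots> \<le> ((\<rho> + 1) * (2 * C\<^sup>2) * \<epsilon> * ?W) * \<bar>kernel_weight m \<gamma> \<Phi> b v I w J R r \<sigma>\<bar>"
    unfolding abs_mult
  proof (rule mult_right_mono)
    have "\<bar>\<rho> * (f 1 v1 I1 * f 2 v2 I2 - g 1 v1 I1 * g 2 v2 I2) - (f 3 v I * f 4 w J - g 3 v I * g 4 w J)\<bar>
        \<le> \<rho> * \<bar>f 1 v1 I1 * f 2 v2 I2 - g 1 v1 I1 * g 2 v2 I2\<bar> + \<bar>f 3 v I * f 4 w J - g 3 v I * g 4 w J\<bar>"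
      using \<rho> by (metis abs_mult abs_of_nonneg abs_triangle_ineq4)
    also have "\<dots> \<le> \<rho> * (2 * C\<^sup>2 * \<epsilon> * ?W) + 2 * C\<^sup>2 * \<epsilon> * ?W"
      by (intro add_mono mult_left_mono gain loss \<rho>)
    also have "\<dots> = (\<rho> + 1) * (2 * C\<^sup>2) * \<epsilon> * ?W" by (simp add: algebra_simps)
    finally show "\<bar>\<rho> * (f 1 v1 I1 * f 2 v2 I2 - g 1 v1 I1 * g 2 v2 I2) - (f 3 v I * f 4 w J - g 3 v I * g 4 w J)\<bar>
        \<le> (\<rho> + 1) * (2 * C\<^sup>2) * \<epsilon> * ?W" .
  qed simp
  finally show ?thesis
    by (simp add: \<rho>_def abs_mult abs_of_pos[OF energy_weight_pos(1)] mult.assoc)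
qed

end

section \<open>Asymptotics of the reaction rate\<close>

locale reaction_mixture = reaction_kernel +
  fixes \<phi> :: "nat \<Rightarrow> real \<Rightarrow> real"
  assumes weight: "\<And>i. i \<in> {1..4} \<Longrightarrow> internal_weight kB (\<phi> i)"
begin

text \<open>The operator divides by \<open>\<phi> 3 I\<close> and the moment multiplies by it; both
  cancel almost everywhere, and Fubini turns the iterated integral into one over the product
  space.\<close>

lemma moment_Q_react_backward:
  assumes eq: "\<And>k v I. k \<in> {1..4} \<Longrightarrow> 0 \<le> I \<Longrightarrow> f k v I = g k v I"
    and int: "integrable two_particle_measure (backward_integrand m E \<gamma> \<Phi> b g)"
    and conv: "moment_converges (\<phi> 3) (Q_react m E \<phi> \<gamma> \<Phi> b f 3)"
  shows "moment (\<phi> 3) (Q_react m E \<phi> \<gamma> \<Phi> b f 3)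
    = integral\<^sup>L two_particle_measure (backward_integrand m E \<gamma> \<Phi> b g)"
proof -
  interpret w3: internal_weight kB "\<phi> 3" by (rule weight) simp
  interpret S: sigma_finite_measure state_measure by (rule sigma_finite_state_measure)
  interpret C: sigma_finite_measure collision_measure by (rule sigma_finite_collision_measure)
  interpret SC: pair_sigma_finite state_measure collision_measure ..
  let ?J = "\<lambda>z. \<integral>p. backward_integrand m E \<gamma> \<Phi> b g (z, p) \<partial>collision_measure"
  have Q: "Q_react m E \<phi> \<gamma> \<Phi> b f 3 v I = ?J (v, I) / \<phi> 3 I" if "0 \<le> I" for v I
  proof -
    have "Q_react m E \<phi> \<gamma> \<Phi> b f 3 v I
        = (\<integral>p. backward_integrand m E \<gamma> \<Phi> b g ((v, I), p) / \<phi> 3 I \<partial>collision_measure)"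
      unfolding Q_react_def react_integrand_backward
    proof (rule Bochner_Integration.integral_cong)
      fix p assume "p \<in> space collision_measure"
      then have "((v, I), p) \<in> space two_particle_measure"
        using that by (simp add: state_measure_def space_pair_measure)
      then show "backward_integrand m E \<gamma> \<Phi> b f ((v, I), p) / \<phi> 3 I
          = backward_integrand m E \<gamma> \<Phi> b g ((v, I), p) / \<phi> 3 I"
        using backward_integrand_cong[OF _ eq] by simp
    qed simp
    then show ?thesis by simp
  qed
  have J_int: "integrable state_measure ?J"
    by (rule SC.integrable_fst'[OF int])
  have pos: "AE z in state_measure. 0 < \<phi> 3 (snd z)"
    unfolding state_measure_def
    by (rule AE_pair_snd[OF sigma_finite_lborel sigma_finite_half_line _ w3.weight_pos]) measurable
  have "moment (\<phi> 3) (Q_react m E \<phi> \<gamma> \<Phi> b f 3) = (\<integral>z. ?J z \<partial>state_measure)"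
    unfolding moment_def
  proof (rule integral_cong_AE)
    \<comment> \<open>The convergence of the moment is what supplies measurability of this
      integrand.\<close>
    show "(\<lambda>(v, I). Q_react m E \<phi> \<gamma> \<Phi> b f 3 v I * \<phi> 3 I) \<in> borel_measurable state_measure"
      using conv unfolding moment_converges_def by (rule borel_measurable_integrable)
    show "?J \<in> borel_measurable state_measure"
      using J_int by (rule borel_measurable_integrable)
    show "AE z in state_measure. (case z of (v, I) \<Rightarrow> Q_react m E \<phi> \<gamma> \<Phi> b f 3 v I * \<phi> 3 I) = ?J z"
      using pos AE_space
    proof eventually_elim
      case (elim z)
      then have "0 \<le> snd z" by (auto simp: state_measure_def space_pair_measure)
      with elim(1) show ?case by (cases z) (simp add: Q)
    qed
  qed
  then show ?thesis by (simp add: SC.integral_fst'[OF int])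
qed

lemma borel_measurable_backward_maxwellian:
  "backward_integrand m E \<gamma> \<Phi> b (\<lambda>k. maxwellian kB (m k) (\<phi> k) (n k) (\<tau> k) (u k)) \<in> borel_measurable two_particle_measure"
proof -
  note [measurable] = borel_measurable_maxwellian
  show ?thesis
    unfolding backward_integrand_def case_prod_unfold by measurable
qed

text \<open>For Maxwellians at rest with one common temperature the formula for the rate is exact;
  the error term stems solely from drift and temperature differences.\<close>

lemma has_bochner_integral_backward_rest:
  assumes T: "0 < T"
  shows "has_bochner_integral two_particle_measure
    (backward_integrand m E \<gamma> \<Phi> b (\<lambda>k. maxwellian kB (m k) (\<phi> k) (n k) T 0))
    (leading_rate kB m E \<phi> \<gamma> \<Phi> b y T n)"
proof -
  define q where "q = (\<lambda>k. partition_fun kB (\<phi> k) T)"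
  define a where "a = (\<lambda>k. (m k / (2 * pi * kB * T)) powr (3 / 2))"
  define \<rho> where "\<rho> = m 3 * m 4 / (m 1 * m 2)"
  define c where "c = \<rho> powr (3 / 2) * (n 1 * n 2 / (q 1 * q 2)) * exp (- E / (kB * T)) - n 3 * n 4 / (q 3 * q 4)"
  have \<rho>: "0 < \<rho>" using masses by (simp add: \<rho>_def)
  \<comment> \<open>The normalizations satisfy
    \<open>\<rho> powr (3 / 2) * (a 1 * a 2) = a 3 * a 4\<close>, which uses up half of the cube of
    the mass ratio.\<close>
  have mass_factor: "\<rho> ^ 3 * (a 1 * a 2) = \<rho> powr (3 / 2) * (a 3 * a 4)"
  proof -
    have "\<rho> ^ 3 = \<rho> powr (3 / 2) * \<rho> powr (3 / 2)"
      using \<rho> by (simp add: powr_add[symmetric])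
    moreover have "\<rho> powr (3 / 2) * (a 1 * a 2) = a 3 * a 4"
    proof -
      have "\<rho> * (m 1 / (2 * pi * kB * T) * (m 2 / (2 * pi * kB * T))) = m 3 / (2 * pi * kB * T) * (m 4 / (2 * pi * kB * T))"
        using masses by (simp add: \<rho>_def)
      then show ?thesis
        using masses kB T \<rho> unfolding a_def by (simp only: powr_mult[symmetric])
    qed
    ultimately show ?thesis by (simp only: mult.assoc)
  qed
  have "has_bochner_integral two_particle_measure
      (\<lambda>z. c * (\<lambda>((v, I), (w, J, R, r, \<sigma>)). a 3 * a 4
        * (energy_weight T 3 v I * energy_weight T 4 w J * kernel_weight m \<gamma> \<Phi> b v I w J R r \<sigma>)) z)
      (c * (4 / (sqrt pi * (m 3 * m 4)\<^sup>2) * (2 * kB * T / reduced_mass m 3 4) powr ((\<gamma> - 1) / 2)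
       * Gamma ((\<gamma> + 2) / 2) * integral\<^sup>L parameter_measure (rate_integrand kB \<Phi> b y T)))"
    unfolding a_def by (rule has_bochner_integral_mult_right) (rule energy_weight_kernel_integral[OF T])
  moreover have "AE z in two_particle_measure. c * (\<lambda>((v, I), (w, J, R, r, \<sigma>)). a 3 * a 4
        * (energy_weight T 3 v I * energy_weight T 4 w J * kernel_weight m \<gamma> \<Phi> b v I w J R r \<sigma>)) z
      = backward_integrand m E \<gamma> \<Phi> b (\<lambda>k. maxwellian kB (m k) (\<phi> k) (n k) T 0) z"
    using AE_two_particle_measure_norm AE_space
  proof eventually_elim
    case (elim z)
    obtain v I w J R r \<sigma> where z: "z = ((v, I), (w, J, R, r, \<sigma>))" by (cases z) auto
    obtain v1 I1 v2 I2 where state: "backward_state m E ((v, I), (w, J, R, r, \<sigma>)) = ((v1, I1), (v2, I2))"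
      by (metis prod.exhaust)
    let ?W = "energy_weight T 3 v I * energy_weight T 4 w J"
    let ?X = "exp (- E / (kB * T))"
    have M: "maxwellian kB (m k) (\<phi> k) (n k) T 0 v' I' = n k / q k * a k * energy_weight T k v' I'" for k v' I'
      unfolding maxwellian_rest_eq[OF T] q_def a_def ..
    have "energy_weight T 1 v1 I1 * energy_weight T 2 v2 I2 = ?W * ?X"
      using elim unfolding z by (intro backward_energy_weight[OF _ _ state]) auto
    then have "\<rho> ^ 3 * ((n 1 / q 1 * a 1 * energy_weight T 1 v1 I1) * (n 2 / q 2 * a 2 * energy_weight T 2 v2 I2))
        = (\<rho> ^ 3 * (a 1 * a 2)) * (n 1 / q 1 * (n 2 / q 2)) * (?W * ?X)"
      by algebra
    also have "\<dots> = \<rho> powr (3 / 2) * (a 3 * a 4) * (n 1 / q 1 * (n 2 / q 2)) * (?W * ?X)"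
      unfolding mass_factor ..
    finally have gain: "\<rho> ^ 3 * ((n 1 / q 1 * a 1 * energy_weight T 1 v1 I1) * (n 2 / q 2 * a 2 * energy_weight T 2 v2 I2))
        = \<rho> powr (3 / 2) * (n 1 * n 2 / (q 1 * q 2)) * ?X * (a 3 * a 4 * ?W)"
      by (simp add: mult_ac)
    have loss: "(n 3 / q 3 * a 3 * energy_weight T 3 v I) * (n 4 / q 4 * a 4 * energy_weight T 4 w J)
        = n 3 * n 4 / (q 3 * q 4) * (a 3 * a 4 * ?W)"
      by (simp add: mult_ac)
    have "backward_integrand m E \<gamma> \<Phi> b (\<lambda>k. maxwellian kB (m k) (\<phi> k) (n k) T 0) z
        = (\<rho> ^ 3 * ((n 1 / q 1 * a 1 * energy_weight T 1 v1 I1) * (n 2 / q 2 * a 2 * energy_weight T 2 v2 I2))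
           - (n 3 / q 3 * a 3 * energy_weight T 3 v I) * (n 4 / q 4 * a 4 * energy_weight T 4 w J))
          * kernel_weight m \<gamma> \<Phi> b v I w J R r \<sigma>"
      unfolding backward_integrand_def z state M \<rho>_def[symmetric] by simp
    also have "\<dots> = c * (a 3 * a 4 * ?W) * kernel_weight m \<gamma> \<Phi> b v I w J R r \<sigma>"
      unfolding gain loss c_def by (simp add: left_diff_distrib)
    finally show ?case unfolding z by (simp add: mult.assoc)
  qed
  moreover have "(\<lambda>z. c * (\<lambda>((v, I), (w, J, R, r, \<sigma>)). a 3 * a 4
        * (energy_weight T 3 v I * energy_weight T 4 w J * kernel_weight m \<gamma> \<Phi> b v I w J R r \<sigma>)) z)
      \<in> borel_measurable two_particle_measure"
    using integrable_energy_weight_kernel[OF T, THEN borel_measurable_integrable]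
    by (simp add: case_prod_unfold mult.assoc)
  moreover have "leading_rate kB m E \<phi> \<gamma> \<Phi> b y T n
      = c * (4 / (sqrt pi * (m 3 * m 4)\<^sup>2) * (2 * kB * T / reduced_mass m 3 4) powr ((\<gamma> - 1) / 2)
       * Gamma ((\<gamma> + 2) / 2) * integral\<^sup>L parameter_measure (rate_integrand kB \<Phi> b y T))"
    unfolding leading_rate_def Let_def c_def q_def \<rho>_def by (simp only: mult.assoc)
  ultimately show ?thesis
    using borel_measurable_backward_maxwellian[of n "\<lambda>_. T" "\<lambda>_. 0"]
    by (subst has_bochner_integral_cong_AE[symmetric]) auto
qed

text \<open>The comparison state freezes temperature and drift but keeps the densities at the given
  epsilon. The leading rate is therefore taken at \<open>n \<epsilon>\<close>, and the order epsilon
  of the error requires no speed of convergence of the densities.\<close>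

lemma moment_Q_react_asymptotics:
  fixes n \<theta> :: "real \<Rightarrow> nat \<Rightarrow> real" and u :: "real \<Rightarrow> nat \<Rightarrow> vec3" and f :: "real \<Rightarrow> nat \<Rightarrow> vec3 \<Rightarrow> real \<Rightarrow> real"
  assumes T: "0 < T" and \<epsilon>0: "0 < \<epsilon>0"
    and n: "\<And>k. k \<in> {1..4} \<Longrightarrow> (\<lambda>\<epsilon>. n \<epsilon> k) \<in> O[at_right 0](\<lambda>_. 1)"
    and \<theta>: "\<And>k. k \<in> {1..4} \<Longrightarrow> (\<lambda>\<epsilon>. \<theta> \<epsilon> k) \<in> O[at_right 0](\<lambda>_. 1)"
    and u: "\<And>k. k \<in> {1..4} \<Longrightarrow> (\<lambda>\<epsilon>. norm (u \<epsilon> k)) \<in> O[at_right 0](\<lambda>_. 1)"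
    and f: "\<And>\<epsilon> k v I. 0 < \<epsilon> \<Longrightarrow> \<epsilon> < \<epsilon>0 \<Longrightarrow> k \<in> {1..4} \<Longrightarrow> 0 \<le> I \<Longrightarrow>
      f \<epsilon> k v I = maxwellian kB (m k) (\<phi> k) (n \<epsilon> k) (T + \<epsilon> * \<theta> \<epsilon> k) (\<epsilon> *\<^sub>R u \<epsilon> k) v I"
    and conv: "\<And>\<epsilon>. 0 < \<epsilon> \<Longrightarrow> \<epsilon> < \<epsilon>0 \<Longrightarrow> moment_converges (\<phi> 3) (Q_react m E \<phi> \<gamma> \<Phi> b (f \<epsilon>) 3)"
  shows "(\<lambda>\<epsilon>. moment (\<phi> 3) (Q_react m E \<phi> \<gamma> \<Phi> b (f \<epsilon>) 3) - leading_rate kB m E \<phi> \<gamma> \<Phi> b y T (n \<epsilon>))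
    \<in> O[at_right 0](\<lambda>\<epsilon>. \<epsilon>)"
proof -
  define F where "F = (\<lambda>\<epsilon> k. maxwellian kB (m k) (\<phi> k) (n \<epsilon> k) (T + \<epsilon> * \<theta> \<epsilon> k) (\<epsilon> *\<^sub>R u \<epsilon> k))"
  define F0 where "F0 = (\<lambda>\<epsilon> k. maxwellian kB (m k) (\<phi> k) (n \<epsilon> k) T 0)"
  let ?bound = "\<lambda>C \<epsilon> k v I. \<bar>F \<epsilon> k v I - F0 \<epsilon> k v I\<bar> \<le> C * \<epsilon> * energy_weight (2 * T) k v I \<and>
      \<bar>F \<epsilon> k v I\<bar> \<le> C * energy_weight (2 * T) k v I \<and> \<bar>F0 \<epsilon> k v I\<bar> \<le> C * energy_weight (2 * T) k v I"
  have "\<exists>C. \<forall>\<^sub>F \<epsilon> in at_right 0. \<forall>v. \<forall>I\<ge>0. ?bound C \<epsilon> k v I" if k: "k \<in> {1..4}" for k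
  proof -
    interpret w: internal_weight kB "\<phi> k" by (rule weight[OF k])
    \<comment> \<open>The exponent with \<open>2 * kB * T\<close> is read as a Boltzmann factor at
      temperature 2T, for which the kernel integral converges.\<close>
    have "energy_weight (2 * T) k v I = exp (- (m k * (norm v)\<^sup>2 / 2 + I) / (2 * kB * T))" for v I
      by (simp add: energy_weight_def mult_ac)
    then show ?thesis
      using w.maxwellian_perturbation[OF mass_pos[OF k] T n[OF k] \<theta>[OF k] u[OF k]]
      by (simp only: F_def F0_def)
  qed
  then have "\<forall>k\<in>{1..4}. \<exists>C. \<forall>\<^sub>F \<epsilon> in at_right 0. \<forall>v. \<forall>I\<ge>0. ?bound C \<epsilon> k v I"
    by (intro ballI)
  then have "\<exists>Ck. \<forall>k\<in>{1..4}. \<forall>\<^sub>F \<epsilon> in at_right 0. \<forall>v. \<forall>I\<ge>0. ?bound (Ck k) \<epsilon> k v I"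
    by (rule bchoice)
  then obtain Ck where Ck: "\<forall>k\<in>{1..4}. \<forall>\<^sub>F \<epsilon> in at_right 0. \<forall>v. \<forall>I\<ge>0. ?bound (Ck k) \<epsilon> k v I"
    by (rule exE)
  define C where "C = (\<Sum>k\<in>{1..4}. \<bar>Ck k\<bar>)"
  have C0: "0 \<le> C" by (simp add: C_def sum_nonneg)
  have CkC: "Ck k \<le> C" if "k \<in> {1..4}" for k
    using member_le_sum[of k "{1..4}" "\<lambda>k. \<bar>Ck k\<bar>"] that by (simp add: C_def)
  have ev: "\<forall>\<^sub>F \<epsilon> in at_right 0. \<forall>k\<in>{1..4}. \<forall>v. \<forall>I\<ge>0. ?bound (Ck k) \<epsilon> k v I"
    using Ck by (intro eventually_ball_finite) simp_all
  define K where "K = ((m 3 * m 4 / (m 1 * m 2)) ^ 3 + 1) * (2 * C\<^sup>2)"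
  define D where "D = (\<lambda>((v, I), (w, J, R, r, \<sigma>)). energy_weight (2 * T) 3 v I * energy_weight (2 * T) 4 w J
      * kernel_weight m \<gamma> \<Phi> b v I w J R r \<sigma>)"
  have D: "integrable two_particle_measure (\<lambda>z. \<bar>D z\<bar>)"
    unfolding D_def using T by (intro integrable_abs integrable_energy_weight_kernel) auto
  have "\<forall>\<^sub>F \<epsilon> in at_right 0. 0 < \<epsilon> \<and> \<epsilon> < \<epsilon>0"
    using \<epsilon>0 by (auto simp: eventually_at_right intro!: exI[of _ \<epsilon>0])
  then have "\<forall>\<^sub>F \<epsilon> in at_right 0.
      norm (moment (\<phi> 3) (Q_react m E \<phi> \<gamma> \<Phi> b (f \<epsilon>) 3) - leading_rate kB m E \<phi> \<gamma> \<Phi> b y T (n \<epsilon>))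
        \<le> (K * (\<integral>z. \<bar>D z\<bar> \<partial>two_particle_measure)) * norm \<epsilon>"
    using ev
  proof eventually_elim
    case (elim \<epsilon>)
    then have \<epsilon>: "0 < \<epsilon>" "\<epsilon> < \<epsilon>0" by auto
    let ?B = "backward_integrand m E \<gamma> \<Phi> b"
    have bound: "?bound C \<epsilon> k v I" if "k \<in> {1..4}" "0 \<le> I" for k v I
    proof -
      have "?bound (Ck k) \<epsilon> k v I" using elim that by blast
      moreover have "Ck k * \<epsilon> * energy_weight (2 * T) k v I \<le> C * \<epsilon> * energy_weight (2 * T) k v I"
        "Ck k * energy_weight (2 * T) k v I \<le> C * energy_weight (2 * T) k v I"
        using CkC[OF that(1)] \<epsilon> by (intro mult_right_mono; simp)+
      ultimately show ?thesis by linarith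
    qed
    have diff: "AE z in two_particle_measure. \<bar>?B (F \<epsilon>) z - ?B (F0 \<epsilon>) z\<bar> \<le> K * \<epsilon> * \<bar>D z\<bar>"
      using AE_two_particle_measure_norm AE_space
    proof eventually_elim
      case (elim z)
      obtain v I w J R r \<sigma> where z: "z = ((v, I), (w, J, R, r, \<sigma>))" by (cases z) auto
      show ?case
        unfolding z K_def D_def prod.case
      proof (rule backward_integrand_perturbation)
        show "0 < 2 * T" "0 \<le> \<epsilon>" using T \<epsilon> by auto
        show "((v, I), w, J, R, r, \<sigma>) \<in> space two_particle_measure" "norm \<sigma> = 1"
          using elim z by auto
      qed (rule C0 | rule bound[THEN conjunct1] bound[THEN conjunct2, THEN conjunct1]
            bound[THEN conjunct2, THEN conjunct2] | assumption)+
    qed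
    have meas: "?B (F \<epsilon>) \<in> borel_measurable two_particle_measure"
      unfolding F_def by (rule borel_measurable_backward_maxwellian)
    have rest: "integrable two_particle_measure (?B (F0 \<epsilon>))"
      "integral\<^sup>L two_particle_measure (?B (F0 \<epsilon>)) = leading_rate kB m E \<phi> \<gamma> \<Phi> b y T (n \<epsilon>)"
      using has_bochner_integral_backward_rest[OF T, of "n \<epsilon>"] unfolding F0_def has_bochner_integral_iff by auto
    have KD: "integrable two_particle_measure (\<lambda>z. K * \<epsilon> * \<bar>D z\<bar>)" using D by simp
    \<comment> \<open>The difference is integrable by domination; adding the explicitly known rest
      integrand yields integrability for the actual distributions.\<close>
    have int_diff: "integrable two_particle_measure (\<lambda>z. ?B (F \<epsilon>) z - ?B (F0 \<epsilon>) z)"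
    proof (rule Bochner_Integration.integrable_bound[OF KD])
      show "AE z in two_particle_measure. norm (?B (F \<epsilon>) z - ?B (F0 \<epsilon>) z) \<le> norm (K * \<epsilon> * \<bar>D z\<bar>)"
        using diff by eventually_elim (metis abs_ge_self order_trans real_norm_def)
    qed (use meas rest(1) in auto)
    have int: "integrable two_particle_measure (?B (F \<epsilon>))"
      using Bochner_Integration.integrable_add[OF int_diff rest(1)] by simp
    have "moment (\<phi> 3) (Q_react m E \<phi> \<gamma> \<Phi> b (f \<epsilon>) 3) = integral\<^sup>L two_particle_measure (?B (F \<epsilon>))"
      by (rule moment_Q_react_backward[OF _ int conv]) (use f \<epsilon> in \<open>auto simp: F_def\<close>)
    then have "moment (\<phi> 3) (Q_react m E \<phi> \<gamma> \<Phi> b (f \<epsilon>) 3) - leading_rate kB m E \<phi> \<gamma> \<Phi> b y T (n \<epsilon>)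
        = (\<integral>z. ?B (F \<epsilon>) z - ?B (F0 \<epsilon>) z \<partial>two_particle_measure)"
      using int rest by simp
    then have "norm (moment (\<phi> 3) (Q_react m E \<phi> \<gamma> \<Phi> b (f \<epsilon>) 3) - leading_rate kB m E \<phi> \<gamma> \<Phi> b y T (n \<epsilon>))
        \<le> (\<integral>z. norm (?B (F \<epsilon>) z - ?B (F0 \<epsilon>) z) \<partial>two_particle_measure)"
      by (simp only: integral_norm_bound)
    also have "\<dots> \<le> (\<integral>z. K * \<epsilon> * \<bar>D z\<bar> \<partial>two_particle_measure)"
      using diff by (intro integral_mono_AE integrable_norm int_diff KD) simp
    also have "\<dots> = (K * (\<integral>z. \<bar>D z\<bar> \<partial>two_particle_measure)) * norm \<epsilon>"
      using \<epsilon> by simp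
    finally show ?case .
  qed
  then show ?thesis by (rule bigoI)
qed

end

section \<open>Moment balance of each species and passage to the limit\<close>

theorem lemma10:
  fixes kB E \<gamma> \<epsilon>0 :: real
    and m Eb :: "nat \<Rightarrow> real"
    and \<phi> :: "nat \<Rightarrow> real \<Rightarrow> real"
    and \<Phi> :: "nat \<Rightarrow> nat \<Rightarrow> real \<Rightarrow> real \<Rightarrow> real \<Rightarrow> real \<Rightarrow> real"
    and b :: "nat \<Rightarrow> nat \<Rightarrow> real \<Rightarrow> real"
    and \<Phi>r :: "real \<Rightarrow> real \<Rightarrow> real \<Rightarrow> real \<Rightarrow> real"
    and br :: "real \<Rightarrow> real"
    and \<Omega> :: "vec3 set"
    and f :: "real \<Rightarrow> nat \<Rightarrow> real \<Rightarrow> vec3 \<Rightarrow> vec3 \<Rightarrow> real \<Rightarrow> real"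
    and n\<epsilon> T\<epsilon> :: "real \<Rightarrow> nat \<Rightarrow> real \<Rightarrow> vec3 \<Rightarrow> real"
    and u\<epsilon> :: "real \<Rightarrow> nat \<Rightarrow> real \<Rightarrow> vec3 \<Rightarrow> vec3"
    and T :: "real \<Rightarrow> vec3 \<Rightarrow> real"
    and n :: "nat \<Rightarrow> real \<Rightarrow> vec3 \<Rightarrow> real"
    and u :: "nat \<Rightarrow> real \<Rightarrow> vec3 \<Rightarrow> vec3"
    and y :: vec3
  \<comment> \<open>the mixture; E >= 0 says that the square roots in the backward velocities are real for all R, r;
      the weights are denominators in the collision operators\<close>
  assumes kB: "0 < kB"
    and mass_pos: "\<And>i. i \<in> {1..4} \<Longrightarrow> 0 < m i"
    and mass_cons: "m 1 + m 2 = m 3 + m 4"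
    and heat: "E = reaction_heat Eb" "0 \<le> E"
    and gamma: "1 \<le> \<gamma>"
    and \<Omega>: "open \<Omega>" "bounded \<Omega>"
    and unit: "norm y = 1"
    and weight_nonneg: "\<And>i I. i \<in> {1..4} \<Longrightarrow> 0 \<le> I \<Longrightarrow> 0 \<le> \<phi> i I"
    and weight_pos: "\<And>i. i \<in> {1..4} \<Longrightarrow> AE I in half_line. 0 < \<phi> i I"
  \<comment> \<open>convergence of the integrals\<close>
    and partition_conv: "\<And>i \<tau>. i \<in> {1..4} \<Longrightarrow> 0 < \<tau> \<Longrightarrow>
          integrable half_line (\<lambda>I. \<phi> i I * exp (- I / (kB * \<tau>)))"
    and \<Phi>r_meas: "(\<lambda>(I, J, R, r). \<Phi>r I J R r) \<in> borel_measurable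
          (half_line \<Otimes>\<^sub>M half_line \<Otimes>\<^sub>M unit_interval \<Otimes>\<^sub>M unit_interval)"
    and br_meas: "br \<in> borel_measurable unit_interval"
    and rate_conv: "\<And>\<tau>. 0 < \<tau> \<Longrightarrow> integrable parameter_measure (rate_integrand kB \<Phi>r br y \<tau>)"
    and elastic_conv: "\<And>\<epsilon> i j t x v I.
          \<lbrakk>0 < \<epsilon>; \<epsilon> < \<epsilon>0; i \<in> {1..4}; j \<in> {1..4}; 0 < t; x \<in> \<Omega>; 0 \<le> I; 0 < \<phi> i I\<rbrakk> \<Longrightarrow>
          integrable collision_measure
            (elastic_integrand m \<phi> \<gamma> \<Phi> b i j (f \<epsilon> i t x) (f \<epsilon> j t x) v I)"
    and react_conv: "\<And>\<epsilon> i t x v I.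
          \<lbrakk>0 < \<epsilon>; \<epsilon> < \<epsilon>0; i \<in> {1..4}; 0 < t; x \<in> \<Omega>; 0 \<le> I; 0 < \<phi> i I\<rbrakk> \<Longrightarrow>
          integrable collision_measure
            (react_integrand m E \<phi> \<gamma> \<Phi>r br (\<lambda>k. f \<epsilon> k t x) i v I)"
    and elastic_moment_conv: "\<And>\<epsilon> i j t x.
          \<lbrakk>0 < \<epsilon>; \<epsilon> < \<epsilon>0; i \<in> {1..4}; j \<in> {1..4}; 0 < t; x \<in> \<Omega>\<rbrakk> \<Longrightarrow>
          moment_converges (\<phi> i) (Q_elastic m \<phi> \<gamma> \<Phi> b i j (f \<epsilon> i t x) (f \<epsilon> j t x))"
    and react_moment_conv: "\<And>\<epsilon> i t x.
          \<lbrakk>0 < \<epsilon>; \<epsilon> < \<epsilon>0; i \<in> {1..4}; 0 < t; x \<in> \<Omega>\<rbrakk> \<Longrightarrow>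
          moment_converges (\<phi> i) (Q_react m E \<phi> \<gamma> \<Phi>r br (\<lambda>k. f \<epsilon> k t x) i)"
  \<comment> \<open>consequences of the reversibility of the kernels\<close>
    and elastic_balance: "\<And>\<epsilon> i j t x.
          \<lbrakk>0 < \<epsilon>; \<epsilon> < \<epsilon>0; i \<in> {1..4}; j \<in> {1..4}; 0 < t; x \<in> \<Omega>\<rbrakk> \<Longrightarrow>
          moment (\<phi> i) (Q_elastic m \<phi> \<gamma> \<Phi> b i j (f \<epsilon> i t x) (f \<epsilon> j t x)) = 0"
    and react_balance: "\<And>\<epsilon> t x. \<lbrakk>0 < \<epsilon>; \<epsilon> < \<epsilon>0; 0 < t; x \<in> \<Omega>\<rbrakk> \<Longrightarrow>
          moment (\<phi> 1) (Q_react m E \<phi> \<gamma> \<Phi>r br (\<lambda>k. f \<epsilon> k t x) 1)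
          = moment (\<phi> 2) (Q_react m E \<phi> \<gamma> \<Phi>r br (\<lambda>k. f \<epsilon> k t x) 2) \<and>
          moment (\<phi> 2) (Q_react m E \<phi> \<gamma> \<Phi>r br (\<lambda>k. f \<epsilon> k t x) 2)
          = - moment (\<phi> 3) (Q_react m E \<phi> \<gamma> \<Phi>r br (\<lambda>k. f \<epsilon> k t x) 3) \<and>
          - moment (\<phi> 3) (Q_react m E \<phi> \<gamma> \<Phi>r br (\<lambda>k. f \<epsilon> k t x) 3)
          = - moment (\<phi> 4) (Q_react m E \<phi> \<gamma> \<Phi>r br (\<lambda>k. f \<epsilon> k t x) 4)"
  \<comment> \<open>the scaled kinetic system; the Frechet derivative in direction v is v . grad_x\<close>
    and \<epsilon>0: "0 < \<epsilon>0"
    and kinetic: "\<And>\<epsilon> i t x v I.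
          \<lbrakk>0 < \<epsilon>; \<epsilon> < \<epsilon>0; i \<in> {1..4}; 0 < t; x \<in> \<Omega>; 0 \<le> I; 0 < \<phi> i I\<rbrakk> \<Longrightarrow>
          \<epsilon> * deriv (\<lambda>s. f \<epsilon> i s x v I) t + frechet_derivative (\<lambda>z. f \<epsilon> i t z v I) (at x) v
          = 1 / \<epsilon> * (\<Sum>j = 1..4. Q_elastic m \<phi> \<gamma> \<Phi> b i j (f \<epsilon> i t x) (f \<epsilon> j t x) v I)
            + \<epsilon> * Q_react m E \<phi> \<gamma> \<Phi>r br (\<lambda>k. f \<epsilon> k t x) i v I"
  \<comment> \<open>Maxwellian form\<close>
    and T_pos: "\<And>t x. 0 \<le> t \<Longrightarrow> x \<in> \<Omega> \<Longrightarrow> 0 < T t x"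
    and field_pos: "\<And>\<epsilon> i t x. \<lbrakk>0 < \<epsilon>; \<epsilon> < \<epsilon>0; i \<in> {1..4}; 0 \<le> t; x \<in> \<Omega>\<rbrakk> \<Longrightarrow>
          0 < n\<epsilon> \<epsilon> i t x \<and> 0 < T\<epsilon> \<epsilon> i t x"
    and maxwell: "\<And>\<epsilon> i t x v I.
          \<lbrakk>0 < \<epsilon>; \<epsilon> < \<epsilon>0; i \<in> {1..4}; 0 \<le> t; x \<in> \<Omega>; 0 \<le> I\<rbrakk> \<Longrightarrow>
          f \<epsilon> i t x v I = maxwellian kB (m i) (\<phi> i) (n\<epsilon> \<epsilon> i t x)
            (T t x + \<epsilon> * T\<epsilon> \<epsilon> i t x) (\<epsilon> *\<^sub>R u\<epsilon> \<epsilon> i t x) v I"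
  \<comment> \<open>smoothness of the fields\<close>
    and T_diff: "\<And>t x. 0 < t \<Longrightarrow> x \<in> \<Omega> \<Longrightarrow> (\<lambda>(s, z). T s z) differentiable at (t, x)"
    and field_diff: "\<And>\<epsilon> i t x. \<lbrakk>0 < \<epsilon>; \<epsilon> < \<epsilon>0; i \<in> {1..4}; 0 < t; x \<in> \<Omega>\<rbrakk> \<Longrightarrow>
          (\<lambda>(s, z). n\<epsilon> \<epsilon> i s z) differentiable at (t, x) \<and>
          (\<lambda>(s, z). T\<epsilon> \<epsilon> i s z) differentiable at (t, x) \<and>
          (\<lambda>(s, z). u\<epsilon> \<epsilon> i s z) differentiable at (t, x)"
    and limit_diff: "\<And>i t x. \<lbrakk>i \<in> {1..4}; 0 < t; x \<in> \<Omega>\<rbrakk> \<Longrightarrow>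
          (\<lambda>(s, z). n i s z) differentiable at (t, x) \<and>
          (\<lambda>(s, z). u i s z) differentiable at (t, x)"
  \<comment> \<open>behaviour for small epsilon; the last two: the limit commutes with derivatives\<close>
    and u_bounded: "\<And>i t x. \<lbrakk>i \<in> {1..4}; 0 \<le> t; x \<in> \<Omega>\<rbrakk> \<Longrightarrow>
          (\<lambda>\<epsilon>. norm (u\<epsilon> \<epsilon> i t x)) \<in> O[at_right 0](\<lambda>_. 1)"
    and T_bounded: "\<And>i t x. \<lbrakk>i \<in> {1..4}; 0 \<le> t; x \<in> \<Omega>\<rbrakk> \<Longrightarrow>
          (\<lambda>\<epsilon>. T\<epsilon> \<epsilon> i t x) \<in> O[at_right 0](\<lambda>_. 1)"
    and n_lim: "\<And>i t x. \<lbrakk>i \<in> {1..4}; 0 \<le> t; x \<in> \<Omega>\<rbrakk> \<Longrightarrow>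
          ((\<lambda>\<epsilon>. n\<epsilon> \<epsilon> i t x) \<longlongrightarrow> n i t x) (at_right 0)"
    and u_lim: "\<And>i t x. \<lbrakk>i \<in> {1..4}; 0 \<le> t; x \<in> \<Omega>\<rbrakk> \<Longrightarrow>
          ((\<lambda>\<epsilon>. u\<epsilon> \<epsilon> i t x) \<longlongrightarrow> u i t x) (at_right 0)"
    and dt_lim: "\<And>i t x. \<lbrakk>i \<in> {1..4}; 0 < t; x \<in> \<Omega>\<rbrakk> \<Longrightarrow>
          ((\<lambda>\<epsilon>. deriv (\<lambda>s. n\<epsilon> \<epsilon> i s x) t) \<longlongrightarrow> deriv (\<lambda>s. n i s x) t) (at_right 0)"
    and div_lim: "\<And>i t x. \<lbrakk>i \<in> {1..4}; 0 < t; x \<in> \<Omega>\<rbrakk> \<Longrightarrow>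
          ((\<lambda>\<epsilon>. divergence (\<lambda>z. n\<epsilon> \<epsilon> i t z *\<^sub>R u\<epsilon> \<epsilon> i t z) x)
             \<longlongrightarrow> divergence (\<lambda>z. n i t z *\<^sub>R u i t z) x) (at_right 0)"
  shows "\<exists>A :: real \<Rightarrow> vec3 \<Rightarrow> real. \<exists>A\<epsilon> :: real \<Rightarrow> real \<Rightarrow> vec3 \<Rightarrow> real.
           \<forall>t > 0. \<forall>x \<in> \<Omega>.
             (\<forall>\<epsilon>. 0 < \<epsilon> \<and> \<epsilon> < \<epsilon>0 \<longrightarrow>
                A\<epsilon> \<epsilon> t x = moment (\<phi> 3) (Q_react m E \<phi> \<gamma> \<Phi>r br (\<lambda>k. f \<epsilon> k t x) 3)) \<and>
             (\<lambda>\<epsilon>. A\<epsilon> \<epsilon> t x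
                - leading_rate kB m E \<phi> \<gamma> \<Phi>r br y (T t x) (\<lambda>i. n\<epsilon> \<epsilon> i t x)) \<in> O[at_right 0](\<lambda>\<epsilon>. \<epsilon>) \<and>
             ((\<lambda>\<epsilon>. A\<epsilon> \<epsilon> t x) \<longlongrightarrow> A t x) (at_right 0) \<and>
             (\<forall>i \<in> {1..4}.
                deriv (\<lambda>s. n i s x) t + divergence (\<lambda>z. n i t z *\<^sub>R u i t z) x
                = - stoich i * A t x)"
proof -
  have weight: "internal_weight kB (\<phi> i)" if "i \<in> {1..4}" for i
    by (rule internal_weight.intro)
      (rule kB weight_nonneg[OF that] weight_pos[OF that] partition_conv[OF that]; assumption)+
  interpret reaction_mixture kB E \<gamma> m \<Phi>r br y \<phi>
    by (intro reaction_mixture.intro reaction_kernel.intro reaction_mixture_axioms.intro)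
      (rule kB mass_pos mass_cons heat(2) gamma unit \<Phi>r_meas br_meas rate_conv weight; assumption)+
  let ?react = "\<lambda>\<epsilon> t x i. moment (\<phi> i) (Q_react m E \<phi> \<gamma> \<Phi>r br (\<lambda>k. f \<epsilon> k t x) i)"
  let ?flux = "\<lambda>\<epsilon> i t x. deriv (\<lambda>s. n\<epsilon> \<epsilon> i s x) t + divergence (\<lambda>z. n\<epsilon> \<epsilon> i t z *\<^sub>R u\<epsilon> \<epsilon> i t z) x"
  have balance: "?flux \<epsilon> i t x = ?react \<epsilon> t x i"
    if \<epsilon>: "0 < \<epsilon>" "\<epsilon> < \<epsilon>0" and i: "i \<in> {1..4}" and tx: "0 < t" "x \<in> \<Omega>" for \<epsilon> i t x
  proof -
    interpret w: internal_weight kB "\<phi> i" by (rule weight[OF i])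
    let ?lhs = "\<lambda>(v, I). (\<epsilon> * deriv (\<lambda>s. f \<epsilon> i s x v I) t + frechet_derivative (\<lambda>z. f \<epsilon> i t z v I) (at x) v) * \<phi> i I"
    let ?Qe = "\<lambda>j. Q_elastic m \<phi> \<gamma> \<Phi> b i j (f \<epsilon> i t x) (f \<epsilon> j t x)"
    let ?Qr = "Q_react m E \<phi> \<gamma> \<Phi>r br (\<lambda>k. f \<epsilon> k t x) i"
    let ?rhs = "\<lambda>z. 1 / \<epsilon> * (\<Sum>j = 1..4. case z of (v, I) \<Rightarrow> ?Qe j v I * \<phi> i I) + \<epsilon> * (case z of (v, I) \<Rightarrow> ?Qr v I * \<phi> i I)"
    have lhs: "has_bochner_integral state_measure ?lhs (\<epsilon> * ?flux \<epsilon> i t x)"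
    proof (rule w.maxwellian_field_moment[where S = "{0<..} \<times> \<Omega>" and \<Theta> = "\<lambda>s z. T s z + \<epsilon> * T\<epsilon> \<epsilon> i s z"])
      show "0 < m i" by (rule mass_pos[OF i])
      show "0 < T t x + \<epsilon> * T\<epsilon> \<epsilon> i t x"
        using T_pos[of t x] field_pos[OF \<epsilon> i, of t x] tx \<epsilon> by (simp add: add_pos_pos)
      note diff = field_diff[OF \<epsilon> i tx]
      show "(\<lambda>(s, z). n\<epsilon> \<epsilon> i s z) differentiable at (t, x)" "(\<lambda>(s, z). u\<epsilon> \<epsilon> i s z) differentiable at (t, x)"
        using diff by auto
      have "(\<lambda>p. (case p of (s, z) \<Rightarrow> T s z) + \<epsilon> * (case p of (s, z) \<Rightarrow> T\<epsilon> \<epsilon> i s z)) differentiable at (t, x)"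
        using diff T_diff[OF tx] by (intro differentiable_add differentiable_mult differentiable_const) auto
      then show "(\<lambda>(s, z). T s z + \<epsilon> * T\<epsilon> \<epsilon> i s z) differentiable at (t, x)"
        by (simp add: case_prod_unfold)
      show "open ({(0 :: real)<..} \<times> \<Omega>)" "(t, x) \<in> {0<..} \<times> \<Omega>"
        using tx by (auto intro!: open_Times open_greaterThan \<Omega>(1))
      show "f \<epsilon> i s z v I = maxwellian kB (m i) (\<phi> i) (n\<epsilon> \<epsilon> i s z) (T s z + \<epsilon> * T\<epsilon> \<epsilon> i s z) (\<epsilon> *\<^sub>R u\<epsilon> \<epsilon> i s z) v I"
        if "(s, z) \<in> {0<..} \<times> \<Omega>" "0 \<le> I" for s z v I
        using that by (intro maxwell \<epsilon> i) auto
    qed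
    have rhs: "has_bochner_integral state_measure ?rhs (1 / \<epsilon> * (\<Sum>j = 1..4. moment (\<phi> i) (?Qe j)) + \<epsilon> * ?react \<epsilon> t x i)"
      using elastic_moment_conv[OF \<epsilon> i _ tx] react_moment_conv[OF \<epsilon> i tx]
      unfolding moment_def moment_converges_def
      by (intro has_bochner_integral_add has_bochner_integral_mult_right has_bochner_integral_sum has_bochner_integral_integrable)
    \<comment> \<open>The kinetic equation is available only where the weight is positive, so the
      two sides are compared almost everywhere.\<close>
    have "AE z in state_measure. 0 < \<phi> i (snd z)"
      unfolding state_measure_def
      by (rule AE_pair_snd[OF sigma_finite_lborel sigma_finite_half_line _ w.weight_pos]) measurable
    then have "AE z in state_measure. ?lhs z = ?rhs z"
      using AE_space
    proof eventually_elim
      case (elim z)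
      obtain v I where z: "z = (v, I)" by (cases z)
      have "0 \<le> I" "0 < \<phi> i I" using elim z by (auto simp: state_measure_def space_pair_measure)
      then show ?case
        unfolding z prod.case kinetic[OF \<epsilon> i tx \<open>0 \<le> I\<close> \<open>0 < \<phi> i I\<close>]
        by (simp add: distrib_right sum_distrib_right)
    qed
    then have "integral\<^sup>L state_measure ?lhs = integral\<^sup>L state_measure ?rhs"
      using lhs rhs by (intro integral_cong_AE) (auto simp: has_bochner_integral_iff)
    then have "\<epsilon> * ?flux \<epsilon> i t x = 1 / \<epsilon> * (\<Sum>j = 1..4. moment (\<phi> i) (?Qe j)) + \<epsilon> * ?react \<epsilon> t x i"
      using has_bochner_integral_integral_eq[OF lhs] has_bochner_integral_integral_eq[OF rhs] by (simp only:)
    also have "(\<Sum>j = 1..4. moment (\<phi> i) (?Qe j)) = 0"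
      by (intro sum.neutral ballI elastic_balance[OF \<epsilon> i _ tx])
    finally show ?thesis using \<epsilon> by simp
  qed
  have small: "\<forall>\<^sub>F \<epsilon> in at_right 0. 0 < \<epsilon> \<and> \<epsilon> < \<epsilon>0"
    using \<epsilon>0 by (auto simp: eventually_at_right intro!: exI[of _ \<epsilon>0])
  have limit: "((\<lambda>\<epsilon>. ?react \<epsilon> t x i) \<longlongrightarrow> deriv (\<lambda>s. n i s x) t + divergence (\<lambda>z. n i t z *\<^sub>R u i t z) x) (at_right 0)"
    if i: "i \<in> {1..4}" and tx: "0 < t" "x \<in> \<Omega>" for i t x
  proof (rule Lim_transform_eventually)
    show "((\<lambda>\<epsilon>. ?flux \<epsilon> i t x) \<longlongrightarrow> deriv (\<lambda>s. n i s x) t + divergence (\<lambda>z. n i t z *\<^sub>R u i t z) x) (at_right 0)"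
      by (intro tendsto_add dt_lim div_lim i tx)
    show "\<forall>\<^sub>F \<epsilon> in at_right 0. ?flux \<epsilon> i t x = ?react \<epsilon> t x i"
      using small by eventually_elim (intro balance i tx; simp)
  qed
  \<comment> \<open>The limiting rate is the transport side of species 3; the assumed limits of its
    derivatives are what makes the reactive moment converge to it.\<close>
  define A where "A = (\<lambda>t x. deriv (\<lambda>s. n 3 s x) t + divergence (\<lambda>z. n 3 t z *\<^sub>R u 3 t z) x)"
  have species: "deriv (\<lambda>s. n i s x) t + divergence (\<lambda>z. n i t z *\<^sub>R u i t z) x = - stoich i * A t x"
    if i: "i \<in> {1..4}" and tx: "0 < t" "x \<in> \<Omega>" for i t x
  proof (rule tendsto_unique[OF _ limit[OF i tx]])
    have "((\<lambda>\<epsilon>. - stoich i * ?react \<epsilon> t x 3) \<longlongrightarrow> - stoich i * A t x) (at_right 0)"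
      unfolding A_def by (intro tendsto_mult tendsto_const limit tx) simp
    \<comment> \<open>Reversibility gives species 4 the moment of species 3, and species 1 and 2 its
      negative; the factor \<open>- stoich i\<close> records these signs.\<close>
    moreover have "\<forall>\<^sub>F \<epsilon> in at_right 0. - stoich i * ?react \<epsilon> t x 3 = ?react \<epsilon> t x i"
      using small
    proof eventually_elim
      case (elim \<epsilon>)
      have "i = 1 \<or> i = 2 \<or> i = 3 \<or> i = 4" using i by auto
      then show ?case
        using react_balance[of \<epsilon> t x] elim tx by (elim disjE) (simp_all add: stoich_def)
    qed
    ultimately show "((\<lambda>\<epsilon>. ?react \<epsilon> t x i) \<longlongrightarrow> - stoich i * A t x) (at_right 0)"
      by (rule Lim_transform_eventually)
  qed simp
  have asymptotics: "(\<lambda>\<epsilon>. ?react \<epsilon> t x 3 - leading_rate kB m E \<phi> \<gamma> \<Phi>r br y (T t x) (\<lambda>i. n\<epsilon> \<epsilon> i t x)) \<in> O[at_right 0](\<lambda>\<epsilon>. \<epsilon>)"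
    if tx: "0 < t" "x \<in> \<Omega>" for t x
  proof (rule moment_Q_react_asymptotics[where \<theta> = "\<lambda>\<epsilon> k. T\<epsilon> \<epsilon> k t x" and u = "\<lambda>\<epsilon> k. u\<epsilon> \<epsilon> k t x"])
    have t: "0 \<le> t" using tx by simp
    show "0 < T t x" "0 < \<epsilon>0" by (fact T_pos[OF t tx(2)] \<epsilon>0)+
    fix k :: nat assume k: "k \<in> {1..4}"
    show "(\<lambda>\<epsilon>. n\<epsilon> \<epsilon> k t x) \<in> O[at_right 0](\<lambda>_. 1)"
      using n_lim[OF k t tx(2)] by (intro bigoI_tendsto[where c = "n k t x"]) auto
    show "(\<lambda>\<epsilon>. T\<epsilon> \<epsilon> k t x) \<in> O[at_right 0](\<lambda>_. 1)" "(\<lambda>\<epsilon>. norm (u\<epsilon> \<epsilon> k t x)) \<in> O[at_right 0](\<lambda>_. 1)"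
      by (fact T_bounded[OF k t tx(2)] u_bounded[OF k t tx(2)])+
    fix \<epsilon> v I assume "0 < \<epsilon>" "\<epsilon> < \<epsilon>0" "(0 :: real) \<le> I"
    then show "f \<epsilon> k t x v I = maxwellian kB (m k) (\<phi> k) (n\<epsilon> \<epsilon> k t x) (T t x + \<epsilon> * T\<epsilon> \<epsilon> k t x) (\<epsilon> *\<^sub>R u\<epsilon> \<epsilon> k t x) v I"
      by (intro maxwell k t tx)
  next
    fix \<epsilon> assume "0 < \<epsilon>" "\<epsilon> < \<epsilon>0"
    then show "moment_converges (\<phi> 3) (Q_react m E \<phi> \<gamma> \<Phi>r br (\<lambda>k. f \<epsilon> k t x) 3)"
      by (intro react_moment_conv tx) auto
  qed
  show ?thesis
  proof (intro exI[of _ A] exI[of _ "\<lambda>\<epsilon> t x. ?react \<epsilon> t x 3"] allI impI ballI conjI)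
    fix t x assume tx: "(0 :: real) < t" "x \<in> \<Omega>"
    show "(\<lambda>\<epsilon>. ?react \<epsilon> t x 3 - leading_rate kB m E \<phi> \<gamma> \<Phi>r br y (T t x) (\<lambda>i. n\<epsilon> \<epsilon> i t x)) \<in> O[at_right 0](\<lambda>\<epsilon>. \<epsilon>)"
      by (rule asymptotics[OF tx])
    show "((\<lambda>\<epsilon>. ?react \<epsilon> t x 3) \<longlongrightarrow> A t x) (at_right 0)"
      unfolding A_def by (rule limit[OF _ tx]) simp
    show "deriv (\<lambda>s. n i s x) t + divergence (\<lambda>z. n i t z *\<^sub>R u i t z) x = - stoich i * A t x"
      if "i \<in> {1..4}" for i
      by (rule species[OF that tx])
  qed simp
qed

end
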